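(* Let $G$ and $H$ be infinite finitely generated residually finite groups. Let $X$ and $Y$ be free exact odometers of $G$ and $H$, respectively. Then the following statements are equivalent: (1) $[[L_X]]\cong [[L_Y]]$ (as abstract groups). (2) $[[R_X]]\cong [[R_Y]]$ (as abstract groups). (3) There exist clopen subgroups $U_1\subseteq X$ and $U_2\subseteq Y$ such that $U_1$ and $U_2$ are isomorphic as topological groups and $[X:U_1]=[Y:U_2]<\infty$.
   Context: Let $G$ be a countable group. A scale of $G$ is a decreasing sequence $(\Gamma_n)_{n\in\mathbb{N}}$ of normal finite-index subgroups of $G$ with $\bigcap_n\Gamma_n=\{1_G\}$. The free exact odometer associated with the scale is $X=G_{(\Gamma_n)}=\{(x_n)_n\in\prod_n G/\Gamma_n : x_{n+1}\mapsto x_n \text{ under } G/\Gamma_{n+1}\to G/\Gamma_n \text{ for all } n\}$, a subgroup of the product group with the topology induced by the product of the discrete topologies; it is a compact metrizable totally disconnected topological group. A free exact odometer of $G$ is one associated with some scale of $G$. $L_X$ and $R_X$ are the left actions of the group $X$ on the space $X$ given by $L_X^{\xi}(x)=\xi x$ and $R_X^{\xi}(x)=x\xi^{-1}$ for $\xi,x\in X$. For an action $\alpha$ of a (not necessarily countable) group $K$ by homeomorphisms on a compact totally disconnected metrizable space $Z$, the topological full group $[[\alpha]]$ is the group (under composition) of all homeomorphisms $f$ of $Z$ for which there exist a finite clopen partition $\{A_1,\dots,A_k\}$ of $Z$ and $g_1,\dots,g_k\in K$ with $f(y)=\alpha^{g_i}(y)$ for all $y\in A_i$, $1\le i\le k$.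 *)

theory Defs
  imports "HOL-Analysis.Analysis" "HOL-Algebra.Bij" "HOL-Algebra.Generated_Groups" "HOL-Algebra.Product_Groups"
begin

definition finitely_generated_group :: "('a, 'm) monoid_scheme \<Rightarrow> bool" where
  "finitely_generated_group G \<longleftrightarrow>
     (\<exists>S \<subseteq> carrier G. finite S \<and> generate G S = carrier G)"

definition residually_finite_group :: "('a, 'm) monoid_scheme \<Rightarrow> bool" where
  "residually_finite_group G \<longleftrightarrow>
     (\<forall>g \<in> carrier G - {\<one>\<^bsub>G\<^esub>}. \<exists>N. N \<lhd> G \<and> finite (rcosets\<^bsub>G\<^esub> N) \<and> g \<notin> N)"

definition group_scale :: "('a, 'm) monoid_scheme \<Rightarrow> (nat \<Rightarrow> 'a set) \<Rightarrow> bool" where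
  "group_scale G \<Gamma> \<longleftrightarrow>
     (\<forall>n. \<Gamma> n \<lhd> G \<and> finite (rcosets\<^bsub>G\<^esub> (\<Gamma> n))) \<and>
     decseq \<Gamma> \<and>
     (\<Inter>n. \<Gamma> n) = {\<one>\<^bsub>G\<^esub>}"

text \<open>
  For normal subgroups \<open>M \<subseteq> N\<close> of \<open>G\<close>, the canonical map from \<open>G Mod M\<close> to \<open>G Mod N\<close>
  sends a coset \<open>C\<close> to the product set \<open>N C\<close>; see \<open>quotient_proj_rcoset\<close> below.
\<close>

definition quotient_proj :: "('a, 'm) monoid_scheme \<Rightarrow> 'a set \<Rightarrow> 'a set \<Rightarrow> 'a set" where
  "quotient_proj G N C = N <#>\<^bsub>G\<^esub> C"

lemma quotient_proj_rcoset:
  assumes "M \<lhd> G" "N \<lhd> G" "M \<subseteq> N" "g \<in> carrier G"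
  shows "quotient_proj G N (M #>\<^bsub>G\<^esub> g) = N #>\<^bsub>G\<^esub> g"
proof -
  interpret M: normal M G by fact
  interpret N: normal N G by fact
  have "N <#>\<^bsub>G\<^esub> (M #>\<^bsub>G\<^esub> g) = (N <#>\<^bsub>G\<^esub> M) #>\<^bsub>G\<^esub> g"
    using assms M.subset N.subset by (simp add: M.setmult_rcos_assoc)
  also have "N <#>\<^bsub>G\<^esub> M = N"
    using assms(3) M.one_closed N.m_closed N.subset
    by (force simp: set_mult_def subset_iff)
  finally show ?thesis by (simp add: quotient_proj_def)
qed

definition odometer_space :: "('a, 'm) monoid_scheme \<Rightarrow> (nat \<Rightarrow> 'a set) \<Rightarrow> (nat \<Rightarrow> 'a set) set" where
  "odometer_space G \<Gamma> =
     {x \<in> (\<Pi>\<^sub>E n\<in>UNIV. carrier (G Mod \<Gamma> n)). \<forall>n. quotient_proj G (\<Gamma> n) (x (Suc n)) = x n}"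

definition odometer :: "('a, 'm) monoid_scheme \<Rightarrow> (nat \<Rightarrow> 'a set) \<Rightarrow> (nat \<Rightarrow> 'a set) monoid" where
  "odometer G \<Gamma> =
     (product_group UNIV (\<lambda>n. G Mod \<Gamma> n)) \<lparr>carrier := odometer_space G \<Gamma>\<rparr>"

definition odometer_topology ::
    "('a, 'm) monoid_scheme \<Rightarrow> (nat \<Rightarrow> 'a set) \<Rightarrow> (nat \<Rightarrow> 'a set) topology" where
  "odometer_topology G \<Gamma> =
     subtopology
       (product_topology (\<lambda>n. discrete_topology (carrier (G Mod \<Gamma> n))) UNIV)
       (odometer_space G \<Gamma>)"

definition left_action :: "('x, 'm) monoid_scheme \<Rightarrow> 'x \<Rightarrow> 'x \<Rightarrow> 'x" where
  "left_action B \<xi> x = \<xi> \<otimes>\<^bsub>B\<^esub> x"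

definition right_action :: "('x, 'm) monoid_scheme \<Rightarrow> 'x \<Rightarrow> 'x \<Rightarrow> 'x" where
  "right_action B \<xi> x = x \<otimes>\<^bsub>B\<^esub> inv\<^bsub>B\<^esub> \<xi>"

text \<open>
  Self-maps of the space \<open>Z\<close> are represented as in \<^const>\<open>BijGroup\<close>: they are extensional, so
  that equality of maps is equality on \<open>topspace Z\<close>. In \<open>topological_full_group Z K \<alpha>\<close> the set \<open>K\<close> is the
  carrier of the acting group.
\<close>

definition topological_full_group_set :: "'z topology \<Rightarrow> 'k set \<Rightarrow> ('k \<Rightarrow> 'z \<Rightarrow> 'z) \<Rightarrow> ('z \<Rightarrow> 'z) set" where
  "topological_full_group_set Z K \<alpha> =
     {f \<in> Bij (topspace Z). homeomorphic_map Z Z f \<and>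
        (\<exists>P. finite P \<and> partition_on (topspace Z) P \<and>
             (\<forall>A\<in>P. openin Z A \<and> closedin Z A \<and> (\<exists>g\<in>K. \<forall>y\<in>A. f y = \<alpha> g y)))}"

definition topological_full_group :: "'z topology \<Rightarrow> 'k set \<Rightarrow> ('k \<Rightarrow> 'z \<Rightarrow> 'z) \<Rightarrow> ('z \<Rightarrow> 'z) monoid" where
  "topological_full_group Z K \<alpha> = (BijGroup (topspace Z)) \<lparr>carrier := topological_full_group_set Z K \<alpha>\<rparr>"

definition clopen_subgroup :: "'x set \<Rightarrow> ('x, 'm) monoid_scheme \<Rightarrow> 'x topology \<Rightarrow> bool" where
  "clopen_subgroup U B S \<longleftrightarrow> subgroup U B \<and> openin S U \<and> closedin S U"

definition topological_group_isomorphic ::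
    "('x, 'm) monoid_scheme \<Rightarrow> 'x topology \<Rightarrow> ('y, 'n) monoid_scheme \<Rightarrow> 'y topology \<Rightarrow> bool" where
  "topological_group_isomorphic B S C T \<longleftrightarrow> (\<exists>\<phi> \<in> iso B C. homeomorphic_map S T \<phi>)"

end

theory Submission
  imports Defs
begin

text \<open>
  An element of \<open>[[L_X]]\<close> is a bijection of \<open>X\<close> that commutes with right multiplication by a small open
  normal subgroup. Hence an isomorphism of clopen subgroups of equal index, extended over left cosets,
  conjugates \<open>[[L_X]]\<close> to \<open>[[L_Y]]\<close>; and inversion conjugates \<open>[[L_X]]\<close> to \<open>[[R_X]]\<close>.

  Conversely, as in Fremlin's treatment of groups with many involutions, for an involution \<open>p\<close> the set of
  elements supported in the support of \<open>p\<close> is definable in purely group-theoretic terms, so an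
  isomorphism \<open>[[L_X]] \<cong> [[L_Y]]\<close> is conjugation by a homeomorphism \<open>f\<close>. For each \<open>z\<close> the cocycle
  \<open>f (z x) (f x)\<^sup>-\<^sup>1\<close> is then uniformly locally constant in \<open>x\<close>, and Baire's theorem makes
  this uniform over \<open>z\<close> in an open normal subgroup \<open>U\<close>. On \<open>U\<close> the map \<open>x \<mapsto> f x (f 1)\<^sup>-\<^sup>1\<close> is an
  isomorphism onto a clopen subgroup \<open>U'\<close>. The indices agree because the sets \<open>f (x U)\<close> partition \<open>Y\<close> and
  are images of the coset \<open>U' f 1\<close> under elements of \<open>[[L_Y]]\<close>, which preserve Haar measure.
\<close>

section \<open>An algebraic description of supports\<close>

text \<open>No continuity is given for the abstract isomorphism, so points have to be recovered from
  algebra. The lever is squaring. An element commuting with all flips of \<open>p\<close> acts on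
  the support of \<open>p\<close> pointwise as the identity or as \<open>p\<close>, so its square is
  trivial there. Off the support, every element with small support commutes with all flips, and some
  of these have squares that move a given point. Hence commuting with all these squares means fixing
  everything outside the support of \<open>p\<close>. A swap of two clopen sets has trivial square,
  so 3-cycles of points are needed inside every nonempty clopen set; infinitude of the groups
  provides them. Supports of involutions then form bases of the two spaces, and points are matched
  through the supports containing them. The resulting \<open>f\<close> turns the left translation by
  \<open>z\<close> into a map commuting with right translations by an open subgroup that depends on
  \<open>z\<close>; the remaining work is to remove this dependence.\<close>

abbreviation clopenin :: "'x topology \<Rightarrow> 'x set \<Rightarrow> bool" where
  "clopenin T A \<equiv> openin T A \<and> closedin T A"

text \<open>When \<open>p\<close> is an involution, the next three sets turn out to be: the maps agreeing at each point with \<open>p\<close> or the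
  identity, their centralizer, and the maps whose support is contained in that of \<open>p\<close>.\<close>

definition commuting_flips :: "('g, 'm) monoid_scheme \<Rightarrow> 'g \<Rightarrow> 'g set" where
  "commuting_flips K p =
     {a \<in> carrier K. a \<otimes>\<^bsub>K\<^esub> p = p \<otimes>\<^bsub>K\<^esub> a \<and> a \<otimes>\<^bsub>K\<^esub> a = \<one>\<^bsub>K\<^esub> \<and>
        (\<forall>b\<in>carrier K. b \<otimes>\<^bsub>K\<^esub> p = p \<otimes>\<^bsub>K\<^esub> b \<longrightarrow>
           a \<otimes>\<^bsub>K\<^esub> (b \<otimes>\<^bsub>K\<^esub> a \<otimes>\<^bsub>K\<^esub> inv\<^bsub>K\<^esub> b) = (b \<otimes>\<^bsub>K\<^esub> a \<otimes>\<^bsub>K\<^esub> inv\<^bsub>K\<^esub> b) \<otimes>\<^bsub>K\<^esub> a)}"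

definition flip_centralizer :: "('g, 'm) monoid_scheme \<Rightarrow> 'g \<Rightarrow> 'g set" where
  "flip_centralizer K p =
     {a \<in> carrier K. \<forall>b\<in>commuting_flips K p. a \<otimes>\<^bsub>K\<^esub> b = b \<otimes>\<^bsub>K\<^esub> a}"

definition support_subgroup :: "('g, 'm) monoid_scheme \<Rightarrow> 'g \<Rightarrow> 'g set" where
  "support_subgroup K p =
     {a \<in> carrier K. \<forall>b\<in>flip_centralizer K p.
        a \<otimes>\<^bsub>K\<^esub> (b \<otimes>\<^bsub>K\<^esub> b) = (b \<otimes>\<^bsub>K\<^esub> b) \<otimes>\<^bsub>K\<^esub> a}"

section \<open>Invariance of the three sets under group isomorphisms\<close>

context group_hom
begin

lemma iso_mult_eq_iff:
  assumes "h \<in> iso G H" "a \<in> carrier G" "b \<in> carrier G"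
  shows "h a = h b \<longleftrightarrow> a = b"
  using assms by (auto simp: iso_def bij_betw_def inj_on_def)

lemma iso_ball_carrier:
  assumes "h \<in> iso G H"
  shows "(\<forall>b\<in>carrier H. P b) \<longleftrightarrow> (\<forall>b\<in>carrier G. P (h b))"
  using assms by (force simp: iso_def bij_betw_def)

text \<open>The injective homomorphism \<open>h\<close> preserves and reflects equations between
  words; surjectivity lets the quantifier over the carrier of \<open>H\<close> be replaced by one
  over the carrier of \<open>G\<close>.\<close>

lemma iso_commuting_flips:
  assumes h: "h \<in> iso G H" and p: "p \<in> carrier G" and a: "a \<in> carrier G"
  shows "h a \<in> commuting_flips H (h p) \<longleftrightarrow> a \<in> commuting_flips G p"
proof -
  have *: "x \<in> carrier G \<Longrightarrow> y \<in> carrier G \<Longrightarrow> h x \<otimes>\<^bsub>H\<^esub> h y = h (x \<otimes> y)" for x y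
    by simp
  have inv: "x \<in> carrier G \<Longrightarrow> inv\<^bsub>H\<^esub> h x = h (inv x)" for x
    by simp
  show ?thesis
    unfolding commuting_flips_def iso_ball_carrier[OF h]
    \<comment> \<open>The homomorphism rules are used from right to left: each side collapses to a
      single value of \<open>h\<close>, and then \<open>h\<close> cancels by injectivity.\<close>
    using p a by (simp del: hom_mult hom_inv hom_one
      add: * inv hom_one[symmetric] iso_mult_eq_iff[OF h] cong: ball_cong)
qed

lemma iso_flip_centralizer:
  assumes h: "h \<in> iso G H" and p: "p \<in> carrier G" and a: "a \<in> carrier G"
  shows "h a \<in> flip_centralizer H (h p) \<longleftrightarrow> a \<in> flip_centralizer G p"
proof -
  have *: "x \<in> carrier G \<Longrightarrow> y \<in> carrier G \<Longrightarrow> h x \<otimes>\<^bsub>H\<^esub> h y = h (x \<otimes> y)" for x y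
    by simp
  \<comment> \<open>The bounded quantifier is widened to the whole carrier, the range over which
    \<open>iso_ball_carrier\<close> can move it.\<close>
  have alt: "flip_centralizer K q = {a \<in> carrier K. \<forall>b\<in>carrier K.
      b \<in> commuting_flips K q \<longrightarrow> a \<otimes>\<^bsub>K\<^esub> b = b \<otimes>\<^bsub>K\<^esub> a}" for K :: "('x, 'y) monoid_scheme" and q
    by (auto simp: flip_centralizer_def commuting_flips_def)
  show ?thesis
    unfolding alt iso_ball_carrier[OF h]
    using p a by (simp del: hom_mult
      add: * iso_mult_eq_iff[OF h] iso_commuting_flips[OF h] cong: ball_cong)
qed

lemma iso_support_subgroup:
  assumes h: "h \<in> iso G H" and p: "p \<in> carrier G" and a: "a \<in> carrier G"
  shows "h a \<in> support_subgroup H (h p) \<longleftrightarrow> a \<in> support_subgroup G p"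
proof -
  have *: "x \<in> carrier G \<Longrightarrow> y \<in> carrier G \<Longrightarrow> h x \<otimes>\<^bsub>H\<^esub> h y = h (x \<otimes> y)" for x y
    by simp
  have alt: "support_subgroup K q = {a \<in> carrier K. \<forall>b\<in>carrier K.
      b \<in> flip_centralizer K q \<longrightarrow> a \<otimes>\<^bsub>K\<^esub> (b \<otimes>\<^bsub>K\<^esub> b) = (b \<otimes>\<^bsub>K\<^esub> b) \<otimes>\<^bsub>K\<^esub> a}"
    for K :: "('x, 'y) monoid_scheme" and q
    by (auto simp: support_subgroup_def flip_centralizer_def)
  show ?thesis
    unfolding alt iso_ball_carrier[OF h]
    using p a by (simp del: hom_mult
      add: * iso_mult_eq_iff[OF h] iso_flip_centralizer[OF h] cong: ball_cong)
qed

end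

text \<open>The interface through which the reconstruction sees a full group. \<open>swap\<close> is
  closure under cut and paste: \<open>g\<close> on \<open>A\<close>, its inverse on the image of
  \<open>A\<close>, the identity elsewhere. \<open>local_square\<close> asks for more than a local
  swap, since swaps have trivial squares. Supports are clopen in a full group because an element
  commuting with small right translations moves all or none of a small coset.\<close>

locale rich_action = group K for K :: "('g, 'm) monoid_scheme" (structure) +
  fixes T :: "'x topology" and act :: "'g \<Rightarrow> 'x \<Rightarrow> 'x"  (infixr \<open>\<cdot>\<close> 75)
  assumes act_closed [simp]: "g \<in> carrier K \<Longrightarrow> x \<in> topspace T \<Longrightarrow> g \<cdot> x \<in> topspace T"
    and act_one [simp]: "x \<in> topspace T \<Longrightarrow> \<one> \<cdot> x = x"
    and act_mult [simp]: "g \<in> carrier K \<Longrightarrow> h \<in> carrier K \<Longrightarrow> x \<in> topspace T \<Longrightarrow> (g \<otimes> h) \<cdot> x = g \<cdot> h \<cdot> x"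
    and faithful: "g \<in> carrier K \<Longrightarrow> (\<And>x. x \<in> topspace T \<Longrightarrow> g \<cdot> x = x) \<Longrightarrow> g = \<one>"
    and compact: "compact_space T"
    and Hausdorff: "Hausdorff_space T"
    and clopen_base: "openin T W \<Longrightarrow> x \<in> W \<Longrightarrow> \<exists>A. clopenin T A \<and> x \<in> A \<and> A \<subseteq> W"
    and clopenin_vimage: "g \<in> carrier K \<Longrightarrow> clopenin T A \<Longrightarrow> clopenin T {x \<in> topspace T. g \<cdot> x \<in> A}"
    and clopenin_moved: "g \<in> carrier K \<Longrightarrow> clopenin T {x \<in> topspace T. g \<cdot> x \<noteq> x}"
    and swap: "g \<in> carrier K \<Longrightarrow> clopenin T A \<Longrightarrow> (\<And>x. x \<in> A \<Longrightarrow> g \<cdot> x \<notin> A) \<Longrightarrow>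
      \<exists>s\<in>carrier K. (\<forall>x\<in>A. s \<cdot> x = g \<cdot> x) \<and> (\<forall>x\<in>A. s \<cdot> g \<cdot> x = x) \<and>
        (\<forall>x\<in>topspace T. x \<notin> A \<longrightarrow> x \<notin> (\<lambda>y. g \<cdot> y) ` A \<longrightarrow> s \<cdot> x = x)"
    and local_square: "clopenin T A \<Longrightarrow> x \<in> A \<Longrightarrow>
      \<exists>g\<in>carrier K. (\<forall>y\<in>topspace T. y \<notin> A \<longrightarrow> g \<cdot> y = y) \<and> g \<cdot> g \<cdot> x \<noteq> x"
begin

section \<open>Separation of points and local involutions\<close>

definition moved :: "'g \<Rightarrow> 'x set" where
  "moved g = {x \<in> topspace T. g \<cdot> x \<noteq> x}"

lemma clopen_mem: "clopenin T A \<Longrightarrow> x \<in> A \<Longrightarrow> x \<in> topspace T"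
  using openin_subset by blast

lemma act_inv_act [simp]: "g \<in> carrier K \<Longrightarrow> x \<in> topspace T \<Longrightarrow> inv g \<cdot> g \<cdot> x = x"
  by (metis act_mult act_one inv_closed l_inv)

lemma act_act_inv [simp]: "g \<in> carrier K \<Longrightarrow> x \<in> topspace T \<Longrightarrow> g \<cdot> inv g \<cdot> x = x"
  by (metis act_mult act_one inv_closed r_inv)

lemma act_inject [simp]:
  "g \<in> carrier K \<Longrightarrow> x \<in> topspace T \<Longrightarrow> y \<in> topspace T \<Longrightarrow> g \<cdot> x = g \<cdot> y \<longleftrightarrow> x = y"
  by (metis act_inv_act)

lemma act_eqI:
  assumes "g \<in> carrier K" "h \<in> carrier K" "\<And>x. x \<in> topspace T \<Longrightarrow> g \<cdot> x = h \<cdot> x"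
  shows "g = h"
proof -
  have "inv g \<otimes> h = \<one>"
    using assms by (intro faithful) (auto simp flip: assms(3))
  then show ?thesis
    using assms(1,2) by (metis inv_closed inv_equality inv_inv)
qed

lemma involution_act [simp]:
  "p \<in> carrier K \<Longrightarrow> p \<otimes> p = \<one> \<Longrightarrow> x \<in> topspace T \<Longrightarrow> p \<cdot> p \<cdot> x = x"
  by (metis act_mult act_one)

lemma stays_in:
  assumes "g \<in> carrier K" "\<forall>y\<in>topspace T. y \<notin> A \<longrightarrow> g \<cdot> y = y" "A \<subseteq> topspace T" "x \<in> A"
  shows "g \<cdot> x \<in> A"
  using assms by (metis act_closed act_inject subsetD)

text \<open>The two images are separated by Hausdorffness and the clopen base, then pulled back. The
  points \<open>y\<close> and \<open>z\<close> are independent: the sets \<open>g A\<close> and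
  \<open>h A\<close> are disjoint, which is more than \<open>g\<close> and \<open>h\<close>
  differing at each point of \<open>A\<close>.\<close>

lemma separate_images:
  assumes g: "g \<in> carrier K" and h: "h \<in> carrier K" and B: "clopenin T B" "x \<in> B"
    and ne: "g \<cdot> x \<noteq> h \<cdot> x"
  obtains A where "clopenin T A" "x \<in> A" "A \<subseteq> B" "\<And>y z. y \<in> A \<Longrightarrow> z \<in> A \<Longrightarrow> g \<cdot> y \<noteq> h \<cdot> z"
proof -
  have x: "x \<in> topspace T" using B clopen_mem by blast
  obtain U W where UW: "openin T U" "openin T W" "g \<cdot> x \<in> U" "h \<cdot> x \<in> W" "disjnt U W"
    using Hausdorff ne g h x unfolding Hausdorff_space_def by (metis act_closed)
  obtain C D where CD: "clopenin T C" "g \<cdot> x \<in> C" "C \<subseteq> U" "clopenin T D" "h \<cdot> x \<in> D" "D \<subseteq> W"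
    using clopen_base UW by metis
  let ?A = "B \<inter> ({y \<in> topspace T. g \<cdot> y \<in> C} \<inter> {y \<in> topspace T. h \<cdot> y \<in> D})"
  show thesis
  proof (rule that)
    show "clopenin T ?A"
      using B clopenin_vimage[OF g CD(1)] clopenin_vimage[OF h CD(4)] by auto
    show "x \<in> ?A" using B CD x by auto
    show "g \<cdot> y \<noteq> h \<cdot> z" if "y \<in> ?A" "z \<in> ?A" for y z
      using that CD(3,6) UW(5) unfolding disjnt_iff by (metis (no_types, lifting) IntD1 IntD2 mem_Collect_eq subsetD)
  qed auto
qed

lemma separate_from_self:
  assumes g: "g \<in> carrier K" and B: "clopenin T B" "x \<in> B" and ne: "g \<cdot> x \<noteq> x"
  obtains A where "clopenin T A" "x \<in> A" "A \<subseteq> B" "\<And>y. y \<in> A \<Longrightarrow> g \<cdot> y \<notin> A"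
proof -
  have "g \<cdot> x \<noteq> \<one> \<cdot> x"
    using assms clopen_mem by auto
  then obtain A where "clopenin T A" "x \<in> A" "A \<subseteq> B"
    and "\<And>y z. y \<in> A \<Longrightarrow> z \<in> A \<Longrightarrow> g \<cdot> y \<noteq> \<one> \<cdot> z"
    using separate_images[OF g one_closed B] by blast
  then show thesis
    using that clopen_mem act_one by metis
qed

text \<open>A small \<open>B\<close> around \<open>x\<close> with \<open>g B\<close> disjoint from
  \<open>B\<close> is swapped with \<open>g B\<close>; the support stays in \<open>A\<close> because
  \<open>g\<close> maps \<open>A\<close> into itself.\<close>

lemma local_involution:
  assumes A: "clopenin T A" "x \<in> A"
  obtains s where "s \<in> carrier K" "s \<otimes> s = \<one>" "moved s \<subseteq> A" "x \<in> moved s"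
proof -
  obtain g where g: "g \<in> carrier K" "\<forall>y\<in>topspace T. y \<notin> A \<longrightarrow> g \<cdot> y = y" "g \<cdot> g \<cdot> x \<noteq> x"
    using local_square[OF A] by blast
  have x: "x \<in> topspace T" using A clopen_mem by blast
  have "g \<cdot> x \<noteq> x" using g by auto
  then obtain B where B: "clopenin T B" "x \<in> B" "B \<subseteq> A" "\<And>y. y \<in> B \<Longrightarrow> g \<cdot> y \<notin> B"
    using separate_from_self[OF g(1) A] by blast
  obtain s where s: "s \<in> carrier K" "\<forall>x\<in>B. s \<cdot> x = g \<cdot> x" "\<forall>x\<in>B. s \<cdot> g \<cdot> x = x"
    "\<forall>x\<in>topspace T. x \<notin> B \<longrightarrow> x \<notin> (\<lambda>y. g \<cdot> y) ` B \<longrightarrow> s \<cdot> x = x"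
    using swap[OF g(1) B(1,4)] by blast
  have gB: "g \<cdot> y \<in> A" if "y \<in> B" for y
    using stays_in[OF g(1,2)] A B that openin_subset by blast
  have "s \<cdot> s \<cdot> y = y" if "y \<in> topspace T" for y
    using that s by (cases "y \<in> B \<or> y \<in> (\<lambda>y. g \<cdot> y) ` B") auto
  then have "s \<otimes> s = \<one>"
    using s(1) by (intro act_eqI) auto
  moreover have "moved s \<subseteq> A"
    using s gB B(3) by (auto simp: moved_def)
  moreover have "x \<in> moved s"
    using s(2) B(2) x \<open>g \<cdot> x \<noteq> x\<close> by (simp add: moved_def)
  ultimately show thesis using that s(1) by blast
qed

text \<open>Where \<open>p\<close> fixes \<open>A\<close> pointwise, a \<open>g\<close> supported in
  \<open>A\<close> already commutes with \<open>p\<close>. Where \<open>p\<close> moves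
  \<open>A\<close> off itself, \<open>g\<close> is copied to \<open>p A\<close> by conjugation; the
  two supports are disjoint, so \<open>g\<close> times its copy commutes with \<open>p\<close> and
  agrees with \<open>g\<close> on \<open>A\<close>.\<close>

lemma local_commuting_square:
  assumes p: "p \<in> carrier K" "p \<otimes> p = \<one>" and A: "clopenin T A" "x \<in> A"
    and alt: "(\<forall>y\<in>A. p \<cdot> y = y) \<or> (\<forall>y\<in>A. p \<cdot> y \<notin> A)"
  obtains b where "b \<in> carrier K" "b \<otimes> p = p \<otimes> b"
    "\<And>y. y \<in> topspace T \<Longrightarrow> y \<notin> A \<Longrightarrow> p \<cdot> y \<notin> A \<Longrightarrow> b \<cdot> y = y"
    "\<And>y. y \<in> A \<Longrightarrow> b \<cdot> y \<in> A" "b \<cdot> b \<cdot> x \<noteq> x"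
proof -
  obtain g where g: "g \<in> carrier K" "\<forall>y\<in>topspace T. y \<notin> A \<longrightarrow> g \<cdot> y = y" "g \<cdot> g \<cdot> x \<noteq> x"
    using local_square[OF A] by blast
  have sub: "A \<subseteq> topspace T" using A openin_subset by blast
  have gA: "g \<cdot> y \<in> A" if "y \<in> A" for y
    using stays_in[OF g(1,2) sub that] .
  from alt show thesis
  proof
    assume fix_p: "\<forall>y\<in>A. p \<cdot> y = y"
    have pA: "p \<cdot> y \<notin> A" if "y \<in> topspace T" "y \<notin> A" for y
      using that fix_p p by (metis involution_act)
    have "g \<otimes> p = p \<otimes> g"
    proof (rule act_eqI)
      fix y assume "y \<in> topspace T"
      then show "(g \<otimes> p) \<cdot> y = (p \<otimes> g) \<cdot> y"
        using g(1,2) p fix_p gA pA by (cases "y \<in> A") auto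
    qed (use g p in auto)
    then show thesis using that g gA by blast
  next
    assume off: "\<forall>y\<in>A. p \<cdot> y \<notin> A"
    let ?b = "g \<otimes> (p \<otimes> g \<otimes> p)"
    have b: "?b \<cdot> y = (if y \<in> A then g \<cdot> y else if p \<cdot> y \<in> A then p \<cdot> g \<cdot> p \<cdot> y else y)"
      if y: "y \<in> topspace T" for y
    proof -
      have "g \<cdot> p \<cdot> g \<cdot> p \<cdot> y = p \<cdot> g \<cdot> p \<cdot> y" if "p \<cdot> y \<in> A"
        using that g(1,2) p y off gA[OF that] by auto
      moreover have "g \<cdot> p \<cdot> y = p \<cdot> y" if "p \<cdot> y \<notin> A"
        using that g(2) p y by auto
      ultimately show ?thesis
        using g(1,2) p y off by auto
    qed
    have "?b \<otimes> p = p \<otimes> ?b"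
    proof (rule act_eqI)
      fix y assume y: "y \<in> topspace T"
      have "?b \<cdot> p \<cdot> y = p \<cdot> ?b \<cdot> y"
        unfolding b[OF y] b[OF act_closed[OF p(1) y]] using y p g(1) off by auto
      then show "(?b \<otimes> p) \<cdot> y = (p \<otimes> ?b) \<cdot> y"
        using y p g(1) by (simp del: m_assoc)
    qed (use g p in auto)
    moreover have "?b \<cdot> y \<in> A" if "y \<in> A" for y
      using b gA that sub by auto
    moreover have "?b \<cdot> ?b \<cdot> x \<noteq> x"
      using b[of x] b[of "g \<cdot> x"] g gA A(2) sub by auto
    ultimately show thesis
      using that[of ?b] g(1) p(1) b by auto
  qed
qed

lemma moved_clopen: "g \<in> carrier K \<Longrightarrow> clopenin T (moved g)"
  unfolding moved_def by (rule clopenin_moved)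

text \<open>If \<open>a x\<close> were neither \<open>x\<close> nor \<open>p x\<close>, some small
  \<open>A\<close> around \<open>x\<close> would have \<open>a A\<close> disjoint from both
  \<open>A\<close> and \<open>p A\<close>. A \<open>b\<close> commuting with \<open>p\<close> and
  supported in \<open>A\<close> and \<open>p A\<close> then fixes \<open>a A\<close> pointwise, and
  commuting of \<open>a\<close> with \<open>b a b^-1\<close> would force
  \<open>b (b x) = x\<close>.\<close>

lemma commuting_flips_act:
  assumes p: "p \<in> carrier K" "p \<otimes> p = \<one>" and a: "a \<in> commuting_flips K p"
    and x: "x \<in> topspace T"
  shows "a \<cdot> x = x \<or> a \<cdot> x = p \<cdot> x"
proof (rule ccontr)
  assume neg: "\<not> ?thesis"
  have aK: "a \<in> carrier K" "a \<otimes> a = \<one>"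
    and comm: "\<And>b. b \<in> carrier K \<Longrightarrow> b \<otimes> p = p \<otimes> b \<Longrightarrow>
      a \<otimes> (b \<otimes> a \<otimes> inv b) = (b \<otimes> a \<otimes> inv b) \<otimes> a"
    using a by (auto simp: commuting_flips_def)
  obtain A0 where A0: "clopenin T A0" "x \<in> A0" "\<And>y. y \<in> A0 \<Longrightarrow> a \<cdot> y \<notin> A0"
    using separate_from_self[OF aK(1), of "topspace T" x] neg x by (metis closedin_topspace openin_topspace)
  obtain A1 where A1: "clopenin T A1" "x \<in> A1" "A1 \<subseteq> A0" "\<And>y z. y \<in> A1 \<Longrightarrow> z \<in> A1 \<Longrightarrow> a \<cdot> y \<noteq> p \<cdot> z"
    using separate_images[OF aK(1) p(1) A0(1,2)] neg by metis
  obtain A where A: "clopenin T A" "x \<in> A" "A \<subseteq> A1" "(\<forall>y\<in>A. p \<cdot> y = y) \<or> (\<forall>y\<in>A. p \<cdot> y \<notin> A)"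
  proof (cases "p \<cdot> x = x")
    case True
    show thesis
    proof (rule that)
      show "clopenin T (A1 - moved p)"
        using A1(1) moved_clopen[OF p(1)] by (auto intro: openin_diff closedin_diff)
      show "x \<in> A1 - moved p" using A1(2) True by (simp add: moved_def)
      show "(\<forall>y\<in>A1 - moved p. p \<cdot> y = y) \<or> (\<forall>y\<in>A1 - moved p. p \<cdot> y \<notin> A1 - moved p)"
        using A1(1) clopen_mem by (auto simp: moved_def)
    qed auto
  next
    case False
    then show thesis
      using separate_from_self[OF p(1) A1(1,2)] that by metis
  qed
  obtain b where b: "b \<in> carrier K" "b \<otimes> p = p \<otimes> b"
    "\<And>y. y \<in> topspace T \<Longrightarrow> y \<notin> A \<Longrightarrow> p \<cdot> y \<notin> A \<Longrightarrow> b \<cdot> y = y"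
    "\<And>y. y \<in> A \<Longrightarrow> b \<cdot> y \<in> A" "b \<cdot> b \<cdot> x \<noteq> x"
    using local_commuting_square[OF p A(1,2,4)] by metis
  have ba: "b \<cdot> a \<cdot> y = a \<cdot> y" if "y \<in> A" for y
  proof (rule b(3))
    have y: "y \<in> topspace T" using A that clopen_mem by blast
    then show "a \<cdot> y \<in> topspace T" using aK by simp
    show "a \<cdot> y \<notin> A" using A0(3) A1(3) A(3) that by blast
    show "p \<cdot> a \<cdot> y \<notin> A"
      using A1(4)[of y "p \<cdot> a \<cdot> y"] A(3) that p aK y by auto
  qed
  \<comment> \<open>At \<open>b x\<close> the two products disagree: one gives
    \<open>a (a x) = x\<close>, the other \<open>b (b x)\<close>.\<close>
  let ?y = "b \<cdot> x"
  have y: "?y \<in> A" "?y \<in> topspace T" using b A x by auto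
  have "(a \<otimes> (b \<otimes> a \<otimes> inv b)) \<cdot> ?y = x"
    using aK b(1) x ba[OF A(2)] by simp
  moreover have "inv b \<cdot> a \<cdot> ?y = a \<cdot> ?y"
    using ba[OF y(1)] b(1) aK(1) y(2) by (metis act_closed act_inv_act)
  then have "((b \<otimes> a \<otimes> inv b) \<otimes> a) \<cdot> ?y = b \<cdot> ?y"
    using aK b(1) y by (simp add: m_assoc)
  ultimately show False
    using comm[OF b(1,2)] b(5) by simp
qed

text \<open>For the converse, every flip preserves each pair \<open>{x, p x}\<close>, and
  permutations of a set with at most two elements commute and square to one. An element commuting
  with \<open>p\<close> permutes these pairs, so conjugation by it turns flips into flips.\<close>

lemma commuting_flips_iff:
  assumes p: "p \<in> carrier K" "p \<otimes> p = \<one>"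
  shows "a \<in> commuting_flips K p \<longleftrightarrow>
    a \<in> carrier K \<and> (\<forall>x\<in>topspace T. a \<cdot> x = x \<or> a \<cdot> x = p \<cdot> x)"
proof
  assume "a \<in> commuting_flips K p"
  then show "a \<in> carrier K \<and> (\<forall>x\<in>topspace T. a \<cdot> x = x \<or> a \<cdot> x = p \<cdot> x)"
    using commuting_flips_act[OF p] by (auto simp: commuting_flips_def)
next
  assume R: "a \<in> carrier K \<and> (\<forall>x\<in>topspace T. a \<cdot> x = x \<or> a \<cdot> x = p \<cdot> x)"
  then have a: "a \<in> carrier K" by blast
  have flips_commute: "c \<otimes> d = d \<otimes> c"
    if c: "c \<in> carrier K" "\<forall>x\<in>topspace T. c \<cdot> x = x \<or> c \<cdot> x = p \<cdot> x"
      and d: "d \<in> carrier K" "\<forall>x\<in>topspace T. d \<cdot> x = x \<or> d \<cdot> x = p \<cdot> x" for c d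
  proof (rule act_eqI)
    fix x assume x: "x \<in> topspace T"
    then have "p \<cdot> x \<in> topspace T" "p \<cdot> p \<cdot> x = x" using p by auto
    then have "c \<cdot> d \<cdot> x = d \<cdot> c \<cdot> x"
      using c d x by (metis act_inject)
    then show "(c \<otimes> d) \<cdot> x = (d \<otimes> c) \<cdot> x" using c d x by simp
  qed (use c d in auto)
  have "a \<otimes> p = p \<otimes> a"
    using flips_commute[of a p] R p by blast
  moreover have "a \<otimes> a = \<one>"
  proof (rule act_eqI)
    fix x assume x: "x \<in> topspace T"
    then have "p \<cdot> x \<in> topspace T" "p \<cdot> p \<cdot> x = x" using p by auto
    then have "a \<cdot> a \<cdot> x = x" using R x by (metis act_inject)
    then show "(a \<otimes> a) \<cdot> x = \<one> \<cdot> x" using x a by simp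
  qed (use a in auto)
  moreover have "a \<otimes> (b \<otimes> a \<otimes> inv b) = (b \<otimes> a \<otimes> inv b) \<otimes> a"
    if b: "b \<in> carrier K" "b \<otimes> p = p \<otimes> b" for b
  proof (rule flips_commute)
    show "\<forall>x\<in>topspace T. (b \<otimes> a \<otimes> inv b) \<cdot> x = x \<or> (b \<otimes> a \<otimes> inv b) \<cdot> x = p \<cdot> x"
    proof
      fix x assume x: "x \<in> topspace T"
      have "b \<cdot> p \<cdot> inv b \<cdot> x = p \<cdot> x"
        using b x p by (metis act_act_inv act_closed act_mult inv_closed)
      moreover have "a \<cdot> inv b \<cdot> x = inv b \<cdot> x \<or> a \<cdot> inv b \<cdot> x = p \<cdot> inv b \<cdot> x"
        using R b x by simp
      ultimately show "(b \<otimes> a \<otimes> inv b) \<cdot> x = x \<or> (b \<otimes> a \<otimes> inv b) \<cdot> x = p \<cdot> x"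
        using a b(1) x by auto
    qed
  qed (use R a b in auto)
  ultimately show "a \<in> commuting_flips K p"
    using a by (simp add: commuting_flips_def)
qed

text \<open>Cut down to a small clopen \<open>A\<close> around \<open>x\<close>, the involution
  \<open>p\<close> gives a flip \<open>s\<close> that acts only on \<open>A\<close> and
  \<open>p A\<close>. If \<open>a x\<close> were neither \<open>x\<close> nor \<open>p x\<close>, it
  could be kept outside the support of \<open>s\<close>, and commuting with \<open>s\<close> would
  give \<open>a (p x) = s (a x) = a x\<close>.\<close>

lemma flip_centralizer_act:
  assumes p: "p \<in> carrier K" "p \<otimes> p = \<one>" and a: "a \<in> flip_centralizer K p"
    and x: "x \<in> topspace T" "p \<cdot> x \<noteq> x"
  shows "a \<cdot> x = x \<or> a \<cdot> x = p \<cdot> x"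
proof (rule ccontr)
  assume neg: "\<not> ?thesis"
  have aK: "a \<in> carrier K" and comm: "\<And>b. b \<in> commuting_flips K p \<Longrightarrow> a \<otimes> b = b \<otimes> a"
    using a by (auto simp: flip_centralizer_def)
  obtain A0 where A0: "clopenin T A0" "x \<in> A0" "\<And>y. y \<in> A0 \<Longrightarrow> a \<cdot> y \<notin> A0"
    using separate_from_self[OF aK(1), of "topspace T" x] neg x by (metis closedin_topspace openin_topspace)
  obtain A1 where A1: "clopenin T A1" "x \<in> A1" "A1 \<subseteq> A0" "\<And>y z. y \<in> A1 \<Longrightarrow> z \<in> A1 \<Longrightarrow> a \<cdot> y \<noteq> p \<cdot> z"
    using separate_images[OF aK(1) p(1) A0(1,2)] neg by metis
  obtain A where A: "clopenin T A" "x \<in> A" "A \<subseteq> A1" "\<And>y. y \<in> A \<Longrightarrow> p \<cdot> y \<notin> A"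
    using separate_from_self[OF p(1) A1(1,2) x(2)] by metis
  obtain s where s: "s \<in> carrier K" "\<forall>x\<in>A. s \<cdot> x = p \<cdot> x" "\<forall>x\<in>A. s \<cdot> p \<cdot> x = x"
    "\<forall>x\<in>topspace T. x \<notin> A \<longrightarrow> x \<notin> (\<lambda>y. p \<cdot> y) ` A \<longrightarrow> s \<cdot> x = x"
    using swap[OF p(1) A(1,4)] by blast
  have "s \<in> commuting_flips K p"
    unfolding commuting_flips_iff[OF p]
  proof (intro conjI ballI)
    fix y assume y: "y \<in> topspace T"
    show "s \<cdot> y = y \<or> s \<cdot> y = p \<cdot> y"
      using s y p A(1) clopen_mem by (cases "y \<in> A \<or> y \<in> (\<lambda>y. p \<cdot> y) ` A") auto
  qed (rule s(1))
  then have "a \<cdot> s \<cdot> x = s \<cdot> a \<cdot> x"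
    using comm aK s(1) x by (metis act_mult)
  moreover have "s \<cdot> a \<cdot> x = a \<cdot> x"
    using s(4) A0(3) A1(3,4) A(2,3) aK x by (metis act_closed imageE subsetD)
  ultimately show False
    using s(2) A(2) x p aK by auto
qed

text \<open>If \<open>a\<close> moves a fixed point \<open>x\<close> of \<open>p\<close>, take a
  small \<open>A\<close> around \<open>x\<close>, off the support of \<open>p\<close> and disjoint
  from \<open>a A\<close>. A \<open>g\<close> supported in \<open>A\<close> centralizes all flips,
  and comparing \<open>a g g\<close> with \<open>g g a\<close> at \<open>x\<close> gives
  \<open>g (g x) = x\<close>, against the choice of \<open>g\<close>. Conversely, squares of
  elements of \<open>flip_centralizer K p\<close> are trivial on the support of \<open>p\<close>,
  and \<open>a\<close> is trivial off it.\<close>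

lemma support_subgroup_iff:
  assumes p: "p \<in> carrier K" "p \<otimes> p = \<one>"
  shows "a \<in> support_subgroup K p \<longleftrightarrow> a \<in> carrier K \<and> moved a \<subseteq> moved p"
proof
  assume L: "a \<in> support_subgroup K p"
  then have a: "a \<in> carrier K" by (simp add: support_subgroup_def)
  moreover have "p \<cdot> x \<noteq> x" if x: "x \<in> topspace T" "a \<cdot> x \<noteq> x" for x
  proof
    assume px: "p \<cdot> x = x"
    have "clopenin T (topspace T - moved p)"
      using moved_clopen[OF p(1)] by auto
    then obtain A where A: "clopenin T A" "x \<in> A" "A \<subseteq> topspace T - moved p" "\<And>y. y \<in> A \<Longrightarrow> a \<cdot> y \<notin> A"
      using separate_from_self[OF a, of "topspace T - moved p" x] x px by (auto simp: moved_def)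
    obtain g where g: "g \<in> carrier K" "\<forall>y\<in>topspace T. y \<notin> A \<longrightarrow> g \<cdot> y = y" "g \<cdot> g \<cdot> x \<noteq> x"
      using local_square[OF A(1,2)] by blast
    have "g \<in> flip_centralizer K p"
      unfolding flip_centralizer_def
    proof (intro CollectI conjI ballI)
      fix b assume b: "b \<in> commuting_flips K p"
      then have bK: "b \<in> carrier K" by (simp add: commuting_flips_def)
      have fixA: "b \<cdot> y = y" if "y \<in> A" for y
        using that A(3) commuting_flips_act[OF p b, of y] by (auto simp: moved_def)
      show "g \<otimes> b = b \<otimes> g"
      proof (rule act_eqI)
        fix y assume y: "y \<in> topspace T"
        show "(g \<otimes> b) \<cdot> y = (b \<otimes> g) \<cdot> y"
        proof (cases "y \<in> A")
          case True
          moreover have "g \<cdot> y \<in> A"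
            using stays_in[OF g(1,2) _ True] A(1) openin_subset by blast
          ultimately show ?thesis using fixA g(1) bK y by simp
        next
          case False
          then have "b \<cdot> y \<notin> A" using fixA bK y by (metis act_closed act_inject)
          then show ?thesis using False g bK y by simp
        qed
      qed (use g bK in auto)
    qed (rule g(1))
    then have "a \<otimes> (g \<otimes> g) = (g \<otimes> g) \<otimes> a"
      using L by (simp add: support_subgroup_def)
    then have "a \<cdot> g \<cdot> g \<cdot> x = g \<cdot> g \<cdot> a \<cdot> x"
      using a g(1) x by (metis act_mult m_closed act_closed)
    also have "\<dots> = a \<cdot> x"
      using g(2) A(2,4) a x by simp
    finally show False using g(1,3) a x by simp
  qed
  ultimately show "a \<in> carrier K \<and> moved a \<subseteq> moved p"
    by (auto simp: moved_def)
next
  assume R: "a \<in> carrier K \<and> moved a \<subseteq> moved p"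
  then have a: "a \<in> carrier K" and sub: "\<And>x. x \<in> topspace T \<Longrightarrow> p \<cdot> x = x \<Longrightarrow> a \<cdot> x = x"
    by (auto simp: moved_def)
  show "a \<in> support_subgroup K p"
    unfolding support_subgroup_def
  proof (intro CollectI conjI ballI a)
    fix b assume b: "b \<in> flip_centralizer K p"
    then have bK: "b \<in> carrier K" by (simp add: flip_centralizer_def)
    have bb: "b \<cdot> b \<cdot> x = x" if x: "x \<in> topspace T" "p \<cdot> x \<noteq> x" for x
    proof -
      have "p \<cdot> x \<in> topspace T" "p \<cdot> p \<cdot> x = x" using p x by auto
      then show ?thesis
        using flip_centralizer_act[OF p b, of x] flip_centralizer_act[OF p b, of "p \<cdot> x"] x bK
        by (metis act_inject)
    qed
    show "a \<otimes> (b \<otimes> b) = (b \<otimes> b) \<otimes> a"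
    proof (rule act_eqI)
      fix x assume x: "x \<in> topspace T"
      have "a \<cdot> b \<cdot> b \<cdot> x = b \<cdot> b \<cdot> a \<cdot> x"
      proof (cases "p \<cdot> x = x")
        case True
        \<comment> \<open>A point moved by \<open>p\<close> is fixed by \<open>b b\<close>; if
          \<open>b (b x)\<close> were moved, injectivity would give \<open>b (b x) = x\<close>,
          which \<open>p\<close> fixes.\<close>
        then have "p \<cdot> b \<cdot> b \<cdot> x = b \<cdot> b \<cdot> x"
          using bb[of "b \<cdot> b \<cdot> x"] x bK by (metis act_closed act_inject)
        then show ?thesis using sub True x bK by simp
      next
        case False
        then have "p \<cdot> a \<cdot> x \<noteq> a \<cdot> x"
          using sub[of "a \<cdot> x"] a x by (metis act_closed act_inject)
        then show ?thesis using bb False x a by simp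
      qed
      then show "(a \<otimes> (b \<otimes> b)) \<cdot> x = ((b \<otimes> b) \<otimes> a) \<cdot> x"
        using a bK x by simp
    qed (use a bK in auto)
  qed
qed

end

section \<open>Spatial realization of isomorphisms\<close>

locale rich_action_iso =
  A: rich_action K S act1 + B: rich_action L T act2
  for K :: "('g, 'm) monoid_scheme" and S :: "'x topology" and act1 :: "'g \<Rightarrow> 'x \<Rightarrow> 'x"  (infixr \<open>\<cdot>\<^sub>1\<close> 75)
    and L :: "('h, 'n) monoid_scheme" and T :: "'y topology" and act2 :: "'h \<Rightarrow> 'y \<Rightarrow> 'y"  (infixr \<open>\<cdot>\<^sub>2\<close> 75) +
  fixes h :: "'g \<Rightarrow> 'h"
  assumes h_iso: "h \<in> iso K L"
begin

sublocale group_hom K L h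
  using h_iso by unfold_locales (simp add: iso_def)

lemma h_surj: "s \<in> carrier L \<Longrightarrow> \<exists>t\<in>carrier K. h t = s"
  using h_iso unfolding iso_def bij_betw_def by (metis (mono_tags, lifting) imageE mem_Collect_eq)

section \<open>Comparing supports across the isomorphism\<close>

definition involutions :: "'g set" where
  "involutions = {p \<in> carrier K. p \<otimes>\<^bsub>K\<^esub> p = \<one>\<^bsub>K\<^esub>}"

lemma involutionsD: "p \<in> involutions \<Longrightarrow> p \<in> carrier K" "p \<in> involutions \<Longrightarrow> p \<otimes>\<^bsub>K\<^esub> p = \<one>\<^bsub>K\<^esub>"
  by (auto simp: involutions_def)

lemma h_involution:
  assumes "p \<in> involutions"
  shows "h p \<in> carrier L" "h p \<otimes>\<^bsub>L\<^esub> h p = \<one>\<^bsub>L\<^esub>"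
  using involutionsD[OF assms] by (auto simp flip: hom_mult)

text \<open>Inclusion of supports is membership in \<open>support_subgroup\<close>, which
  \<open>h\<close> preserves. The involution is needed for the larger support; \<open>a\<close> is
  arbitrary.\<close>

lemma moved_subset_iff:
  assumes "a \<in> carrier K" "p \<in> involutions"
  shows "B.moved (h a) \<subseteq> B.moved (h p) \<longleftrightarrow> A.moved a \<subseteq> A.moved p"
  using A.support_subgroup_iff[of p a] B.support_subgroup_iff[of "h p" "h a"]
    iso_support_subgroup[OF h_iso, of p a] involutionsD[OF assms(2)] h_involution[OF assms(2)] assms(1)
  by auto

text \<open>The identity is an involution with empty support, so triviality is itself an inclusion
  of supports.\<close>

lemma h_moved_empty_iff:
  assumes "a \<in> carrier K"
  shows "B.moved (h a) = {} \<longleftrightarrow> A.moved a = {}"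
proof -
  have "\<one>\<^bsub>K\<^esub> \<in> involutions" by (simp add: involutions_def)
  from moved_subset_iff[OF assms this] show ?thesis
    by (auto simp: A.moved_def B.moved_def)
qed

text \<open>An involution supported in an overlap of the images would come from an element of
  \<open>K\<close> supported in both of two disjoint sets, hence with empty support.\<close>

lemma moved_disjoint:
  assumes p: "p \<in> involutions" and q: "q \<in> involutions" and dis: "A.moved p \<inter> A.moved q = {}"
  shows "B.moved (h p) \<inter> B.moved (h q) = {}"
proof (rule ccontr)
  assume "\<not> ?thesis"
  then obtain y where y: "y \<in> B.moved (h p) \<inter> B.moved (h q)" by blast
  have "clopenin T (B.moved (h p) \<inter> B.moved (h q))"
    using B.moved_clopen h_involution(1) p q by (simp add: closedin_Int openin_Int)
  then obtain s where s: "s \<in> carrier L" "s \<otimes>\<^bsub>L\<^esub> s = \<one>\<^bsub>L\<^esub>" "B.moved s \<subseteq> B.moved (h p) \<inter> B.moved (h q)" "y \<in> B.moved s"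
    using B.local_involution y by metis
  obtain t where t: "t \<in> carrier K" "h t = s"
    using h_surj[OF s(1)] by blast
  have "A.moved t \<subseteq> A.moved p \<inter> A.moved q"
    using moved_subset_iff[OF t(1) p] moved_subset_iff[OF t(1) q] s t by auto
  then show False
    using dis h_moved_empty_iff[OF t(1)] s t by auto
qed

text \<open>Finite intersection property: the images of sufficiently small supports near
  \<open>x\<close> lie in any finitely many of the sets in question, and they are nonempty.\<close>

lemma ex_common_image:
  assumes x: "x \<in> topspace S"
  shows "\<exists>y\<in>topspace T. \<forall>p\<in>involutions. x \<in> A.moved p \<longrightarrow> y \<in> B.moved (h p)"
proof -
  \<comment> \<open>The whole space is made a member so that a common point lies in
    \<open>topspace T\<close> by construction.\<close>
  define \<U> where "\<U> = insert (topspace T) {B.moved (h p) |p. p \<in> involutions \<and> x \<in> A.moved p}"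
  have closed: "closedin T C" if "C \<in> \<U>" for C
    using that B.moved_clopen h_involution(1) by (auto simp: \<U>_def)
  \<comment> \<open>An intersection of supports is not visibly the support of an involution, so the
    induction carries a neighbourhood of \<open>x\<close> such that every support inside it has its
    image inside the intersection.\<close>
  have nbhd: "\<exists>A. clopenin S A \<and> x \<in> A \<and> (\<forall>q\<in>carrier K. A.moved q \<subseteq> A \<longrightarrow> B.moved (h q) \<subseteq> \<Inter>\<F>)"
    if "finite \<F>" "\<F> \<subseteq> \<U>" for \<F>
    using that
  proof (induction rule: finite_induct)
    case empty
    show ?case using x by (intro exI[of _ "topspace S"]) auto
  next
    case (insert C \<F>)
    then obtain A where A: "clopenin S A" "x \<in> A" "\<forall>q\<in>carrier K. A.moved q \<subseteq> A \<longrightarrow> B.moved (h q) \<subseteq> \<Inter>\<F>"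
      by auto
    from insert.prems have "C \<in> \<U>" by simp
    then consider "C = topspace T" | p where "C = B.moved (h p)" "p \<in> involutions" "x \<in> A.moved p"
      by (auto simp: \<U>_def)
    then show ?case
    proof cases
      case 1
      then have "B.moved g \<subseteq> C" for g by (auto simp: B.moved_def)
      then show ?thesis
        using A by (intro exI[of _ A]) simp
    next
      case 2
      then have "clopenin S (A \<inter> A.moved p)"
        using A(1) A.moved_clopen involutionsD(1) by (simp add: closedin_Int openin_Int)
      moreover have "B.moved (h q) \<subseteq> \<Inter>(insert C \<F>)"
        if "q \<in> carrier K" "A.moved q \<subseteq> A \<inter> A.moved p" for q
      proof -
        have "B.moved (h q) \<subseteq> \<Inter>\<F>" using A(3) that by blast
        moreover have "B.moved (h q) \<subseteq> C"
          using moved_subset_iff[OF that(1) 2(2)] that(2) 2(1) by blast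
        ultimately show ?thesis by blast
      qed
      ultimately show ?thesis
        using A(2) 2(3) by (intro exI[of _ "A \<inter> A.moved p"]) simp
    qed
  qed
  have "\<Inter>\<F> \<noteq> {}" if \<F>: "finite \<F>" "\<F> \<subseteq> \<U>" for \<F>
  proof -
    obtain A where A: "clopenin S A" "x \<in> A" "\<forall>q\<in>carrier K. A.moved q \<subseteq> A \<longrightarrow> B.moved (h q) \<subseteq> \<Inter>\<F>"
      using nbhd[OF \<F>] by blast
    obtain s where s: "s \<in> carrier K" "A.moved s \<subseteq> A" "x \<in> A.moved s"
      using A.local_involution[OF A(1,2)] by metis
    then have "B.moved (h s) \<noteq> {}"
      using h_moved_empty_iff[OF s(1)] by blast
    moreover have "B.moved (h s) \<subseteq> \<Inter>\<F>"
      using A(3) s(1,2) by blast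
    ultimately show ?thesis
      by blast
  qed
  then have "\<Inter>\<U> \<noteq> {}"
    using B.compact[unfolded compact_space_fip] closed by simp
  then obtain y where y: "y \<in> \<Inter>\<U>" by blast
  show ?thesis
  proof (intro bexI ballI impI)
    show "y \<in> topspace T" using y by (simp add: \<U>_def)
    show "y \<in> B.moved (h p)" if "p \<in> involutions" "x \<in> A.moved p" for p
      using y that unfolding \<U>_def by blast
  qed
qed

text \<open>The condition is one-sided because that is what compactness yields. The argument of
  \<open>point_map_moved_iff\<close> supplies the converse, and by \<open>image_eqI\<close> the
  point is then unique.\<close>

definition point_map :: "'x \<Rightarrow> 'y" where
  "point_map x = (SOME y. y \<in> topspace T \<and> (\<forall>p\<in>involutions. x \<in> A.moved p \<longrightarrow> y \<in> B.moved (h p)))"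

lemma point_map_mem: "x \<in> topspace S \<Longrightarrow> point_map x \<in> topspace T"
  and point_map_moved: "x \<in> topspace S \<Longrightarrow> p \<in> involutions \<Longrightarrow> x \<in> A.moved p \<Longrightarrow> point_map x \<in> B.moved (h p)"
  using someI_ex[OF ex_common_image[unfolded Bex_def]] unfolding point_map_def by auto

text \<open>If \<open>p\<close> fixed \<open>x\<close>, some involution moving \<open>x\<close>
  would have support disjoint from that of \<open>p\<close>, and \<open>point_map x\<close> would
  lie in two disjoint sets.\<close>

lemma point_map_moved_iff:
  assumes x: "x \<in> topspace S" and p: "p \<in> involutions"
  shows "point_map x \<in> B.moved (h p) \<longleftrightarrow> x \<in> A.moved p"
proof
  assume y: "point_map x \<in> B.moved (h p)"
  show "x \<in> A.moved p"
  proof (rule ccontr)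
    assume "x \<notin> A.moved p"
    moreover have "clopenin S (topspace S - A.moved p)"
      using A.moved_clopen involutionsD(1)[OF p] by auto
    ultimately obtain q where q: "q \<in> carrier K" "q \<otimes>\<^bsub>K\<^esub> q = \<one>\<^bsub>K\<^esub>" "A.moved q \<subseteq> topspace S - A.moved p" "x \<in> A.moved q"
      using A.local_involution x by (metis DiffI)
    then have "q \<in> involutions" by (simp add: involutions_def)
    then show False
      using moved_disjoint[OF p, of q] point_map_moved[OF x, of q] q y by blast
  qed
qed (rule point_map_moved[OF x p])

text \<open>Makes the sets \<open>B.moved (h p)\<close> a base of \<open>T\<close>, on which both
  continuity and equality of points are tested.\<close>

lemma image_separation:
  assumes "openin T W" "y \<in> W"
  obtains p where "p \<in> involutions" "y \<in> B.moved (h p)" "B.moved (h p) \<subseteq> W"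
proof -
  obtain A where A: "clopenin T A" "y \<in> A" "A \<subseteq> W"
    using B.clopen_base assms by blast
  then obtain s where s: "s \<in> carrier L" "s \<otimes>\<^bsub>L\<^esub> s = \<one>\<^bsub>L\<^esub>" "B.moved s \<subseteq> A" "y \<in> B.moved s"
    using B.local_involution by metis
  obtain t where t: "t \<in> carrier K" "h t = s"
    using h_surj[OF s(1)] by blast
  have "h (t \<otimes>\<^bsub>K\<^esub> t) = h \<one>\<^bsub>K\<^esub>"
    using s t by simp
  then have "t \<in> involutions"
    using iso_mult_eq_iff[OF h_iso, of "t \<otimes>\<^bsub>K\<^esub> t" "\<one>\<^bsub>K\<^esub>"] t by (simp add: involutions_def)
  then show thesis using that s t A by blast
qed

lemma image_eqI:
  assumes "y \<in> topspace T" "z \<in> topspace T"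
    and "\<And>p. p \<in> involutions \<Longrightarrow> y \<in> B.moved (h p) \<longleftrightarrow> z \<in> B.moved (h p)"
  shows "y = z"
proof (rule ccontr)
  assume "y \<noteq> z"
  then obtain U W where "openin T U" "openin T W" "y \<in> U" "z \<in> W" "disjnt U W"
    using B.Hausdorff assms(1,2) unfolding Hausdorff_space_def by metis
  then show False
    using image_separation assms(3) by (metis disjnt_iff subsetD)
qed

lemma continuous_point_map: "continuous_map S T point_map"
  unfolding continuous_map_def
proof (intro conjI allI impI)
    fix U assume U: "openin T U"
    show "openin S {x \<in> topspace S. point_map x \<in> U}"
    proof (subst openin_subopen, intro ballI)
      fix x assume x: "x \<in> {x \<in> topspace S. point_map x \<in> U}"
      then obtain p where p: "p \<in> involutions" "point_map x \<in> B.moved (h p)" "B.moved (h p) \<subseteq> U"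
        using image_separation[OF U] by blast
      have "openin S (A.moved p)" using A.moved_clopen involutionsD p by blast
      moreover have "A.moved p \<subseteq> {x \<in> topspace S. point_map x \<in> U}"
      proof
        fix z assume z: "z \<in> A.moved p"
        then have zS: "z \<in> topspace S" by (simp add: A.moved_def)
        then show "z \<in> {x \<in> topspace S. point_map x \<in> U}"
          using point_map_moved[OF zS p(1) z] p(3) by blast
      qed
      moreover have "x \<in> A.moved p"
        using x p(1,2) point_map_moved_iff by blast
      ultimately show "\<exists>T. openin S T \<and> x \<in> T \<and> T \<subseteq> {x \<in> topspace S. point_map x \<in> U}"
        by blast
    qed
qed (use point_map_mem in auto)

text \<open>The point \<open>g x\<close> is moved by \<open>p\<close> iff \<open>x\<close> is moved
  by \<open>g^-1 p g\<close>. The same holds after applying \<open>h\<close>, and points of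
  \<open>T\<close> are determined by the supports containing them.\<close>

lemma point_map_act:
  assumes g: "g \<in> carrier K" and x: "x \<in> topspace S"
  shows "point_map (g \<cdot>\<^sub>1 x) = h g \<cdot>\<^sub>2 point_map x"
proof (rule image_eqI)
  have hg: "h g \<in> carrier L" using g by simp
  show "h g \<cdot>\<^sub>2 point_map x \<in> topspace T"
    using B.act_closed hg point_map_mem x by blast
  show "point_map (g \<cdot>\<^sub>1 x) \<in> topspace T"
    using point_map_mem g x by simp
  fix p assume p: "p \<in> involutions"
  let ?q = "inv\<^bsub>K\<^esub> g \<otimes>\<^bsub>K\<^esub> p \<otimes>\<^bsub>K\<^esub> g"
  have pK: "p \<in> carrier K" "p \<otimes>\<^bsub>K\<^esub> p = \<one>\<^bsub>K\<^esub>" using involutionsD p by auto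
  have "?q \<otimes>\<^bsub>K\<^esub> ?q = \<one>\<^bsub>K\<^esub>"
    by (rule A.act_eqI) (use g pK in auto)
  then have q: "?q \<in> involutions"
    using g pK by (simp add: involutions_def)
  have "g \<cdot>\<^sub>1 x \<in> A.moved p \<longleftrightarrow> x \<in> A.moved ?q"
    using g pK x A.act_inject[of "inv\<^bsub>K\<^esub> g" "p \<cdot>\<^sub>1 g \<cdot>\<^sub>1 x" "g \<cdot>\<^sub>1 x"] by (simp add: A.moved_def)
  also have "\<dots> \<longleftrightarrow> point_map x \<in> B.moved (h ?q)"
    using point_map_moved_iff q x by simp
  also have "\<dots> \<longleftrightarrow> h g \<cdot>\<^sub>2 point_map x \<in> B.moved (h p)"
    using g pK hg point_map_mem[OF x]
      B.act_inject[of "inv\<^bsub>L\<^esub> h g" "h p \<cdot>\<^sub>2 h g \<cdot>\<^sub>2 point_map x" "h g \<cdot>\<^sub>2 point_map x"]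
    by (simp add: B.moved_def)
  finally show "point_map (g \<cdot>\<^sub>1 x) \<in> B.moved (h p) \<longleftrightarrow> h g \<cdot>\<^sub>2 point_map x \<in> B.moved (h p)"
    using point_map_moved_iff[OF _ p, of "g \<cdot>\<^sub>1 x"] g x by simp
qed

lemma flip: "rich_action_iso L T act2 K S act1 (inv_into (carrier K) h)"
  by unfold_locales (rule A.iso_set_sym[OF h_iso])

text \<open>The point maps of \<open>h\<close> and of its inverse are characterized by corresponding
  supports, so each composite preserves every support membership and therefore fixes every point.
  Bijectivity and continuity of the inverse come together.\<close>

theorem spatial_realization:
  obtains f where "homeomorphic_map S T f"
    "\<And>g x. g \<in> carrier K \<Longrightarrow> x \<in> topspace S \<Longrightarrow> f (g \<cdot>\<^sub>1 x) = h g \<cdot>\<^sub>2 f x"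
proof -
  interpret inv: rich_action_iso L T act2 K S act1 "inv_into (carrier K) h"
    by (rule flip)
  have bij: "bij_betw h (carrier K) (carrier L)" using h_iso by (simp add: iso_def)
  have inv_h: "inv_into (carrier K) h (h p) = p" if "p \<in> carrier K" for p
    using bij that by (simp add: bij_betw_inv_into_left)
  have inv_involutions: "inv_into (carrier K) h q \<in> involutions" "h (inv_into (carrier K) h q) = q"
    if "q \<in> inv.involutions" for q
  proof -
    show "h (inv_into (carrier K) h q) = q"
      using that bij by (simp add: inv.involutions_def bij_betw_inv_into_right)
    show "inv_into (carrier K) h q \<in> involutions"
      using inv.h_involution[OF that] by (simp add: involutions_def)
  qed
  have h_involutions: "h p \<in> inv.involutions" if "p \<in> involutions" for p
    using h_involution[OF that] by (simp add: inv.involutions_def)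
  have "homeomorphic_maps S T point_map inv.point_map"
    unfolding homeomorphic_maps_def
  proof (intro conjI ballI continuous_point_map inv.continuous_point_map)
    fix x assume x: "x \<in> topspace S"
    show "inv.point_map (point_map x) = x"
    proof (rule inv.image_eqI)
      fix q assume q: "q \<in> inv.involutions"
      have "inv.point_map (point_map x) \<in> A.moved (inv_into (carrier K) h q) \<longleftrightarrow> point_map x \<in> B.moved q"
        using inv.point_map_moved_iff q x point_map_mem by blast
      also have "\<dots> \<longleftrightarrow> x \<in> A.moved (inv_into (carrier K) h q)"
        using point_map_moved_iff[OF x inv_involutions(1)[OF q]] inv_involutions(2)[OF q] by simp
      finally show "inv.point_map (point_map x) \<in> A.moved (inv_into (carrier K) h q) \<longleftrightarrow>
        x \<in> A.moved (inv_into (carrier K) h q)" .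
    qed (use x inv.point_map_mem point_map_mem in auto)
  next
    fix y assume y: "y \<in> topspace T"
    show "point_map (inv.point_map y) = y"
    proof (rule image_eqI)
      fix p assume p: "p \<in> involutions"
      have "point_map (inv.point_map y) \<in> B.moved (h p) \<longleftrightarrow> inv.point_map y \<in> A.moved p"
        using point_map_moved_iff p y inv.point_map_mem by blast
      also have "\<dots> \<longleftrightarrow> y \<in> B.moved (h p)"
        using inv.point_map_moved_iff[OF y h_involutions[OF p]] inv_h involutionsD(1)[OF p] by simp
      finally show "point_map (inv.point_map y) \<in> B.moved (h p) \<longleftrightarrow> y \<in> B.moved (h p)" .
    qed (use y inv.point_map_mem point_map_mem in auto)
  qed
  then have "homeomorphic_map S T point_map"
    using homeomorphic_map_maps by blast
  then show thesis using that point_map_act by blast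
qed

end

section \<open>Topological full groups of profinite groups\<close>

text \<open>A profinite group seen through a countable base \<open>V\<close> of open normal
  subgroups at the identity; by \<open>openin_T\<close> the left cosets of the \<open>V n\<close>
  form a base of the topology.\<close>

locale profinite_chain = group B for B :: "('x, 'm) monoid_scheme" (structure) +
  fixes V :: "nat \<Rightarrow> 'x set" and T :: "'x topology"
  assumes normal_V: "V n \<lhd> B"
    and finite_rcosets_V: "finite (rcosets (V n))"
    and decseq_V: "decseq V"
    and Inter_V: "(\<Inter>n. V n) = {\<one>}"
    and openin_T: "openin T S \<longleftrightarrow> S \<subseteq> carrier B \<and> (\<forall>x\<in>S. \<exists>n. \<forall>v\<in>V n. x \<otimes> v \<in> S)"
    and compact_T: "compact_space T"
begin

section \<open>Cosets of the chain as a uniform structure\<close>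

lemma subgroup_V: "subgroup (V n) B"
  using normal_V normal_imp_subgroup by blast

lemma V_carrier [simp]: "v \<in> V n \<Longrightarrow> v \<in> carrier B"
  using subgroup_V subgroup.mem_carrier by metis

lemma V_one [simp]: "\<one> \<in> V n"
  using subgroup_V subgroup.one_closed by metis

lemma V_mult [simp]: "u \<in> V n \<Longrightarrow> v \<in> V n \<Longrightarrow> u \<otimes> v \<in> V n"
  using subgroup_V subgroup.m_closed by metis

lemma V_inv [simp]: "v \<in> V n \<Longrightarrow> inv v \<in> V n"
  using subgroup_V subgroup.m_inv_closed by metis

lemma V_conj: "v \<in> V n \<Longrightarrow> x \<in> carrier B \<Longrightarrow> x \<otimes> v \<otimes> inv x \<in> V n"
  using normal.inv_op_closed2[OF normal_V] by metis

lemma V_conj': "v \<in> V n \<Longrightarrow> x \<in> carrier B \<Longrightarrow> inv x \<otimes> v \<otimes> x \<in> V n"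
  using normal.inv_op_closed1[OF normal_V] by metis

lemma V_mono: "m \<le> n \<Longrightarrow> v \<in> V n \<Longrightarrow> v \<in> V m"
  using decseq_V by (auto simp: decseq_def)

lemma V_separates:
  assumes "x \<in> carrier B" "x \<noteq> \<one>"
  obtains n where "x \<notin> V n"
  using Inter_V assms by blast

lemma V_cancel: "v \<in> V n \<Longrightarrow> x \<in> carrier B \<Longrightarrow> x \<otimes> v \<in> V n \<longleftrightarrow> x \<in> V n"
  by (metis V_carrier V_inv V_mult inv_closed inv_solve_right m_closed r_inv m_assoc r_one)

lemma inv_mult_cancel [simp]: "x \<in> carrier B \<Longrightarrow> y \<in> carrier B \<Longrightarrow> inv x \<otimes> (x \<otimes> y) = y"
  by (simp flip: m_assoc)

lemma mult_inv_cancel: "x \<in> carrier B \<Longrightarrow> y \<in> carrier B \<Longrightarrow> x \<otimes> (inv x \<otimes> y) = y"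
  by (simp flip: m_assoc)

lemma topspace_T [simp]: "topspace T = carrier B"
  by (rule antisym; unfold topspace_def) (force simp: openin_T)+

lemma translation_invariant_complement:
  assumes "A \<subseteq> carrier B" "\<forall>x\<in>A. \<forall>v\<in>V n. x \<otimes> v \<in> A" "x \<in> carrier B - A" "v \<in> V n"
  shows "x \<otimes> v \<in> carrier B - A"
proof -
  have "x \<otimes> v \<notin> A"
  proof
    assume "x \<otimes> v \<in> A"
    then have "x \<otimes> v \<otimes> inv v \<in> A" using assms by simp
    then show False using assms by (simp add: m_assoc)
  qed
  then show ?thesis using assms by simp
qed

text \<open>A Lebesgue number argument. The hypothesis holds on a whole coset \<open>x V n\<close>
  and not just at \<open>x\<close>; finitely many such cosets cover the space, and a bound for their
  levels works everywhere.\<close>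

lemma uniform_on_cosets:
  assumes R: "\<And>x. x \<in> carrier B \<Longrightarrow> \<exists>n. \<forall>u\<in>V n. \<forall>v\<in>V n. R (x \<otimes> u) (x \<otimes> u \<otimes> v)"
  shows "\<exists>n. \<forall>x\<in>carrier B. \<forall>v\<in>V n. R x (x \<otimes> v)"
proof -
  obtain k where k: "\<And>x u v. x \<in> carrier B \<Longrightarrow> u \<in> V (k x) \<Longrightarrow> v \<in> V (k x) \<Longrightarrow> R (x \<otimes> u) (x \<otimes> u \<otimes> v)"
    using R by metis
  define C where "C x = {x \<otimes> u | u. u \<in> V (k x)}" for x
  have C_open: "openin T (C x)" if x: "x \<in> carrier B" for x
    unfolding openin_T
  proof (intro conjI ballI exI)
    fix y v assume "y \<in> C x" and v: "v \<in> V (k x)"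
    then obtain u where u: "u \<in> V (k x)" "y = x \<otimes> u" by (auto simp: C_def)
    then have "y \<otimes> v = x \<otimes> (u \<otimes> v)" using x v by (simp add: m_assoc)
    then show "y \<otimes> v \<in> C x" unfolding C_def using u v V_mult by blast
  qed (use x in \<open>auto simp: C_def\<close>)
  have C_mem: "x \<in> C x" if "x \<in> carrier B" for x
    using that by (auto simp: C_def intro: exI[of _ \<one>])
  have "\<And>U. U \<in> C ` carrier B \<Longrightarrow> openin T U"
    using C_open by blast
  moreover have "topspace T \<subseteq> \<Union>(C ` carrier B)"
    using C_mem by fastforce
  ultimately obtain \<F> where "finite \<F>" "\<F> \<subseteq> C ` carrier B" "topspace T \<subseteq> \<Union>\<F>"
    using compactinD[OF compact_T[unfolded compact_space_def]] by meson
  then obtain F where F: "F \<subseteq> carrier B" "finite F" "carrier B \<subseteq> \<Union>(C ` F)"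
    using finite_subset_image[of \<F> C "carrier B"] by auto
  obtain N where N: "\<And>f. f \<in> F \<Longrightarrow> k f \<le> N"
    using F(2) by (metis Max_ge finite_imageI imageI)
  have "R x (x \<otimes> v)" if x: "x \<in> carrier B" and v: "v \<in> V N" for x v
  proof -
    obtain f u where f: "f \<in> F" "u \<in> V (k f)" "x = f \<otimes> u"
      using F(3) x by (auto simp: C_def)
    then show ?thesis
      using k[of f u v] V_mono[OF N v] F(1) by blast
  qed
  then show ?thesis by blast
qed

text \<open>Membership in a clopen set is locally constant, and compactness makes the level uniform.
  Clopen sets are handled in this form from here on.\<close>

lemma clopenin_iff:
  "clopenin T A \<longleftrightarrow> A \<subseteq> carrier B \<and> (\<exists>n. \<forall>x\<in>A. \<forall>v\<in>V n. x \<otimes> v \<in> A)"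
proof
  assume A: "clopenin T A"
  then have sub: "A \<subseteq> carrier B" and co: "openin T (carrier B - A)"
    by (auto simp: closedin_def)
  have "\<exists>n. \<forall>x\<in>carrier B. \<forall>v\<in>V n. (x \<in> A \<longrightarrow> x \<otimes> v \<in> A)"
  proof (rule uniform_on_cosets)
    fix x assume x: "x \<in> carrier B"
    obtain n where n: "(\<forall>v\<in>V n. x \<otimes> v \<in> A) \<or> (\<forall>v\<in>V n. x \<otimes> v \<in> carrier B - A)"
      using A co x unfolding openin_T by blast
    show "\<exists>n. \<forall>u\<in>V n. \<forall>v\<in>V n. x \<otimes> u \<in> A \<longrightarrow> x \<otimes> u \<otimes> v \<in> A"
      using n x by (intro exI[of _ n]) (auto simp: m_assoc)
  qed
  then show "A \<subseteq> carrier B \<and> (\<exists>n. \<forall>x\<in>A. \<forall>v\<in>V n. x \<otimes> v \<in> A)"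
    using sub by blast
next
  assume "A \<subseteq> carrier B \<and> (\<exists>n. \<forall>x\<in>A. \<forall>v\<in>V n. x \<otimes> v \<in> A)"
  then obtain n where A: "A \<subseteq> carrier B" "\<forall>x\<in>A. \<forall>v\<in>V n. x \<otimes> v \<in> A" by blast
  then have "openin T A" "openin T (carrier B - A)"
    using A translation_invariant_complement[OF A] unfolding openin_T by blast+
  then show "clopenin T A" using A(1) by (simp add: closedin_def)
qed

text \<open>The left coset \<open>x V n\<close>, written without an existential so that comparing
  cells becomes a membership test in \<open>V n\<close>.\<close>

definition cell :: "'x \<Rightarrow> nat \<Rightarrow> 'x set" where
  "cell x n = {y \<in> carrier B. inv x \<otimes> y \<in> V n}"

lemma cell_translate:
  assumes x: "x \<in> carrier B" and y: "y \<in> cell x n" and v: "v \<in> V n"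
  shows "y \<otimes> v \<in> cell x n"
proof -
  have "inv x \<otimes> (y \<otimes> v) = (inv x \<otimes> y) \<otimes> v"
    using assms by (simp add: cell_def m_assoc)
  then show ?thesis using assms by (auto simp: cell_def)
qed

lemma clopenin_cell: "x \<in> carrier B \<Longrightarrow> clopenin T (cell x n)"
  unfolding clopenin_iff using cell_translate[of x _ n] by (auto simp: cell_def intro!: exI[of _ n])

lemma cell_centre [simp]: "x \<in> carrier B \<Longrightarrow> x \<in> cell x n"
  by (simp add: cell_def)

lemma cellE:
  assumes "y \<in> cell x n" "x \<in> carrier B"
  obtains v where "v \<in> V n" "y = x \<otimes> v"
proof
  show "inv x \<otimes> y \<in> V n" using assms by (simp add: cell_def)
  show "y = x \<otimes> (inv x \<otimes> y)" using assms by (simp add: cell_def flip: m_assoc)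
qed

lemma mult_mem_cell [simp]: "x \<in> carrier B \<Longrightarrow> a \<in> carrier B \<Longrightarrow> x \<otimes> a \<in> cell x n \<longleftrightarrow> a \<in> V n"
  by (simp add: cell_def flip: m_assoc)

lemma ex_cell_subset:
  assumes "openin T W" "x \<in> W"
  obtains n where "cell x n \<subseteq> W"
proof -
  have "x \<in> carrier B" using assms openin_T by blast
  moreover obtain n where "\<forall>v\<in>V n. x \<otimes> v \<in> W"
    using assms openin_T by blast
  ultimately have "cell x n \<subseteq> W"
    by (auto elim: cellE)
  then show thesis by (rule that)
qed

lemma Hausdorff_T: "Hausdorff_space T"
  unfolding Hausdorff_space_def
proof (intro allI impI)
  fix x y assume xy: "x \<in> topspace T \<and> y \<in> topspace T \<and> x \<noteq> y"
  then have x: "x \<in> carrier B" "y \<in> carrier B" by auto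
  have "inv x \<otimes> y \<noteq> \<one>"
    using xy by (metis inv_equality inv_inv inv_closed topspace_T)
  then obtain n where "inv x \<otimes> y \<notin> V n"
    using V_separates x by (metis inv_closed m_closed)
  then have "y \<in> topspace T - cell x n"
    using x by (simp add: cell_def)
  moreover have "clopenin T (cell x n)" using clopenin_cell x by blast
  ultimately show "\<exists>U W. openin T U \<and> openin T W \<and> x \<in> U \<and> y \<in> W \<and> disjnt U W"
    using x by (intro exI[of _ "cell x n"] exI[of _ "topspace T - cell x n"])
      (auto simp: disjnt_iff closedin_def)
qed

section \<open>The full group of the left action\<close>

abbreviation full_group_set :: "('x \<Rightarrow> 'x) set" where
  "full_group_set \<equiv> topological_full_group_set T (carrier B) (left_action B)"

abbreviation full_group :: "('x \<Rightarrow> 'x) monoid" where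
  "full_group \<equiv> topological_full_group T (carrier B) (left_action B)"

text \<open>Left translations are exactly the maps commuting with all right translations, so locally being
  a left translation means commuting with right translations by some \<^term>\<open>V n\<close>.\<close>

definition commutes_at :: "nat \<Rightarrow> ('x \<Rightarrow> 'x) \<Rightarrow> bool" where
  "commutes_at n f \<longleftrightarrow> (\<forall>x\<in>carrier B. \<forall>v\<in>V n. f (x \<otimes> v) = f x \<otimes> v)"

lemma commutes_at_mono: "commutes_at m f \<Longrightarrow> m \<le> n \<Longrightarrow> commutes_at n f"
  using V_mono by (auto simp: commutes_at_def)

text \<open>From level \<open>n\<close> on, \<open>f\<close> maps the coset of \<open>x\<close> onto
  the coset of \<open>f x\<close>, so preimages and images of open sets are open.\<close>

lemma homeomorphic_map_if_commutes_at:
  assumes f: "bij_betw f (carrier B) (carrier B)" and n: "commutes_at n f"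
  shows "homeomorphic_map T T f"
proof (rule bijective_open_imp_homeomorphic_map)
  have fc: "f x \<in> carrier B" if "x \<in> carrier B" for x
    using f that bij_betwE by blast
  show "continuous_map T T f"
    unfolding continuous_map_def
  proof (intro conjI allI impI)
    fix U assume U: "openin T U"
    show "openin T {x \<in> topspace T. f x \<in> U}"
      unfolding openin_T
    proof (intro conjI ballI)
      fix x assume x: "x \<in> {x \<in> topspace T. f x \<in> U}"
      then obtain m where m: "\<forall>v\<in>V m. f x \<otimes> v \<in> U"
        using U openin_T by blast
      have "x \<otimes> v \<in> {x \<in> topspace T. f x \<in> U}" if v: "v \<in> V (max m n)" for v
      proof -
        have "v \<in> V m" "v \<in> V n" using V_mono v max.cobounded1 max.cobounded2 by blast+
        then show ?thesis using m n x by (auto simp: commutes_at_def)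
      qed
      then show "\<exists>n. \<forall>v\<in>V n. x \<otimes> v \<in> {x \<in> topspace T. f x \<in> U}" by blast
    qed auto
  qed (use fc in auto)
  show "open_map T T f"
    unfolding open_map_def
  proof (intro allI impI)
    fix U assume U: "openin T U"
    then have sub: "U \<subseteq> carrier B" by (simp add: openin_T)
    show "openin T (f ` U)"
      unfolding openin_T
    proof (intro conjI ballI)
      fix y assume "y \<in> f ` U"
      then obtain x where x: "x \<in> U" "y = f x" by blast
      then obtain m where m: "\<forall>v\<in>V m. x \<otimes> v \<in> U"
        using U openin_T by blast
      have "y \<otimes> v \<in> f ` U" if v: "v \<in> V (max m n)" for v
      proof -
        have "v \<in> V m" "v \<in> V n" using V_mono v max.cobounded1 max.cobounded2 by blast+
        then have "y \<otimes> v = f (x \<otimes> v)" "x \<otimes> v \<in> U"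
          using m n x sub by (auto simp: commutes_at_def)
        then show ?thesis by blast
      qed
      then show "\<exists>n. \<forall>v\<in>V n. y \<otimes> v \<in> f ` U" by blast
    qed (use sub fc in auto)
  qed
qed (use f in \<open>auto simp: bij_betw_def\<close>)

text \<open>Forward: on each piece \<open>f\<close> is a left translation, so it commutes with small
  right translations, and compactness makes the level uniform. Backward:
  \<open>f (a v) = f a v = (f a a^-1) (a v)\<close> on the coset \<open>a V n\<close>, and these
  finitely many cosets form the partition.\<close>

lemma full_group_set_iff:
  "f \<in> full_group_set \<longleftrightarrow> f \<in> Bij (carrier B) \<and> (\<exists>n. commutes_at n f)"
proof
  assume L: "f \<in> full_group_set"
  then obtain P where P: "partition_on (carrier B) P"
    "\<And>A. A \<in> P \<Longrightarrow> clopenin T A \<and> (\<exists>g\<in>carrier B. \<forall>y\<in>A. f y = left_action B g y)"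
    by (auto simp: topological_full_group_set_def)
  \<comment> \<open>The factor \<open>inv x (x v)\<close> is just \<open>v\<close>, expressed
    through the two points \<open>x\<close> and \<open>x v\<close> as
    \<open>uniform_on_cosets\<close> requires.\<close>
  have "\<exists>n. \<forall>x\<in>carrier B. \<forall>v\<in>V n. f (x \<otimes> v) = f x \<otimes> (inv x \<otimes> (x \<otimes> v))"
  proof (rule uniform_on_cosets)
    fix x assume x: "x \<in> carrier B"
    then obtain A where A: "A \<in> P" "x \<in> A"
      using P(1) by (auto simp: partition_on_def)
    then obtain g where g: "g \<in> carrier B" "\<And>y. y \<in> A \<Longrightarrow> f y = g \<otimes> y"
      using P(2) by (metis left_action_def)
    obtain n where n: "\<forall>v\<in>V n. x \<otimes> v \<in> A"
      using P(2)[OF A(1)] A(2) openin_T by blast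
    have "f (x \<otimes> u \<otimes> v) = f (x \<otimes> u) \<otimes> (inv (x \<otimes> u) \<otimes> (x \<otimes> u \<otimes> v))"
      if "u \<in> V n" "v \<in> V n" for u v
    proof -
      have "x \<otimes> u \<in> A" "x \<otimes> (u \<otimes> v) \<in> A"
        using n that by auto
      then have "f (x \<otimes> u) = g \<otimes> (x \<otimes> u)" "f (x \<otimes> u \<otimes> v) = g \<otimes> (x \<otimes> u \<otimes> v)"
        using g(2) that x by (auto simp: m_assoc)
      moreover have "inv (x \<otimes> u) \<otimes> (x \<otimes> u \<otimes> v) = v"
        using that x by (simp only: inv_mult_cancel V_carrier m_closed)
      moreover have "g \<otimes> (x \<otimes> u \<otimes> v) = g \<otimes> (x \<otimes> u) \<otimes> v"
        using that x g(1) by (simp only: m_assoc V_carrier m_closed)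
      ultimately show ?thesis by (simp only:)
    qed
    then show "\<exists>n. \<forall>u\<in>V n. \<forall>v\<in>V n. f (x \<otimes> u \<otimes> v) = f (x \<otimes> u) \<otimes> (inv (x \<otimes> u) \<otimes> (x \<otimes> u \<otimes> v))"
      by blast
  qed
  then have "\<exists>n. commutes_at n f"
    by (auto simp: commutes_at_def inv_mult_cancel)
  then show "f \<in> Bij (carrier B) \<and> (\<exists>n. commutes_at n f)"
    using L by (simp add: topological_full_group_set_def)
next
  assume R: "f \<in> Bij (carrier B) \<and> (\<exists>n. commutes_at n f)"
  then obtain n where n: "commutes_at n f" by blast
  have bij: "bij_betw f (carrier B) (carrier B)" using R by (simp add: Bij_def)
  interpret N: normal "V n" B by (rule normal_V)
  have "\<exists>P. finite P \<and> partition_on (carrier B) P \<and>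
      (\<forall>A\<in>P. openin T A \<and> closedin T A \<and> (\<exists>g\<in>carrier B. \<forall>y\<in>A. f y = left_action B g y))"
  proof (intro exI conjI ballI)
    show "finite (rcosets (V n))" by (rule finite_rcosets_V)
    show "partition_on (carrier B) (rcosets (V n))"
    proof (rule partition_onI)
      show "\<Union> (rcosets V n) = carrier B"
        using rcosets_part_G[OF subgroup_V] .
      show "\<And>p q. p \<in> rcosets V n \<Longrightarrow> q \<in> rcosets V n \<Longrightarrow> p \<noteq> q \<Longrightarrow> disjnt p q"
        using rcos_disjoint[OF subgroup_V] by (auto simp: pairwise_def)
      show "{} \<notin> rcosets V n"
        using N.rcosets_non_empty by blast
    qed
    fix A assume "A \<in> rcosets (V n)"
    then obtain a where a: "a \<in> carrier B" "A = a <# V n"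
      using N.coset_eq by (auto simp: RCOSETS_def)
    have A: "A = {a \<otimes> v | v. v \<in> V n}" using a(2) by (auto simp: l_coset_def)
    have "clopenin T A"
      unfolding clopenin_iff
    proof (intro conjI exI ballI)
      fix x v assume "x \<in> A" "v \<in> V n"
      then show "x \<otimes> v \<in> A"
        unfolding A using a(1) m_assoc V_mult by (smt (verit) V_carrier mem_Collect_eq)
    qed (use A a in auto)
    then show "openin T A" "closedin T A" by auto
    show "\<exists>g\<in>carrier B. \<forall>y\<in>A. f y = left_action B g y"
    proof (intro bexI ballI)
      have fa: "f a \<in> carrier B" using bij a(1) bij_betwE by blast
      then show "f a \<otimes> inv a \<in> carrier B" using a(1) by simp
      fix y assume "y \<in> A"
      then obtain v where v: "v \<in> V n" "y = a \<otimes> v" using A by blast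
      have "f a \<otimes> inv a \<otimes> (a \<otimes> v) = f a \<otimes> (inv a \<otimes> a) \<otimes> v"
        using fa a(1) v by (simp add: m_assoc)
      then show "f y = left_action B (f a \<otimes> inv a) y"
        using n v a(1) fa by (auto simp: commutes_at_def left_action_def)
    qed
  qed
  then show "f \<in> full_group_set"
    using R homeomorphic_map_if_commutes_at[OF bij n] by (simp add: topological_full_group_set_def)
qed

lemma subgroup_full_group_set: "subgroup full_group_set (BijGroup (carrier B))"
proof (rule group.subgroupI[OF group_BijGroup])
  show "full_group_set \<subseteq> carrier (BijGroup (carrier B))"
    by (auto simp: full_group_set_iff BijGroup_def)
  have "(\<lambda>x\<in>carrier B. x) \<in> full_group_set"
    unfolding full_group_set_iff by (auto simp: id_Bij commutes_at_def)
  then show "full_group_set \<noteq> {}" by blast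
next
  fix f assume "f \<in> full_group_set"
  then obtain n where f: "f \<in> Bij (carrier B)" "commutes_at n f"
    by (auto simp: full_group_set_iff)
  have bij: "bij_betw f (carrier B) (carrier B)" using f by (simp add: Bij_def)
  have "commutes_at n (\<lambda>x\<in>carrier B. inv_into (carrier B) f x)"
    unfolding commutes_at_def
  proof (intro ballI)
    fix y v assume y: "y \<in> carrier B" and v: "v \<in> V n"
    then obtain x where x: "x \<in> carrier B" "y = f x"
      using bij by (auto simp: bij_betw_def)
    then have "y \<otimes> v = f (x \<otimes> v)"
      using f v by (simp add: commutes_at_def)
    then show "(\<lambda>x\<in>carrier B. inv_into (carrier B) f x) (y \<otimes> v) =
        (\<lambda>x\<in>carrier B. inv_into (carrier B) f x) y \<otimes> v"
      using x y v bij bij_betw_inv_into_left[OF bij, of "x \<otimes> v"] bij_betw_inv_into_left[OF bij, of x]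
        bij_betwE[OF bij]
      by simp
  qed
  then show "inv\<^bsub>BijGroup (carrier B)\<^esub> f \<in> full_group_set"
    using f restrict_inv_into_Bij by (auto simp: inv_BijGroup full_group_set_iff)
next
  fix f g assume "f \<in> full_group_set" "g \<in> full_group_set"
  then obtain m n where f: "f \<in> Bij (carrier B)" "commutes_at m f"
    and g: "g \<in> Bij (carrier B)" "commutes_at n g"
    by (auto simp: full_group_set_iff)
  then have "commutes_at (max m n) f" "commutes_at (max m n) g"
    using commutes_at_mono by simp_all
  moreover have "g x \<in> carrier B" if "x \<in> carrier B" for x
    using g that Bij_imp_funcset by blast
  ultimately have "commutes_at (max m n) (compose (carrier B) f g)"
    by (auto simp: commutes_at_def compose_def)
  then show "f \<otimes>\<^bsub>BijGroup (carrier B)\<^esub> g \<in> full_group_set"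
    using f g by (auto simp: full_group_set_iff BijGroup_def compose_Bij)
qed

lemma group_full_group: "group full_group"
  unfolding topological_full_group_def topspace_T
  using group.subgroup_imp_group[OF group_BijGroup subgroup_full_group_set] .

lemma carrier_full_group [simp]: "carrier full_group = full_group_set"
  by (simp add: topological_full_group_def)

lemma full_group_setE:
  assumes "f \<in> full_group_set"
  obtains n where "bij_betw f (carrier B) (carrier B)" "commutes_at n f"
  using assms that by (auto simp: full_group_set_iff Bij_def)

lemma full_group_closed [simp]: "f \<in> full_group_set \<Longrightarrow> x \<in> carrier B \<Longrightarrow> f x \<in> carrier B"
  by (metis full_group_setE bij_betwE)

lemma one_full_group: "\<one>\<^bsub>full_group\<^esub> = (\<lambda>x\<in>carrier B. x)"
  by (simp add: topological_full_group_def BijGroup_def)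

lemma mult_full_group:
  "f \<in> full_group_set \<Longrightarrow> g \<in> full_group_set \<Longrightarrow> f \<otimes>\<^bsub>full_group\<^esub> g = compose (carrier B) f g"
  by (simp add: topological_full_group_def BijGroup_def full_group_set_iff)

lemma restrict_mem_full_group_set:
  assumes "bij_betw f (carrier B) (carrier B)" "commutes_at n f"
  shows "restrict f (carrier B) \<in> full_group_set"
  unfolding full_group_set_iff
proof (intro conjI exI)
  show "restrict f (carrier B) \<in> Bij (carrier B)"
    using assms(1) by (auto simp: Bij_def bij_betw_def inj_on_def)
  show "commutes_at n (restrict f (carrier B))"
    using assms(2) by (simp add: commutes_at_def)
qed

lemma translation_mem:
  assumes a: "a \<in> carrier B"
  shows "(\<lambda>x\<in>carrier B. a \<otimes> x) \<in> full_group_set"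
proof (rule restrict_mem_full_group_set)
  show "bij_betw (\<lambda>x. a \<otimes> x) (carrier B) (carrier B)"
    using a by (simp add: bij_betw_def inj_on_multc inj_on_cmult surj_const_mult)
  show "commutes_at 0 (\<lambda>x. a \<otimes> x)"
    using a by (simp add: commutes_at_def m_assoc)
qed

text \<open>The set \<open>A\<close>, its image and the remaining points are all unions of cosets of
  level \<open>max m n\<close>, where \<open>m\<close> belongs to \<open>A\<close> and
  \<open>n\<close> to \<open>g\<close>. Pasting \<open>g\<close>, its inverse and the identity on
  them therefore commutes with that level again.\<close>

lemma swap_full_group:
  assumes g: "g \<in> full_group_set" and A: "clopenin T A" and dis: "\<And>x. x \<in> A \<Longrightarrow> g x \<notin> A"
  shows "\<exists>s\<in>full_group_set. (\<forall>x\<in>A. s x = g x) \<and> (\<forall>x\<in>A. s (g x) = x) \<and>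
    (\<forall>x\<in>carrier B. x \<notin> A \<longrightarrow> x \<notin> g ` A \<longrightarrow> s x = x)"
proof -
  obtain n where bij: "bij_betw g (carrier B) (carrier B)" and n: "commutes_at n g"
    by (rule full_group_setE[OF g])
  obtain m where sub: "A \<subseteq> carrier B" and m: "\<forall>x\<in>A. \<forall>v\<in>V m. x \<otimes> v \<in> A"
    using A[unfolded clopenin_iff] by blast
  let ?k = "max m n"
  have k: "v \<in> V m" "v \<in> V n" if "v \<in> V ?k" for v
    using that V_mono max.cobounded1 max.cobounded2 by blast+
  have gc: "g x \<in> carrier B" if "x \<in> carrier B" for x using g that by simp
  define s where "s x = (if x \<in> A then g x else if x \<in> g ` A then inv_into (carrier B) g x else x)" for x
  have s1: "s x = g x" if "x \<in> A" for x using that by (simp add: s_def)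
  have s2: "s (g x) = x" if "x \<in> A" for x
    using that dis sub bij by (auto simp: s_def bij_betw_inv_into_left)
  have s3: "s x = x" if "x \<notin> A" "x \<notin> g ` A" for x using that by (simp add: s_def)
  have ss: "s (s x) = x" if "x \<in> carrier B" for x
    using s1 s2 s3 by (cases "x \<in> A \<or> x \<in> g ` A") auto
  have sc: "s x \<in> carrier B" if "x \<in> carrier B" for x
    using s1 s2 s3 that gc sub by (cases "x \<in> A \<or> x \<in> g ` A") auto
  have "bij_betw s (carrier B) (carrier B)"
    by (rule bij_betwI[of _ _ _ s]) (use ss sc in auto)
  moreover have "commutes_at ?k s"
    unfolding commutes_at_def
  proof (intro ballI)
    fix x v assume x: "x \<in> carrier B" and v: "v \<in> V ?k"
    have gA: "\<forall>y\<in>g ` A. \<forall>v\<in>V ?k. y \<otimes> v \<in> g ` A"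
    proof (intro ballI)
      fix y u assume "y \<in> g ` A" and u: "u \<in> V ?k"
      then obtain z where z: "z \<in> A" "y = g z" by blast
      then have "y \<otimes> u = g (z \<otimes> u)" "z \<otimes> u \<in> A"
        using n m k[OF u] sub by (auto simp: commutes_at_def)
      then show "y \<otimes> u \<in> g ` A" by blast
    qed
    consider "x \<in> A" | z where "z \<in> A" "x = g z" | "x \<notin> A" "x \<notin> g ` A" by blast
    then show "s (x \<otimes> v) = s x \<otimes> v"
    proof cases
      case 1
      then show ?thesis
        using s1 m k[OF v] n x by (simp add: commutes_at_def)
    next
      case 2
      then have "x \<otimes> v = g (z \<otimes> v)" "z \<otimes> v \<in> A"
        using n m k[OF v] sub by (auto simp: commutes_at_def)
      then show ?thesis using s2 2 by simp
    next
      case 3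
      have "x \<otimes> v \<in> carrier B - A"
        using translation_invariant_complement[OF sub m, of x v] 3 x k[OF v] by blast
      moreover have "x \<otimes> v \<in> carrier B - g ` A"
        using translation_invariant_complement[OF _ gA, of x v] 3 x v gc sub by blast
      ultimately show ?thesis using s3 3 by simp
    qed
  qed
  ultimately have "restrict s (carrier B) \<in> full_group_set"
    by (rule restrict_mem_full_group_set)
  then show ?thesis
    using s1 s2 s3 sub gc by (intro bexI[of _ "restrict s (carrier B)"]) auto
qed

lemma infinite_V:
  assumes "infinite (carrier B)"
  shows "infinite (V n)"
proof
  assume fin: "finite (V n)"
  have "finite c" if "c \<in> rcosets (V n)" for c
    using that fin by (auto simp: RCOSETS_def r_coset_def)
  then have "finite (\<Union>(rcosets (V n)))"
    using finite_rcosets_V by blast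
  then show False
    using assms rcosets_part_G[OF subgroup_V] by simp
qed

text \<open>The composite of two swaps acts as a 3-cycle on points of \<open>A\<close>: it sends
  \<open>x\<close> to \<open>x b\<close> and \<open>x b\<close> to \<open>x a\<close>. Infinitude of
  \<open>V n\<close> supplies the distinct \<open>a\<close> and \<open>b\<close>.\<close>

lemma local_square_full_group:
  assumes inf: "infinite (carrier B)" and A: "clopenin T A" and x: "x \<in> A"
  shows "\<exists>g\<in>full_group_set. (\<forall>y\<in>carrier B. y \<notin> A \<longrightarrow> g y = y) \<and> g (g x) \<noteq> x"
proof -
  obtain n where sub: "A \<subseteq> carrier B" and n: "\<forall>x\<in>A. \<forall>v\<in>V n. x \<otimes> v \<in> A"
    using A[unfolded clopenin_iff] by blast
  then have xB: "x \<in> carrier B" using x by blast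
  obtain a where a: "a \<in> V n" "a \<noteq> \<one>"
    using infinite_V[OF inf] by (metis finite.emptyI finite_insert finite_subset insertI1 subsetI)
  obtain b where b: "b \<in> V n" "b \<noteq> \<one>" "b \<noteq> a"
    using infinite_V[OF inf, of n] by (metis finite.emptyI finite_insert finite_subset insertCI subsetI)
  have ab: "a \<in> carrier B" "b \<in> carrier B" using a b by auto
  have ne: "inv a \<otimes> b \<noteq> \<one>"
    using b(3) ab by (metis inv_equality inv_inv inv_closed)
  obtain i j k where "a \<notin> V i" "b \<notin> V j" "inv a \<otimes> b \<notin> V k"
    using V_separates a(2) b(2) ne ab by (metis inv_closed m_closed)
  \<comment> \<open>At level \<open>m\<close> the cells of \<open>x\<close>, \<open>x a\<close> and
    \<open>x b\<close> are distinct, and \<open>n \<le> m\<close> keeps them inside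
    \<open>A\<close>.\<close>
  then obtain m where m: "a \<notin> V m" "b \<notin> V m" "inv a \<otimes> b \<notin> V m" "n \<le> m"
    using V_mono[of i "max n (max i (max j k))"] V_mono[of j "max n (max i (max j k))"]
      V_mono[of k "max n (max i (max j k))"] by (metis max.cobounded1 max.cobounded2 max.coboundedI2 max.coboundedI1)
  let ?C = "cell x m"
  have C: "clopenin T ?C" using clopenin_cell xB by blast
  have CA: "?C \<subseteq> A"
  proof
    fix y assume "y \<in> ?C"
    then obtain v where "v \<in> V m" "y = x \<otimes> v" using cellE[OF _ xB] by metis
    then show "y \<in> A" using n x V_mono[OF m(4)] by simp
  qed
  have ex_swap: "\<exists>s\<in>full_group_set. s x = x \<otimes> c \<and> s (x \<otimes> c) = x \<and> (\<forall>y\<in>carrier B. y \<notin> A \<longrightarrow> s y = y)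
      \<and> (\<forall>y\<in>carrier B. y \<notin> ?C \<longrightarrow> inv (x \<otimes> c) \<otimes> y \<notin> V m \<longrightarrow> s y = y)"
    if c: "c \<in> V n" "c \<notin> V m" for c
  proof -
    have cB: "c \<in> carrier B" using c by simp
    \<comment> \<open>The left translation carrying \<open>x v\<close> to \<open>x c v\<close>,
      hence the cell of \<open>x\<close> to that of \<open>x c\<close>.\<close>
    let ?g = "\<lambda>y\<in>carrier B. x \<otimes> c \<otimes> inv x \<otimes> y"
    have g: "?g (x \<otimes> v) = x \<otimes> c \<otimes> v" if "v \<in> V m" for v
    proof -
      have "x \<otimes> c \<otimes> inv x \<otimes> (x \<otimes> v) = x \<otimes> c \<otimes> (inv x \<otimes> x) \<otimes> v"
        using that xB cB by (simp add: m_assoc)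
      then show ?thesis using xB cB that by simp
    qed
    have off: "?g y \<notin> ?C" if y: "y \<in> ?C" for y
    proof -
      obtain v where v: "v \<in> V m" "y = x \<otimes> v" by (rule cellE[OF y xB])
      have "?g y = x \<otimes> (c \<otimes> v)" using v g xB cB by (simp add: m_assoc)
      then show ?thesis using V_cancel[OF v(1) cB] c(2) xB cB v(1) by simp
    qed
    obtain s where s: "s \<in> full_group_set" "\<forall>y\<in>?C. s y = ?g y" "\<forall>y\<in>?C. s (?g y) = y"
      "\<forall>y\<in>carrier B. y \<notin> ?C \<longrightarrow> y \<notin> ?g ` ?C \<longrightarrow> s y = y"
      using swap_full_group[OF translation_mem[of "x \<otimes> c \<otimes> inv x"] C off] xB cB by auto
    have img: "y \<in> A \<and> inv (x \<otimes> c) \<otimes> y \<in> V m" if y: "y \<in> ?g ` ?C" for y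
    proof -
      obtain z where z: "z \<in> ?C" "y = ?g z" using y by blast
      obtain v where v: "v \<in> V m" "z = x \<otimes> v" by (rule cellE[OF z(1) xB])
      then have v: "v \<in> V m" "y = x \<otimes> c \<otimes> v" using g z by simp_all
      then have "y = x \<otimes> (c \<otimes> v)" using xB cB by (simp add: m_assoc)
      then have "y \<in> A" using n x c V_mono[OF m(4) v(1)] by simp
      moreover have "inv (x \<otimes> c) \<otimes> y = v" using v(1) xB cB by (simp only: v(2) inv_mult_cancel V_carrier m_closed)
      ultimately show ?thesis using v by simp
    qed
    have gx: "?g x = x \<otimes> c" using g[of \<one>] xB cB by simp
    show ?thesis
    proof (intro bexI[OF _ s(1)] conjI ballI impI)
      show "s x = x \<otimes> c" "s (x \<otimes> c) = x" using s(2,3) cell_centre[OF xB, of m] gx by metis+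
      show "s y = y" if "y \<in> carrier B" "y \<notin> A" for y
        using that s(4) CA img by blast
      show "s y = y" if "y \<in> carrier B" "y \<notin> ?C" "inv (x \<otimes> c) \<otimes> y \<notin> V m" for y
        using that s(4) img by blast
    qed
  qed
  obtain s where s: "s \<in> full_group_set" "s x = x \<otimes> a" "\<forall>y\<in>carrier B. y \<notin> A \<longrightarrow> s y = y"
    "\<forall>y\<in>carrier B. y \<notin> ?C \<longrightarrow> inv (x \<otimes> a) \<otimes> y \<notin> V m \<longrightarrow> s y = y"
    using ex_swap[OF a(1) m(1)] by blast
  obtain t where t: "t \<in> full_group_set" "t x = x \<otimes> b" "t (x \<otimes> b) = x" "\<forall>y\<in>carrier B. y \<notin> A \<longrightarrow> t y = y"
    using ex_swap[OF b(1) m(2)] by blast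
  have "inv (x \<otimes> a) \<otimes> (x \<otimes> b) = inv a \<otimes> (inv x \<otimes> x) \<otimes> b"
    using xB ab by (simp add: inv_mult_group m_assoc)
  \<comment> \<open>The point \<open>x b\<close> lies in neither of the two cells exchanged by
    \<open>s\<close>.\<close>
  then have sb: "s (x \<otimes> b) = x \<otimes> b"
    using s(4) m xB ab by simp
  let ?r = "compose (carrier B) s t"
  show ?thesis
  proof (intro bexI conjI ballI impI)
    show "?r \<in> full_group_set"
      using monoid.m_closed[OF group.is_monoid[OF group_full_group], of s t] s(1) t(1) mult_full_group by simp
    show "?r y = y" if "y \<in> carrier B" "y \<notin> A" for y
      using that s t by (simp add: compose_def)
    have "?r (?r x) = x \<otimes> a"
      using s(2) t(2,3) sb xB ab by (simp add: compose_def)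
    then show "?r (?r x) \<noteq> x"
      using a(2) ab xB inv_mult_cancel[of x a] by (metis l_inv)
  qed
qed

lemma rich_action_full_group:
  assumes inf: "infinite (carrier B)"
  shows "rich_action full_group T (\<lambda>f. f)"
proof (rule rich_action.intro[OF group_full_group], unfold_locales)
  fix g assume "g \<in> carrier full_group"
  then have g: "g \<in> full_group_set" by simp
  obtain n where bij: "bij_betw g (carrier B) (carrier B)" and n: "commutes_at n g"
    by (rule full_group_setE[OF g])
  show "g x \<in> topspace T" if "x \<in> topspace T" for x using g that by simp
  show "(g \<otimes>\<^bsub>full_group\<^esub> h) x = g (h x)" if "h \<in> carrier full_group" "x \<in> topspace T" for h x
    using g that by (simp add: mult_full_group compose_def)
  show "g = \<one>\<^bsub>full_group\<^esub>" if "\<And>x. x \<in> topspace T \<Longrightarrow> g x = x"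
  proof
    fix x show "g x = \<one>\<^bsub>full_group\<^esub> x"
      using that g by (cases "x \<in> carrier B")
        (auto simp: one_full_group full_group_set_iff dest: Bij_imp_extensional simp: extensional_def)
  qed
  show "clopenin T {x \<in> topspace T. g x \<in> A}" if A: "clopenin T A" for A
  proof -
    obtain m where m: "\<forall>x\<in>A. \<forall>v\<in>V m. x \<otimes> v \<in> A"
      using A[unfolded clopenin_iff] by blast
    have "\<forall>x\<in>{x \<in> topspace T. g x \<in> A}. \<forall>v\<in>V (max m n). x \<otimes> v \<in> {x \<in> topspace T. g x \<in> A}"
      using m n V_mono[of m "max m n"] V_mono[of n "max m n"] by (auto simp: commutes_at_def)
    then show ?thesis unfolding clopenin_iff by auto
  qed
  have "\<forall>x\<in>{x \<in> topspace T. g x \<noteq> x}. \<forall>v\<in>V n. x \<otimes> v \<in> {x \<in> topspace T. g x \<noteq> x}"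
    using n g by (auto simp: commutes_at_def)
  then show "clopenin T {x \<in> topspace T. g x \<noteq> x}" unfolding clopenin_iff by auto
  show "\<exists>s\<in>carrier full_group. (\<forall>x\<in>A. s x = g x) \<and> (\<forall>x\<in>A. s (g x) = x) \<and>
      (\<forall>x\<in>topspace T. x \<notin> A \<longrightarrow> x \<notin> g ` A \<longrightarrow> s x = x)"
    if "clopenin T A" "\<And>x. x \<in> A \<Longrightarrow> g x \<notin> A" for A
    using swap_full_group[OF g that] by simp
next
  fix A x assume "clopenin T A" "x \<in> A"
  then show "\<exists>g\<in>carrier full_group. (\<forall>y\<in>topspace T. y \<notin> A \<longrightarrow> g y = y) \<and> g (g x) \<noteq> x"
    using local_square_full_group[OF inf] by simp
next
  fix W x assume W: "openin T W" "x \<in> W"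
  then have "x \<in> carrier B" using openin_T by blast
  then show "\<exists>A. clopenin T A \<and> x \<in> A \<and> A \<subseteq> W"
    using ex_cell_subset[OF W] clopenin_cell cell_centre by metis
qed (auto simp: one_full_group compact_T Hausdorff_T)

end

section \<open>From isomorphic clopen subgroups to isomorphic full groups\<close>

lemma BijGroup_conj_iso:
  assumes f: "\<And>x. x \<in> S \<Longrightarrow> f x \<in> T" "\<And>x. x \<in> S \<Longrightarrow> f' (f x) = x"
    and f': "\<And>y. y \<in> T \<Longrightarrow> f' y \<in> S" "\<And>y. y \<in> T \<Longrightarrow> f (f' y) = y"
    and sub: "M \<subseteq> Bij S" "N \<subseteq> Bij T"
    and conj: "\<And>g. g \<in> M \<Longrightarrow> (\<lambda>y\<in>T. f (g (f' y))) \<in> N"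
    and conj': "\<And>g. g \<in> N \<Longrightarrow> (\<lambda>x\<in>S. f' (g (f x))) \<in> M"
  shows "BijGroup S\<lparr>carrier := M\<rparr> \<cong> BijGroup T\<lparr>carrier := N\<rparr>"
proof -
  let ?\<Phi> = "\<lambda>g. \<lambda>y\<in>T. f (g (f' y))" and ?\<Psi> = "\<lambda>g. \<lambda>x\<in>S. f' (g (f x))"
  have M: "g x \<in> S" "g \<in> extensional S" "g \<in> Bij S" if "g \<in> M" "x \<in> S" for g x
    using that sub(1) Bij_imp_funcset Bij_imp_extensional by blast+
  have N: "g y \<in> T" "g \<in> extensional T" "g \<in> Bij T" if "g \<in> N" "y \<in> T" for g y
    using that sub(2) Bij_imp_funcset Bij_imp_extensional by blast+
  have "bij_betw ?\<Phi> M N"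
  proof (rule bij_betwI)
    show "?\<Psi> (?\<Phi> g) = g" if g: "g \<in> M" for g
    proof
      fix x show "?\<Psi> (?\<Phi> g) x = g x"
        using M[OF g] f Bij_imp_extensional[of g S] sub g by (cases "x \<in> S") (auto simp: extensional_def)
    qed
    show "?\<Phi> (?\<Psi> g) = g" if g: "g \<in> N" for g
    proof
      fix x show "?\<Phi> (?\<Psi> g) x = g x"
        using N[OF g] f' Bij_imp_extensional[of g T] sub g by (cases "x \<in> T") (auto simp: extensional_def)
    qed
  qed (use conj conj' in blast)+
  moreover have "?\<Phi> \<in> hom (BijGroup S\<lparr>carrier := M\<rparr>) (BijGroup T\<lparr>carrier := N\<rparr>)"
  proof (rule homI)
    show "?\<Phi> g \<in> carrier (BijGroup T\<lparr>carrier := N\<rparr>)" if "g \<in> carrier (BijGroup S\<lparr>carrier := M\<rparr>)" for g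
      using conj that by simp
    fix g h assume "g \<in> carrier (BijGroup S\<lparr>carrier := M\<rparr>)" "h \<in> carrier (BijGroup S\<lparr>carrier := M\<rparr>)"
    then have gh: "g \<in> M" "h \<in> M" by auto
    then have "g \<in> Bij S" "h \<in> Bij S" "?\<Phi> g \<in> Bij T" "?\<Phi> h \<in> Bij T"
      using sub conj by blast+
    moreover have "?\<Phi> (compose S g h) = compose T (?\<Phi> g) (?\<Phi> h)"
      using M[OF gh(1)] M[OF gh(2)] f f' by (auto simp: compose_def fun_eq_iff)
    ultimately show "?\<Phi> (g \<otimes>\<^bsub>BijGroup S\<lparr>carrier := M\<rparr>\<^esub> h) =
        ?\<Phi> g \<otimes>\<^bsub>BijGroup T\<lparr>carrier := N\<rparr>\<^esub> ?\<Phi> h"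
      by (simp add: BijGroup_def)
  qed
  ultimately show ?thesis by (auto simp: is_iso_def iso_def)
qed

text \<open>The pieces are carried over by \<open>f\<close> and, by equivariance, keep their group
  elements; hence one acting set \<open>K\<close> for both actions.\<close>

lemma topological_full_group_set_conj:
  assumes f: "homeomorphic_maps S T f f'"
    and equi: "\<And>k x. k \<in> K \<Longrightarrow> x \<in> topspace S \<Longrightarrow> f (\<alpha> k x) = \<beta> k (f x)"
    and g: "g \<in> topological_full_group_set S K \<alpha>"
  shows "(\<lambda>y\<in>topspace T. f (g (f' y))) \<in> topological_full_group_set T K \<beta>"
proof -
  have hf: "homeomorphic_map S T f" "homeomorphic_map T S f'"
    using f homeomorphic_maps_map by blast+
  have ff': "f (f' y) = y" "f' y \<in> topspace S" if "y \<in> topspace T" for y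
    using f that by (auto simp: homeomorphic_maps_def continuous_map_def)
  have f'f: "f' (f x) = x" "f x \<in> topspace T" if "x \<in> topspace S" for x
    using f that by (auto simp: homeomorphic_maps_def continuous_map_def)
  obtain P where P: "finite P" "partition_on (topspace S) P"
    "\<And>A. A \<in> P \<Longrightarrow> openin S A \<and> closedin S A \<and> (\<exists>k\<in>K. \<forall>y\<in>A. g y = \<alpha> k y)"
    and hg: "homeomorphic_map S S g"
    using g by (auto simp: topological_full_group_set_def)
  have "homeomorphic_map T T (f \<circ> g \<circ> f')"
    using hf hg by (meson homeomorphic_map_compose)
  then have h: "homeomorphic_map T T (\<lambda>y\<in>topspace T. f (g (f' y)))"
    by (rule homeomorphic_map_eq) auto
  then have "(\<lambda>y\<in>topspace T. f (g (f' y))) \<in> Bij (topspace T)"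
    by (auto simp: Bij_def bij_betw_def homeomorphic_eq_everything_map)
  moreover have "partition_on (topspace T) ((\<lambda>A. f ` A) ` P)"
  proof (rule partition_onI)
    have "f ` topspace S = topspace T"
      using hf(1) by (rule homeomorphic_imp_surjective_map)
    then show "\<Union> ((\<lambda>A. f ` A) ` P) = topspace T"
      using partition_onD1[OF P(2)] by (auto simp: image_Union)
    show "{} \<notin> (\<lambda>A. f ` A) ` P"
      using partition_onD3[OF P(2)] by auto
    fix p q assume "p \<in> (\<lambda>A. f ` A) ` P" "q \<in> (\<lambda>A. f ` A) ` P" "p \<noteq> q"
    then obtain A A' where A: "A \<in> P" "A' \<in> P" "p = f ` A" "q = f ` A'" "A \<noteq> A'" by blast
    then have "A \<inter> A' = {}" "A \<subseteq> topspace S" "A' \<subseteq> topspace S"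
      using P(2) by (auto simp: partition_on_def disjoint_def)
    then show "disjnt p q"
      using A(3,4) f'f(1) by (auto simp: disjnt_iff) (metis disjoint_iff subsetD)
  qed
  moreover have "openin T (f ` A) \<and> closedin T (f ` A) \<and>
      (\<exists>k\<in>K. \<forall>y\<in>f ` A. (\<lambda>y\<in>topspace T. f (g (f' y))) y = \<beta> k y)" if A: "A \<in> P" for A
  proof -
    obtain k where k: "k \<in> K" "\<And>y. y \<in> A \<Longrightarrow> g y = \<alpha> k y" and op: "openin S A" "closedin S A"
      using P(3)[OF A] by blast
    have sub: "A \<subseteq> topspace S" using op(1) openin_subset by blast
    have "openin T (f ` A)" "closedin T (f ` A)"
      using op homeomorphic_map_openness[OF hf(1) sub] homeomorphic_map_closedness[OF hf(1) sub] by auto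
    moreover have "(\<lambda>y\<in>topspace T. f (g (f' y))) y = \<beta> k y" if y: "y \<in> f ` A" for y
    proof -
      obtain x where "x \<in> A" "y = f x" using y by blast
      then show ?thesis using f'f[of x] k equi[of k x] sub by auto
    qed
    ultimately show ?thesis using k(1) by blast
  qed
  ultimately show ?thesis
    using P(1) h unfolding topological_full_group_set_def by blast
qed

lemma topological_full_group_conj_iso:
  assumes f: "homeomorphic_maps S T f f'"
    and equi: "\<And>k x. k \<in> K \<Longrightarrow> x \<in> topspace S \<Longrightarrow> \<alpha> k x \<in> topspace S \<and> f (\<alpha> k x) = \<beta> k (f x)"
  shows "topological_full_group S K \<alpha> \<cong> topological_full_group T K \<beta>"
  unfolding topological_full_group_def
proof (rule BijGroup_conj_iso)
  have ff': "f (f' y) = y" "f' y \<in> topspace S" if "y \<in> topspace T" for y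
    using f that by (auto simp: homeomorphic_maps_def continuous_map_def)
  have f'f: "f' (f x) = x" "f x \<in> topspace T" if "x \<in> topspace S" for x
    using f that by (auto simp: homeomorphic_maps_def continuous_map_def)
  show "f x \<in> topspace T" "f' (f x) = x" if "x \<in> topspace S" for x using f'f that by auto
  show "f' y \<in> topspace S" "f (f' y) = y" if "y \<in> topspace T" for y using ff' that by auto
  show "(\<lambda>y\<in>topspace T. f (g (f' y))) \<in> topological_full_group_set T K \<beta>"
    if "g \<in> topological_full_group_set S K \<alpha>" for g
    using topological_full_group_set_conj[OF f _ that] equi by blast
  have "f' (\<beta> k y) = \<alpha> k (f' y)" if "k \<in> K" "y \<in> topspace T" for k y
    using equi[OF that(1) ff'(2)[OF that(2)]] f'f(1) ff'(1)[OF that(2)] by metis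
  then show "(\<lambda>x\<in>topspace S. f' (g (f x))) \<in> topological_full_group_set S K \<alpha>"
    if "g \<in> topological_full_group_set T K \<beta>" for g
    using topological_full_group_set_conj[OF f[THEN homeomorphic_maps_sym[THEN iffD1]] _ that] by blast
qed (auto simp: topological_full_group_set_def)

section \<open>Inversion as a homeomorphism\<close>

context profinite_chain
begin

text \<open>\<open>(x v)^-1 = x^-1 (x v^-1 x^-1)\<close>, and normality puts the last factor back
  into \<open>V n\<close>.\<close>

lemma continuous_inv: "continuous_map T T (\<lambda>x. inv x)"
  unfolding continuous_map_def
proof (intro conjI allI impI)
  fix U assume U: "openin T U"
  show "openin T {x \<in> topspace T. inv x \<in> U}"
    unfolding openin_T
  proof (intro conjI ballI)
    fix x assume x: "x \<in> {x \<in> topspace T. inv x \<in> U}"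
    then obtain n where n: "\<forall>v\<in>V n. inv x \<otimes> v \<in> U"
      using U unfolding openin_T by blast
    have "inv (x \<otimes> v) \<in> U" if v: "v \<in> V n" for v
    proof -
      have "inv (x \<otimes> v) = inv x \<otimes> (x \<otimes> inv v \<otimes> inv x)"
        using x v by (simp add: inv_mult_group m_assoc)
      then show ?thesis using n V_conj[of "inv v" n x] x v by simp
    qed
    then show "\<exists>n. \<forall>v\<in>V n. x \<otimes> v \<in> {x \<in> topspace T. inv x \<in> U}"
      using x by auto
  qed auto
qed auto

lemma homeomorphic_maps_inv: "homeomorphic_maps T T (\<lambda>x. inv x) (\<lambda>x. inv x)"
  using continuous_inv by (simp add: homeomorphic_maps_def)

lemma left_right_full_group_iso:
  "full_group \<cong> topological_full_group T (carrier B) (right_action B)"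
  "topological_full_group T (carrier B) (right_action B) \<cong> full_group"
  by (rule topological_full_group_conj_iso[OF homeomorphic_maps_inv];
      auto simp: left_action_def right_action_def inv_mult_group)+

end

text \<open>A choice of coset representatives identifies a group \<^term>\<open>B\<close> with
  \<^term>\<open>(rcosets\<^bsub>B\<^esub> U) \<times> U\<close>, compatibly with right translations by \<^term>\<open>U\<close>. The coset of \<^term>\<open>x\<close> is
  recorded as that of its inverse, turning left cosets into right cosets.\<close>

locale coset_coordinates = group B for B :: "('x, 'm) monoid_scheme" (structure) +
  fixes U :: "'x set"
  assumes subgroup_U: "subgroup U B"
begin

definition coset :: "'x \<Rightarrow> 'x set" where
  "coset x = U #> inv x"

definition rep :: "'x set \<Rightarrow> 'x" where
  "rep c = (SOME r. r \<in> carrier B \<and> U #> r = c)"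

definition part :: "'x \<Rightarrow> 'x" where
  "part x = rep (coset x) \<otimes> x"

definition point :: "'x set \<Rightarrow> 'x \<Rightarrow> 'x" where
  "point c u = inv (rep c) \<otimes> u"

lemma U_carrier [simp]: "u \<in> U \<Longrightarrow> u \<in> carrier B"
  using subgroup.mem_carrier[OF subgroup_U] .

lemma coset_mem [simp]: "x \<in> carrier B \<Longrightarrow> coset x \<in> rcosets U"
  by (auto simp: coset_def RCOSETS_def)

lemma rep:
  assumes "c \<in> rcosets U"
  shows "rep c \<in> carrier B" "U #> rep c = c"
proof -
  have "\<exists>r. r \<in> carrier B \<and> U #> r = c" using assms by (auto simp: RCOSETS_def)
  from someI_ex[OF this] show "rep c \<in> carrier B" "U #> rep c = c" by (auto simp: rep_def)
qed

lemma part_mem [simp]: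
  assumes x: "x \<in> carrier B"
  shows "part x \<in> U"
proof -
  have "rep (coset x) \<in> U #> inv x"
    using rep[OF coset_mem[OF x]] rcos_self[OF _ subgroup_U, of "rep (coset x)"]
    by (simp add: coset_def)
  then obtain u where "u \<in> U" "rep (coset x) = u \<otimes> inv x"
    by (auto simp: r_coset_def)
  then show ?thesis using x by (simp add: part_def m_assoc)
qed

lemma point_carrier [simp]: "c \<in> rcosets U \<Longrightarrow> u \<in> U \<Longrightarrow> point c u \<in> carrier B"
  using rep by (simp add: point_def)

lemma coset_right_mult [simp]:
  assumes "x \<in> carrier B" "u \<in> U"
  shows "coset (x \<otimes> u) = coset x"
proof -
  have "U #> inv (x \<otimes> u) = (U #> inv u) #> inv x"
    using assms subgroup.subset[OF subgroup_U] by (simp add: inv_mult_group coset_mult_assoc)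
  also have "U #> inv u = U"
    using assms subgroup_U coset_join2 subgroup.m_inv_closed by (metis U_carrier inv_closed)
  finally show ?thesis by (simp add: coset_def)
qed

lemma part_right_mult [simp]: "x \<in> carrier B \<Longrightarrow> u \<in> U \<Longrightarrow> part (x \<otimes> u) = part x \<otimes> u"
  using rep(1)[OF coset_mem, of x] by (simp add: part_def m_assoc)

lemma point_right_mult [simp]: "c \<in> rcosets U \<Longrightarrow> u \<in> U \<Longrightarrow> v \<in> U \<Longrightarrow> point c (u \<otimes> v) = point c u \<otimes> v"
  using rep(1) by (simp add: point_def m_assoc)

lemma coset_point [simp]:
  assumes "c \<in> rcosets U" "u \<in> U"
  shows "coset (point c u) = c"
proof -
  have "coset (point c u) = coset (inv (rep c))"
    using assms rep(1) by (simp add: point_def)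
  then show ?thesis using rep[OF assms(1)] by (simp add: coset_def)
qed

lemma part_point [simp]: "c \<in> rcosets U \<Longrightarrow> u \<in> U \<Longrightarrow> part (point c u) = u"
  using rep(1)[of c] by (simp add: part_def) (simp add: point_def flip: m_assoc)

lemma point_part [simp]: "x \<in> carrier B \<Longrightarrow> point (coset x) (part x) = x"
  using rep(1)[OF coset_mem, of x] by (simp add: part_def point_def flip: m_assoc)

end

section \<open>Extending a subgroup isomorphism over the cosets\<close>

locale profinite_chain_pair = X: profinite_chain B V T + Y: profinite_chain C W S
  for B :: "('x, 'm) monoid_scheme" and V T and C :: "('y, 'n) monoid_scheme" and W S
begin

lemma flip: "profinite_chain_pair C W S B V T"
  by unfold_locales

text \<open>The map \<open>f\<close> intertwines right translation by \<open>u\<close> with right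
  translation by \<open>\<phi> u\<close>. If \<open>g\<close> commutes with \<open>V n\<close>, its
  conjugate thus commutes with every \<open>w\<close> for which \<open>\<phi>' w\<close> lies in
  \<open>V n\<close>; by \<open>cont\<close> these include some \<open>W m\<close>.\<close>

lemma conj_mem_full_group:
  assumes f: "\<And>x. x \<in> carrier B \<Longrightarrow> f x \<in> carrier C" "\<And>x. x \<in> carrier B \<Longrightarrow> f' (f x) = x"
    and f': "\<And>y. y \<in> carrier C \<Longrightarrow> f' y \<in> carrier B" "\<And>y. y \<in> carrier C \<Longrightarrow> f (f' y) = y"
    and fU: "\<And>x u. x \<in> carrier B \<Longrightarrow> u \<in> U1 \<Longrightarrow> f (x \<otimes>\<^bsub>B\<^esub> u) = f x \<otimes>\<^bsub>C\<^esub> \<phi> u"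
    and f'U: "\<And>y u. y \<in> carrier C \<Longrightarrow> u \<in> U2 \<Longrightarrow> f' (y \<otimes>\<^bsub>C\<^esub> u) = f' y \<otimes>\<^bsub>B\<^esub> \<phi>' u"
    and \<phi>': "\<And>u. u \<in> U2 \<Longrightarrow> \<phi>' u \<in> U1" "\<And>u. u \<in> U2 \<Longrightarrow> \<phi> (\<phi>' u) = u" "U1 \<subseteq> carrier B"
    and cont: "\<And>n. \<exists>m. \<forall>w\<in>W m. w \<in> U2 \<and> \<phi>' w \<in> V n"
    and g: "g \<in> X.full_group_set"
  shows "(\<lambda>y\<in>carrier C. f (g (f' y))) \<in> Y.full_group_set"
proof -
  obtain n where bij: "bij_betw g (carrier B) (carrier B)" and n: "X.commutes_at n g"
    by (rule X.full_group_setE[OF g])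
  obtain m where m: "\<And>w. w \<in> W m \<Longrightarrow> w \<in> U2 \<and> \<phi>' w \<in> V n"
    using cont by blast
  show ?thesis
  proof (rule Y.restrict_mem_full_group_set)
    have "bij_betw f' (carrier C) (carrier B)" "bij_betw f (carrier B) (carrier C)"
      using f f' by (auto intro!: bij_betwI[of _ _ _ f] bij_betwI[of _ _ _ f'])
    then have "bij_betw (f \<circ> (g \<circ> f')) (carrier C) (carrier C)"
      using bij by (blast intro: bij_betw_trans)
    then show "bij_betw (\<lambda>y. f (g (f' y))) (carrier C) (carrier C)"
      by (simp add: comp_def)
    show "Y.commutes_at m (\<lambda>y. f (g (f' y)))"
      unfolding Y.commutes_at_def
    proof (intro ballI)
      fix y w assume y: "y \<in> carrier C" and w: "w \<in> W m"
      then have w2: "w \<in> U2" "\<phi>' w \<in> V n" using m by auto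
      have "g (f' (y \<otimes>\<^bsub>C\<^esub> w)) = g (f' y) \<otimes>\<^bsub>B\<^esub> \<phi>' w"
        using f'U[OF y w2(1)] n w2(2) f'(1)[OF y] by (simp add: X.commutes_at_def)
      moreover have "g (f' y) \<in> carrier B" using g f'(1)[OF y] by simp
      ultimately show "f (g (f' (y \<otimes>\<^bsub>C\<^esub> w))) = f (g (f' y)) \<otimes>\<^bsub>C\<^esub> w"
        using fU \<phi>' w2(1) by simp
    qed
  qed
qed

text \<open>Turns continuity between subspaces into the statement about levels that
  \<open>conj_mem_full_group\<close> takes as \<open>cont\<close>.\<close>

lemma subgroup_map_continuous_at_one:
  assumes U: "openin S U2" "\<one>\<^bsub>C\<^esub> \<in> U2" and \<phi>: "continuous_map (subtopology S U2) (subtopology T U1) \<phi>"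
    and one: "\<phi> \<one>\<^bsub>C\<^esub> = \<one>\<^bsub>B\<^esub>"
  shows "\<exists>m. \<forall>w\<in>W m. w \<in> U2 \<and> \<phi> w \<in> V n"
proof -
  have V: "openin T (V n)"
    using X.V_carrier X.V_mult unfolding X.openin_T by blast
  have "\<phi> w \<in> U1" if "w \<in> U2" for w
    using \<phi> that openin_subset[OF U(1)] by (auto simp: continuous_map_def Pi_iff)
  then have eq: "{w \<in> topspace (subtopology S U2). \<phi> w \<in> V n \<inter> U1} = {w \<in> U2. \<phi> w \<in> V n}"
    using openin_subset[OF U(1)] by auto
  have "openin (subtopology T U1) (V n \<inter> U1)"
    using V by (auto simp: openin_subtopology)
  then have "openin (subtopology S U2) {w \<in> U2. \<phi> w \<in> V n}"
    using \<phi> unfolding eq[symmetric] continuous_map_def by blast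
  then have "openin S {w \<in> U2. \<phi> w \<in> V n}"
    using U(1) by (metis openin_trans_full)
  then obtain m where "\<forall>w\<in>W m. \<one>\<^bsub>C\<^esub> \<otimes>\<^bsub>C\<^esub> w \<in> {w \<in> U2. \<phi> w \<in> V n}"
    using U(2) one unfolding Y.openin_T by force
  then show ?thesis by auto
qed

lemma full_groups_iso_if_subgroups_iso:
  assumes U1: "clopen_subgroup U1 B T" and U2: "clopen_subgroup U2 C S"
    and iso: "topological_group_isomorphic (B\<lparr>carrier := U1\<rparr>) (subtopology T U1) (C\<lparr>carrier := U2\<rparr>) (subtopology S U2)"
    and fin: "finite (rcosets\<^bsub>B\<^esub> U1)" "finite (rcosets\<^bsub>C\<^esub> U2)"
    and card: "card (rcosets\<^bsub>B\<^esub> U1) = card (rcosets\<^bsub>C\<^esub> U2)"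
  shows "X.full_group \<cong> Y.full_group"
proof -
  interpret U1: coset_coordinates B U1
    using U1 X.is_group
    by (simp add: coset_coordinates_def coset_coordinates_axioms_def clopen_subgroup_def)
  interpret U2: coset_coordinates C U2
    using U2 Y.is_group
    by (simp add: coset_coordinates_def coset_coordinates_axioms_def clopen_subgroup_def)
  obtain \<phi> where \<phi>: "\<phi> \<in> Group.iso (B\<lparr>carrier := U1\<rparr>) (C\<lparr>carrier := U2\<rparr>)" and
    h\<phi>: "homeomorphic_map (subtopology T U1) (subtopology S U2) \<phi>"
    using iso by (auto simp: topological_group_isomorphic_def)
  have bij: "bij_betw \<phi> U1 U2" using \<phi> by (simp add: iso_def)
  define \<phi>' where "\<phi>' = inv_into U1 \<phi>"
  have m: "\<phi> u \<in> U2" "\<phi>' (\<phi> u) = u" if "u \<in> U1" for u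
    using bij that by (auto simp: \<phi>'_def bij_betw_inv_into_left dest: bij_betwE)
  have m': "\<phi>' u \<in> U1" "\<phi> (\<phi>' u) = u" if "u \<in> U2" for u
    using bij that bij_betw_inv_into[OF bij] by (auto simp: \<phi>'_def bij_betw_inv_into_right dest: bij_betwE)
  have U1c: "a \<otimes>\<^bsub>B\<^esub> b \<in> U1" if "a \<in> U1" "b \<in> U1" for a b
    using that subgroup.m_closed[OF U1.subgroup_U] by blast
  have hom: "\<phi> (a \<otimes>\<^bsub>B\<^esub> b) = \<phi> a \<otimes>\<^bsub>C\<^esub> \<phi> b" if "a \<in> U1" "b \<in> U1" for a b
    using \<phi> that by (auto simp: iso_def hom_def)
  have hom': "\<phi>' (a \<otimes>\<^bsub>C\<^esub> b) = \<phi>' a \<otimes>\<^bsub>B\<^esub> \<phi>' b" if "a \<in> U2" "b \<in> U2" for a b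
    using hom[of "\<phi>' a" "\<phi>' b"] m' m(2)[OF U1c] that by metis
  have one: "\<phi> \<one>\<^bsub>B\<^esub> = \<one>\<^bsub>C\<^esub>"
  proof -
    have o: "\<one>\<^bsub>B\<^esub> \<in> U1" using subgroup.one_closed[OF U1.subgroup_U] .
    then have "\<phi> \<one>\<^bsub>B\<^esub> \<otimes>\<^bsub>C\<^esub> \<phi> \<one>\<^bsub>B\<^esub> = \<phi> \<one>\<^bsub>B\<^esub>" using hom[OF o o] by simp
    then show ?thesis using m(1)[OF o] Y.inv_mult_cancel[of "\<phi> \<one>\<^bsub>B\<^esub>" "\<phi> \<one>\<^bsub>B\<^esub>"] by simp
  qed
  have one': "\<phi>' \<one>\<^bsub>C\<^esub> = \<one>\<^bsub>B\<^esub>"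
    using one m(2) subgroup.one_closed[OF U1.subgroup_U] by metis
  have sub: "U1 \<subseteq> topspace T" "U2 \<subseteq> topspace S" by auto
  have c: "continuous_map (subtopology T U1) (subtopology S U2) \<phi>"
    using h\<phi> homeomorphic_imp_continuous_map by blast
  obtain \<psi> where \<psi>: "homeomorphic_maps (subtopology T U1) (subtopology S U2) \<phi> \<psi>"
    using h\<phi> homeomorphic_map_maps by blast
  have \<psi>_eq: "\<psi> u = \<phi>' u" if "u \<in> U2" for u
  proof -
    have u: "u \<in> topspace (subtopology S U2)" using that sub by auto
    then have "\<psi> u \<in> U1" "\<phi> (\<psi> u) = u"
      using \<psi> by (auto simp: homeomorphic_maps_def continuous_map_def Pi_iff)
    then show ?thesis using m(2) by metis
  qed
  have "continuous_map (subtopology S U2) (subtopology T U1) \<psi>"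
    using \<psi> unfolding homeomorphic_maps_def by blast
  then have c': "continuous_map (subtopology S U2) (subtopology T U1) \<phi>'"
    by (rule continuous_map_eq) (simp only: topspace_subtopology Int_iff \<psi>_eq)
  \<comment> \<open>Equality of the indices enters here. Any bijection of the coset spaces will do:
    elements of the full group only have to commute with small right translations, and right
    translations by the subgroup leave \<open>coset\<close> unchanged.\<close>
  obtain \<sigma> where \<sigma>: "bij_betw \<sigma> (rcosets\<^bsub>B\<^esub> U1) (rcosets\<^bsub>C\<^esub> U2)"
    using finite_same_card_bij[OF fin card] by blast
  define \<sigma>' where "\<sigma>' = inv_into (rcosets\<^bsub>B\<^esub> U1) \<sigma>"
  have s: "\<sigma> a \<in> rcosets\<^bsub>C\<^esub> U2" "\<sigma>' (\<sigma> a) = a" if "a \<in> rcosets\<^bsub>B\<^esub> U1" for a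
    using \<sigma> that by (auto simp: \<sigma>'_def bij_betw_inv_into_left dest: bij_betwE)
  have s': "\<sigma>' a \<in> rcosets\<^bsub>B\<^esub> U1" "\<sigma> (\<sigma>' a) = a" if "a \<in> rcosets\<^bsub>C\<^esub> U2" for a
    using \<sigma> that bij_betw_inv_into[OF \<sigma>] by (auto simp: \<sigma>'_def bij_betw_inv_into_right dest: bij_betwE)
  \<comment> \<open>In the coordinates \<open>coset\<close> and \<open>part\<close>,
    \<open>f\<close> is the product of \<open>\<sigma>\<close> and \<open>\<phi>\<close>. It need
    not be a homomorphism; what counts is \<open>fU\<close>.\<close>
  define f where "f x = U2.point (\<sigma> (U1.coset x)) (\<phi> (U1.part x))" for x
  define f' where "f' y = U1.point (\<sigma>' (U2.coset y)) (\<phi>' (U2.part y))" for y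
  have f: "f x \<in> carrier C" "f' (f x) = x" if "x \<in> carrier B" for x
    using that s m by (auto simp: f_def f'_def)
  have f': "f' y \<in> carrier B" "f (f' y) = y" if "y \<in> carrier C" for y
    using that s' m' by (auto simp: f_def f'_def)
  have fU: "f (x \<otimes>\<^bsub>B\<^esub> u) = f x \<otimes>\<^bsub>C\<^esub> \<phi> u" if "x \<in> carrier B" "u \<in> U1" for x u
    using that s m hom by (simp add: f_def)
  have f'U: "f' (y \<otimes>\<^bsub>C\<^esub> u) = f' y \<otimes>\<^bsub>B\<^esub> \<phi>' u" if "y \<in> carrier C" "u \<in> U2" for y u
    using that s' m' hom' by (simp add: f'_def)
  interpret flip: profinite_chain_pair C W S B V T by (rule flip)
  have "\<exists>k. \<forall>w\<in>W k. w \<in> U2 \<and> \<phi>' w \<in> V n" for n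
    using subgroup_map_continuous_at_one[OF _ _ c' one'] U2 subgroup.one_closed[OF U2.subgroup_U]
    by (simp add: clopen_subgroup_def)
  then have "(\<lambda>y\<in>carrier C. f (g (f' y))) \<in> Y.full_group_set" if "g \<in> X.full_group_set" for g
    using conj_mem_full_group[of f f' U1 \<phi> U2 \<phi>' g] f f' fU f'U m' sub that by simp
  moreover have "\<exists>k. \<forall>w\<in>V k. w \<in> U1 \<and> \<phi> w \<in> W n" for n
    using flip.subgroup_map_continuous_at_one[OF _ _ c one] U1 subgroup.one_closed[OF U1.subgroup_U]
    by (simp add: clopen_subgroup_def)
  then have "(\<lambda>x\<in>carrier B. f' (g (f x))) \<in> X.full_group_set" if "g \<in> Y.full_group_set" for g
    using flip.conj_mem_full_group[of f' f U2 \<phi>' U1 \<phi> g] f f' fU f'U m sub that by simp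
  ultimately show ?thesis
    unfolding topological_full_group_def X.topspace_T Y.topspace_T
    using X.full_group_set_iff Y.full_group_set_iff f f'
    by (intro BijGroup_conj_iso[where f = f and f' = f']) auto
qed

end

section \<open>From isomorphic full groups to isomorphic clopen subgroups\<close>

lemma card_image_eq_if_same_kernel:
  assumes "\<And>x y. x \<in> Z \<Longrightarrow> y \<in> Z \<Longrightarrow> F x = F y \<longleftrightarrow> G x = G y"
  shows "card (F ` Z) = card (G ` Z)"
proof (rule bij_betw_same_card)
  have 1: "inv_into Z F (F x) \<in> Z" "F (inv_into Z F (F x)) = F x" if "x \<in> Z" for x
    using that by (auto simp: inv_into_into f_inv_into_f)
  then have "G (inv_into Z F (F x)) = G x" if "x \<in> Z" for x
    using that assms by blast
  then show "bij_betw (\<lambda>c. G (inv_into Z F c)) (F ` Z) (G ` Z)"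
    using assms by (auto simp: bij_betw_def inj_on_def image_iff)
qed

text \<open>Cardinalities of images in a finite quotient replace Haar measure in the comparison of indices.\<close>

lemma card_saturated_partition:
  assumes P: "partition_on C P" and fin: "finite (q ` C)"
    and sat: "\<And>Z y z. Z \<in> P \<Longrightarrow> y \<in> Z \<Longrightarrow> z \<in> C \<Longrightarrow> q y = q z \<Longrightarrow> z \<in> Z"
    and card: "\<And>Z. Z \<in> P \<Longrightarrow> card (q ` Z) = j"
  shows "finite P" "j * card P = card (q ` C)"
proof -
  have sub: "Z \<subseteq> C" if "Z \<in> P" for Z
    using that partition_onD1[OF P] by blast
  \<comment> \<open>Saturation recovers each part from its image under \<open>q\<close>, so distinct
    parts have distinct images.\<close>
  have Z_eq: "Z = {z \<in> C. q z \<in> q ` Z}" if "Z \<in> P" for Z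
    using sub[OF that] sat[OF that] by (auto simp: image_iff)
  have inj: "inj_on (\<lambda>Z. q ` Z) P"
  proof (rule inj_onI)
    fix Y Z assume YZ: "Y \<in> P" "Z \<in> P" "q ` Y = q ` Z"
    show "Y = Z"
      using Z_eq[OF YZ(1)] unfolding YZ(3) Z_eq[OF YZ(2), symmetric] .
  qed
  have "(\<lambda>Z. q ` Z) ` P \<subseteq> Pow (q ` C)"
    using sub by blast
  then have fin': "finite ((\<lambda>Z. q ` Z) ` P)"
    using fin by (simp add: finite_subset)
  then show "finite P"
    using inj finite_imageD by blast
  have U: "\<Union>((\<lambda>Z. q ` Z) ` P) = q ` C"
    using partition_onD1[OF P] by blast
  have "j * card ((\<lambda>Z. q ` Z) ` P) = card (\<Union>((\<lambda>Z. q ` Z) ` P))"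
  proof (rule card_partition[OF fin'])
    show "finite (\<Union>((\<lambda>Z. q ` Z) ` P))" using U fin by simp
    show "card c = j" if "c \<in> (\<lambda>Z. q ` Z) ` P" for c using that card by blast
    fix c d assume "c \<in> (\<lambda>Z. q ` Z) ` P" "d \<in> (\<lambda>Z. q ` Z) ` P" "c \<noteq> d"
    then obtain Y Z where YZ: "Y \<in> P" "Z \<in> P" "c = q ` Y" "d = q ` Z" "Y \<noteq> Z" by blast
    have "Y \<inter> Z = {}"
      using partition_onD2[OF P] YZ by (auto simp: disjoint_def)
    then show "c \<inter> d = {}"
      using YZ sat[OF YZ(1)] sub[OF YZ(2)] by (auto simp: image_iff)
  qed
  then show "j * card P = card (q ` C)"
    using U card_image[OF inj] by simp
qed

section \<open>Cells as units of size, and Baire category\<close>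

context profinite_chain
begin

text \<open>\<open>x v a = x a (a^-1 v a)\<close>, where the last factor stays in \<open>V n\<close>
  by normality.\<close>

lemma continuous_right_mult:
  assumes a: "a \<in> carrier B"
  shows "continuous_map T T (\<lambda>x. x \<otimes> a)"
  unfolding continuous_map_def
proof (intro conjI allI impI)
  fix U assume U: "openin T U"
  show "openin T {x \<in> topspace T. x \<otimes> a \<in> U}"
    unfolding openin_T
  proof (intro conjI ballI)
    fix x assume x: "x \<in> {x \<in> topspace T. x \<otimes> a \<in> U}"
    then obtain n where n: "\<forall>v\<in>V n. x \<otimes> a \<otimes> v \<in> U"
      using U unfolding openin_T by blast
    have "x \<otimes> v \<otimes> a \<in> U" if v: "v \<in> V n" for v
    proof -
      have "x \<otimes> v \<otimes> a = x \<otimes> a \<otimes> (inv a \<otimes> v \<otimes> a)"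
        using x a v r_inv by (simp add: m_assoc) (simp flip: m_assoc)
      then show ?thesis using n V_conj'[OF v a] by simp
    qed
    then show "\<exists>n. \<forall>v\<in>V n. x \<otimes> v \<in> {x \<in> topspace T. x \<otimes> a \<in> U}"
      using x by auto
  qed auto
qed (use a in auto)

lemma homeomorphic_right_mult:
  assumes a: "a \<in> carrier B"
  shows "homeomorphic_map T T (\<lambda>x. x \<otimes> a)"
proof -
  have "homeomorphic_maps T T (\<lambda>x. x \<otimes> a) (\<lambda>x. x \<otimes> inv a)"
    using a continuous_right_mult[OF a] continuous_right_mult[of "inv a"]
    by (simp add: homeomorphic_maps_def m_assoc)
  then show ?thesis using homeomorphic_map_maps by blast
qed

lemma cell_eq_iff:
  assumes "x \<in> carrier B" "y \<in> carrier B"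
  shows "cell x n = cell y n \<longleftrightarrow> inv x \<otimes> y \<in> V n"
proof
  assume "cell x n = cell y n"
  then show "inv x \<otimes> y \<in> V n"
    using cell_centre[OF assms(2), of n] by (auto simp: cell_def)
next
  assume v: "inv x \<otimes> y \<in> V n"
  have "inv x \<otimes> z \<in> V n \<longleftrightarrow> inv y \<otimes> z \<in> V n" if z: "z \<in> carrier B" for z
  proof -
    have "inv x \<otimes> z = (inv x \<otimes> y) \<otimes> (inv y \<otimes> z)"
      using assms z by (simp add: m_assoc) (simp flip: m_assoc)
    moreover have "inv y \<otimes> z = inv (inv x \<otimes> y) \<otimes> (inv x \<otimes> z)"
      using assms z by (simp add: m_assoc inv_mult_group) (simp flip: m_assoc)
    ultimately show ?thesis
      using v V_mult V_inv by metis
  qed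
  then show "cell x n = cell y n"
    by (auto simp: cell_def)
qed

lemma cell_eqE:
  assumes "cell x n = cell y n" "x \<in> carrier B" "y \<in> carrier B"
  obtains v where "v \<in> V n" "y = x \<otimes> v"
  using assms cell_centre cellE by metis

lemma finite_cells: "finite ((\<lambda>x. cell x n) ` carrier B)"
proof (rule finite_subset[OF _ finite_rcosets_V[of n]])
  show "(\<lambda>x. cell x n) ` carrier B \<subseteq> rcosets (V n)"
  proof
    fix c assume "c \<in> (\<lambda>x. cell x n) ` carrier B"
    then obtain x where x: "x \<in> carrier B" "c = cell x n" by blast
    have "c = x <# V n"
      using x by (auto simp: l_coset_def elim: cellE)
    also have "\<dots> = V n #> x"
      using normal.coset_eq[OF normal_V] x by blast
    finally show "c \<in> rcosets (V n)"
      using x by (auto simp: RCOSETS_def)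
  qed
qed

text \<open>Right translation by \<open>a\<close> conjugates the quotient \<open>x^-1 y\<close> by
  \<open>a\<close>, and \<open>V n\<close> is stable under conjugation; so right translations
  permute the cells of each level.\<close>

lemma cell_right_mult:
  assumes "a \<in> carrier B" "x \<in> carrier B" "y \<in> carrier B"
  shows "cell (x \<otimes> a) n = cell (y \<otimes> a) n \<longleftrightarrow> cell x n = cell y n"
proof -
  have 1: "inv (x \<otimes> a) \<otimes> (y \<otimes> a) = inv a \<otimes> (inv x \<otimes> y) \<otimes> a"
    using assms by (simp add: inv_mult_group m_assoc)
  have 2: "inv x \<otimes> y = a \<otimes> (inv a \<otimes> (inv x \<otimes> y) \<otimes> a) \<otimes> inv a"
    using assms by (simp add: m_assoc) (simp flip: m_assoc)
  show ?thesis
    using assms 1 2 V_conj[of _ n a] V_conj'[of _ n a] by (metis cell_eq_iff m_closed)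
qed

text \<open>Since \<open>g (x v) = g x v\<close>, such a \<open>g\<close> permutes the cells of
  level \<open>n\<close>: the counting form of measure preservation.\<close>

lemma cell_commutes_at:
  assumes "bij_betw g (carrier B) (carrier B)" "commutes_at n g" "x \<in> carrier B" "y \<in> carrier B"
  shows "cell (g x) n = cell (g y) n \<longleftrightarrow> cell x n = cell y n"
proof -
  have gc: "g z \<in> carrier B" if "z \<in> carrier B" for z
    using assms(1) that bij_betwE by blast
  have "cell x n = cell y n" if eq: "cell (g x) n = cell (g y) n"
  proof -
    obtain v where v: "v \<in> V n" "g y = g x \<otimes> v"
      by (rule cell_eqE[OF eq gc gc]) (use assms in auto)
    then have "g y = g (x \<otimes> v)" using assms by (simp add: commutes_at_def)
    then have "y = x \<otimes> v"
      using assms v by (auto simp: bij_betw_def inj_on_def)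
    then show ?thesis using v assms by (simp add: cell_eq_iff)
  qed
  moreover have "cell (g x) n = cell (g y) n" if eq: "cell x n = cell y n"
  proof -
    obtain v where v: "v \<in> V n" "y = x \<otimes> v"
      by (rule cell_eqE[OF eq]) (use assms in auto)
    then show ?thesis using assms gc by (simp add: cell_eq_iff commutes_at_def)
  qed
  ultimately show ?thesis by blast
qed

text \<open>By Baire, one of countably many closed sets covering a compact Hausdorff space has
  interior, and an open set contains with each of its points a coset of some
  \<open>V k\<close>.\<close>

lemma ex_translate_in:
  assumes cover: "carrier B = (\<Union>n::nat. E n)" and closed: "\<And>n. closedin T (E n)"
  obtains n k x where "x \<in> carrier B" "\<And>v. v \<in> V k \<Longrightarrow> x \<otimes> v \<in> E n"
proof -
  have "\<exists>n. T interior_of (E n) \<noteq> {}"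
  proof (rule ccontr)
    assume "\<not> ?thesis"
    then have "T interior_of \<Union>(range E) = {}"
      using closed compact_T Hausdorff_T
      by (intro Baire_category_alt)
        (auto intro: compact_imp_locally_compact_space compact_Hausdorff_imp_regular_space)
    then show False
      using cover interior_of_topspace[of T] by auto
  qed
  then obtain n x where x: "x \<in> T interior_of (E n)" by blast
  then obtain k where "\<forall>v\<in>V k. x \<otimes> v \<in> T interior_of (E n)"
    using openin_interior_of[of T "E n"] unfolding openin_T by blast
  then show thesis
    using that[of x k n] x interior_of_subset[of T "E n"] closedin_subset[OF closed, of n] by auto
qed

end

context profinite_chain_pair
begin

text \<open>Near \<open>x\<close> all values of \<open>f\<close> stay in one cell of level
  \<open>m\<close>; that cell is then the cell of each of these values, so any two of them differ by
  an element of \<open>W m\<close>. Compactness makes the neighbourhood uniform.\<close>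

lemma uniformly_continuous:
  assumes f: "continuous_map T S f"
  shows "\<exists>n. \<forall>x\<in>carrier B. \<forall>v\<in>V n. inv\<^bsub>C\<^esub> f x \<otimes>\<^bsub>C\<^esub> f (x \<otimes>\<^bsub>B\<^esub> v) \<in> W m"
proof (rule X.uniform_on_cosets)
  have fc: "f x \<in> carrier C" if "x \<in> carrier B" for x
    using f that by (auto simp: continuous_map_def Pi_iff)
  fix x assume x: "x \<in> carrier B"
  have "openin T {y \<in> topspace T. f y \<in> Y.cell (f x) m}"
    using f Y.clopenin_cell[OF fc[OF x]] unfolding continuous_map_def by blast
  then obtain n where n: "\<forall>v\<in>V n. x \<otimes>\<^bsub>B\<^esub> v \<in> {y \<in> topspace T. f y \<in> Y.cell (f x) m}"
    using x fc unfolding X.openin_T by fastforce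
  have "inv\<^bsub>C\<^esub> f (x \<otimes>\<^bsub>B\<^esub> u) \<otimes>\<^bsub>C\<^esub> f (x \<otimes>\<^bsub>B\<^esub> u \<otimes>\<^bsub>B\<^esub> v) \<in> W m" if uv: "u \<in> V n" "v \<in> V n" for u v
  proof -
    have "f (x \<otimes>\<^bsub>B\<^esub> u) \<in> Y.cell (f x) m" "f (x \<otimes>\<^bsub>B\<^esub> (u \<otimes>\<^bsub>B\<^esub> v)) \<in> Y.cell (f x) m"
      using n uv X.V_mult by blast+
    then have "Y.cell (f x) m = Y.cell (f (x \<otimes>\<^bsub>B\<^esub> u)) m" "Y.cell (f x) m = Y.cell (f (x \<otimes>\<^bsub>B\<^esub> (u \<otimes>\<^bsub>B\<^esub> v))) m"
      using Y.cell_eq_iff fc x uv by (auto simp: Y.cell_def)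
    then show ?thesis
      using Y.cell_eq_iff[of "f (x \<otimes>\<^bsub>B\<^esub> u)" "f (x \<otimes>\<^bsub>B\<^esub> (u \<otimes>\<^bsub>B\<^esub> v))" m] fc x uv by (simp add: X.m_assoc)
  qed
  then show "\<exists>n. \<forall>u\<in>V n. \<forall>v\<in>V n.
      inv\<^bsub>C\<^esub> f (x \<otimes>\<^bsub>B\<^esub> u) \<otimes>\<^bsub>C\<^esub> f (x \<otimes>\<^bsub>B\<^esub> u \<otimes>\<^bsub>B\<^esub> v) \<in> W m"
    by blast
qed

end

section \<open>The cocycle of a conjugating homeomorphism\<close>

locale profinite_conjugacy = profinite_chain_pair +
  fixes f
  assumes homeo: "homeomorphic_map T S f"
    and conj: "g \<in> X.full_group_set \<Longrightarrow> \<exists>g'\<in>Y.full_group_set. \<forall>x\<in>carrier B. f (g x) = g' (f x)"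
begin

lemma f_carrier [simp]: "x \<in> carrier B \<Longrightarrow> f x \<in> carrier C"
  using homeo by (metis X.topspace_T Y.topspace_T homeomorphic_imp_surjective_map imageI)

lemma f_inject [simp]: "x \<in> carrier B \<Longrightarrow> y \<in> carrier B \<Longrightarrow> f x = f y \<longleftrightarrow> x = y"
  using homeomorphic_imp_injective_map[OF homeo] by (auto simp: inj_on_def)

text \<open>The unique element whose left translation carries \<open>f x\<close> to
  \<open>f (z x)\<close>. It is independent of \<open>x\<close> when \<open>f\<close> is a
  homomorphism followed by a right translation.\<close>

definition cocycle :: "'a \<Rightarrow> 'a \<Rightarrow> 'c" where
  "cocycle z x = f (z \<otimes>\<^bsub>B\<^esub> x) \<otimes>\<^bsub>C\<^esub> inv\<^bsub>C\<^esub> f x"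

lemma cocycle_carrier [simp]: "z \<in> carrier B \<Longrightarrow> x \<in> carrier B \<Longrightarrow> cocycle z x \<in> carrier C"
  by (simp add: cocycle_def)

lemma cocycle_f: "z \<in> carrier B \<Longrightarrow> x \<in> carrier B \<Longrightarrow> cocycle z x \<otimes>\<^bsub>C\<^esub> f x = f (z \<otimes>\<^bsub>B\<^esub> x)"
  by (simp add: cocycle_def Y.m_assoc)

lemma cocycle_mult:
  assumes "y \<in> carrier B" "z \<in> carrier B" "x \<in> carrier B"
  shows "cocycle (y \<otimes>\<^bsub>B\<^esub> z) x = cocycle y (z \<otimes>\<^bsub>B\<^esub> x) \<otimes>\<^bsub>C\<^esub> cocycle z x"
  using assms by (simp add: cocycle_def Y.m_assoc X.m_assoc)

lemma translation_conj:
  assumes z: "z \<in> carrier B"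
  obtains g n where "bij_betw g (carrier C) (carrier C)" "Y.commutes_at n g"
    "\<And>x. x \<in> carrier B \<Longrightarrow> f (z \<otimes>\<^bsub>B\<^esub> x) = g (f x)"
proof -
  obtain g where g: "g \<in> Y.full_group_set" "\<forall>x\<in>carrier B. f ((\<lambda>x\<in>carrier B. z \<otimes>\<^bsub>B\<^esub> x) x) = g (f x)"
    using conj[OF X.translation_mem[OF z]] by blast
  obtain n where "bij_betw g (carrier C) (carrier C)" "Y.commutes_at n g"
    by (rule Y.full_group_setE[OF g(1)])
  then show thesis using that g(2) by simp
qed

text \<open>Moving \<open>x\<close> by a small \<open>v\<close> moves \<open>f x\<close> on the
  right by some \<open>w\<close> in \<open>W m\<close>. The conjugate \<open>g\<close> of the
  translation by \<open>z\<close> commutes with right translation by \<open>w\<close>, so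
  \<open>f (z x)\<close> is moved by the same \<open>w\<close>, which cancels in the
  quotient.\<close>

lemma cocycle_locally_constant:
  assumes z: "z \<in> carrier B"
  shows "\<exists>n. \<forall>x\<in>carrier B. \<forall>v\<in>V n. cocycle z (x \<otimes>\<^bsub>B\<^esub> v) = cocycle z x"
proof -
  obtain g m where g: "Y.commutes_at m g" "\<And>x. x \<in> carrier B \<Longrightarrow> f (z \<otimes>\<^bsub>B\<^esub> x) = g (f x)"
    by (rule translation_conj[OF z]) blast
  obtain n where n: "\<And>x v. x \<in> carrier B \<Longrightarrow> v \<in> V n \<Longrightarrow> inv\<^bsub>C\<^esub> f x \<otimes>\<^bsub>C\<^esub> f (x \<otimes>\<^bsub>B\<^esub> v) \<in> W m"
    using uniformly_continuous[OF homeomorphic_imp_continuous_map[OF homeo]] by blast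
  have "cocycle z (x \<otimes>\<^bsub>B\<^esub> v) = cocycle z x" if x: "x \<in> carrier B" and v: "v \<in> V n" for x v
  proof -
    define w where "w = inv\<^bsub>C\<^esub> f x \<otimes>\<^bsub>C\<^esub> f (x \<otimes>\<^bsub>B\<^esub> v)"
    have w: "w \<in> W m" using n[OF x v] by (simp add: w_def)
    have fxv: "f (x \<otimes>\<^bsub>B\<^esub> v) = f x \<otimes>\<^bsub>C\<^esub> w"
      using x v by (simp add: w_def flip: Y.m_assoc)
    have "f (z \<otimes>\<^bsub>B\<^esub> (x \<otimes>\<^bsub>B\<^esub> v)) = f (z \<otimes>\<^bsub>B\<^esub> x) \<otimes>\<^bsub>C\<^esub> w"
      using g(2)[of "x \<otimes>\<^bsub>B\<^esub> v"] g(2)[OF x] x v g(1) w by (simp add: fxv Y.commutes_at_def)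
    then show ?thesis
      using x z w by (simp add: cocycle_def fxv Y.inv_mult_group Y.m_assoc Y.mult_inv_cancel)
  qed
  then show ?thesis by blast
qed

text \<open>The set \<open>E n\<close> collects the \<open>z\<close> whose cocycle is invariant at
  level \<open>n\<close>; it is closed because, for fixed \<open>x\<close>, the cocycle is
  continuous in \<open>z\<close>. Baire puts a coset \<open>z V k\<close> inside one
  \<open>E n\<close>, and the cocycle identity moves the uniformity from this coset to
  \<open>V k\<close>.\<close>

lemma uniform_cocycle:
  obtains N where "\<And>w v x. w \<in> V N \<Longrightarrow> v \<in> V N \<Longrightarrow> x \<in> carrier B \<Longrightarrow>
    cocycle w (x \<otimes>\<^bsub>B\<^esub> v) = cocycle w x"
proof -
  define E where "E n = {z \<in> carrier B. \<forall>x\<in>carrier B. \<forall>v\<in>V n. cocycle z (x \<otimes>\<^bsub>B\<^esub> v) = cocycle z x}" for n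
  have "carrier B = (\<Union>n. E n)"
    using cocycle_locally_constant by (auto simp: E_def)
  moreover have "closedin T (E n)" for n
  proof -
    have cont: "continuous_map T S (\<lambda>z. cocycle z x)" if x: "x \<in> carrier B" for x
    proof -
      have "continuous_map T S (f \<circ> (\<lambda>z. z \<otimes>\<^bsub>B\<^esub> x))"
        using X.continuous_right_mult[OF x] homeomorphic_imp_continuous_map[OF homeo]
        by (rule continuous_map_compose)
      then have "continuous_map T S ((\<lambda>y. y \<otimes>\<^bsub>C\<^esub> inv\<^bsub>C\<^esub> f x) \<circ> (f \<circ> (\<lambda>z. z \<otimes>\<^bsub>B\<^esub> x)))"
        using Y.continuous_right_mult[OF Y.inv_closed[OF f_carrier[OF x]]]
        by (rule continuous_map_compose)
      then show ?thesis by (simp add: cocycle_def comp_def)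
    qed
    have "closedin T {z \<in> topspace T. cocycle z (x \<otimes>\<^bsub>B\<^esub> v) = cocycle z x}"
      if "x \<in> carrier B" "v \<in> V n" for x v
      using that by (intro closedin_continuous_maps_eq[OF Y.Hausdorff_T] cont) auto
    moreover have "carrier B \<noteq> {}" "V n \<noteq> {}"
      using X.one_closed X.V_one by blast+
    ultimately have "closedin T (\<Inter>x\<in>carrier B. \<Inter>v\<in>V n.
        {z \<in> topspace T. cocycle z (x \<otimes>\<^bsub>B\<^esub> v) = cocycle z x})"
      by (intro closedin_INT)
    moreover have "E n = (\<Inter>x\<in>carrier B. \<Inter>v\<in>V n.
        {z \<in> topspace T. cocycle z (x \<otimes>\<^bsub>B\<^esub> v) = cocycle z x})"
      using \<open>carrier B \<noteq> {}\<close> \<open>V n \<noteq> {}\<close> by (auto simp: E_def)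
    ultimately show ?thesis by simp
  qed
  ultimately obtain n k z where z: "z \<in> carrier B" "\<And>v. v \<in> V k \<Longrightarrow> z \<otimes>\<^bsub>B\<^esub> v \<in> E n"
    by (rule X.ex_translate_in) blast
  show thesis
  \<comment> \<open>The bound \<open>k\<close> keeps \<open>z w\<close> in \<open>E n\<close>; the
    bound \<open>n\<close> makes the cocycles of \<open>z\<close> and of \<open>z w\<close>
    invariant under \<open>v\<close>.\<close>
  proof (rule that[of "max k n"])
    fix w v x assume w: "w \<in> V (max k n)" and v: "v \<in> V (max k n)" and x: "x \<in> carrier B"
    have wv: "w \<in> V k" "v \<in> V n"
      using w v X.V_mono max.cobounded1 max.cobounded2 by blast+
    have E: "cocycle y (x' \<otimes>\<^bsub>B\<^esub> v) = cocycle y x'" if "y \<in> E n" "x' \<in> carrier B" for y x'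
      using that wv by (simp add: E_def)
    have zE: "z \<in> E n" using z(2)[OF X.V_one] z(1) by simp
    \<comment> \<open>The cocycle identity solved for the factor of \<open>w\<close>; the other two
      cocycles belong to \<open>z\<close> and \<open>z w\<close>, both in
      \<open>E n\<close>.\<close>
    have "cocycle w x' = inv\<^bsub>C\<^esub> cocycle z (w \<otimes>\<^bsub>B\<^esub> x') \<otimes>\<^bsub>C\<^esub> cocycle (z \<otimes>\<^bsub>B\<^esub> w) x'"
      if "x' \<in> carrier B" for x'
      using that z(1) wv by (simp add: cocycle_mult)
    then show "cocycle w (x \<otimes>\<^bsub>B\<^esub> v) = cocycle w x"
      using E[OF zE, of "w \<otimes>\<^bsub>B\<^esub> x"] E[OF z(2)[OF wv(1)] x] x wv by (simp add: X.m_assoc)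
  qed
qed

lemma ex_isomorphic_subgroups:
  "\<exists>U1 U2. clopen_subgroup U1 B T \<and> clopen_subgroup U2 C S \<and>
     topological_group_isomorphic
       (B\<lparr>carrier := U1\<rparr>) (subtopology T U1) (C\<lparr>carrier := U2\<rparr>) (subtopology S U2) \<and>
     finite (rcosets\<^bsub>B\<^esub> U1) \<and> finite (rcosets\<^bsub>C\<^esub> U2) \<and>
     card (rcosets\<^bsub>B\<^esub> U1) = card (rcosets\<^bsub>C\<^esub> U2)"
proof -
  obtain N where N: "\<And>w v x. w \<in> V N \<Longrightarrow> v \<in> V N \<Longrightarrow> x \<in> carrier B \<Longrightarrow>
    cocycle w (x \<otimes>\<^bsub>B\<^esub> v) = cocycle w x"
    by (rule uniform_cocycle) blast
  define a where "a = f \<one>\<^bsub>B\<^esub>"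
  have a: "a \<in> carrier C" by (simp add: a_def)
  \<comment> \<open>Normalized to send the identity to the identity; a right translation of the
    values leaves the cocycle unchanged.\<close>
  define \<pi> where "\<pi> x = f x \<otimes>\<^bsub>C\<^esub> inv\<^bsub>C\<^esub> a" for x
  define U2 where "U2 = \<pi> ` V N"
  have \<pi>a: "\<pi> x \<otimes>\<^bsub>C\<^esub> a = f x" "\<pi> x \<in> carrier C" if "x \<in> carrier B" for x
    using that a by (auto simp: \<pi>_def Y.m_assoc)
  have \<pi>_mult: "\<pi> (v \<otimes>\<^bsub>B\<^esub> w) = \<pi> v \<otimes>\<^bsub>C\<^esub> \<pi> w" if "v \<in> V N" "w \<in> V N" for v w
  proof -
    have "f (v \<otimes>\<^bsub>B\<^esub> w) = cocycle v w \<otimes>\<^bsub>C\<^esub> f w"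
      using that by (simp add: cocycle_f)
    \<comment> \<open>The cocycle of \<open>v\<close> is constant along \<open>V N\<close>, so it
      may be evaluated at the identity, where it is \<open>f v a^-1\<close>.\<close>
    also have "cocycle v w = \<pi> v"
      using N[OF that X.one_closed] that by (simp add: \<pi>_def a_def cocycle_def)
    finally show ?thesis
      using that a by (simp add: \<pi>_def Y.m_assoc)
  qed
  have homeo_\<pi>: "homeomorphic_map T S \<pi>"
    using homeomorphic_map_compose[OF homeo Y.homeomorphic_right_mult[of "inv\<^bsub>C\<^esub> a"]] a
    by (simp add: comp_def flip: \<pi>_def)
  have clopen_V: "clopenin T (V N)"
    unfolding X.clopenin_iff by (auto intro!: exI[of _ N])
  have sub_V: "V N \<subseteq> topspace T" by auto
  have clopen_U2: "openin S U2" "closedin S U2"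
    using clopen_V homeomorphic_map_openness[OF homeo_\<pi> sub_V] homeomorphic_map_closedness[OF homeo_\<pi> sub_V]
    by (auto simp: U2_def)
  have hom: "\<pi> \<in> hom (B\<lparr>carrier := V N\<rparr>) C"
    by (rule homI) (auto simp: \<pi>_mult \<pi>a(2))
  have subgroup_U2: "subgroup U2 C"
    using group_hom.img_is_subgroup[of "B\<lparr>carrier := V N\<rparr>" C \<pi>] hom X.subgroup_imp_group[OF X.subgroup_V]
    by (simp add: group_hom_def group_hom_axioms_def U2_def Y.is_group)
  have inj: "inj_on \<pi> (V N)"
    by (rule inj_onI) (metis \<pi>a(1) f_inject X.V_carrier)
  have "topological_group_isomorphic
      (B\<lparr>carrier := V N\<rparr>) (subtopology T (V N)) (C\<lparr>carrier := U2\<rparr>) (subtopology S U2)"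
    unfolding topological_group_isomorphic_def
  proof
    show "\<pi> \<in> Group.iso (B\<lparr>carrier := V N\<rparr>) (C\<lparr>carrier := U2\<rparr>)"
      using inj by (auto simp: iso_def hom_def bij_betw_def U2_def \<pi>_mult)
    show "homeomorphic_map (subtopology T (V N)) (subtopology S U2) \<pi>"
      using sub_V \<pi>a(2) by (intro homeomorphic_map_subtopologies[OF homeo_\<pi>]) (auto simp: U2_def)
  qed
  moreover have "finite (rcosets\<^bsub>C\<^esub> U2) \<and> card (rcosets\<^bsub>B\<^esub> (V N)) = card (rcosets\<^bsub>C\<^esub> U2)"
  proof -
    have fin: "finite (rcosets\<^bsub>B\<^esub> (V N))" by (rule X.finite_rcosets_V)
    have U2c: "u \<in> carrier C" if "u \<in> U2" for u
      using subgroup.mem_carrier[OF subgroup_U2 that] .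
    have U2m: "u \<otimes>\<^bsub>C\<^esub> v \<in> U2" if "u \<in> U2" "v \<in> U2" for u v
      using subgroup.m_closed[OF subgroup_U2] that .
    \<comment> \<open>By normality every coset of \<open>V N\<close> is a left translate
      \<open>z V N\<close>, and under \<open>f\<close> the left translation by \<open>z\<close>
      becomes an element \<open>g\<close> of the full group of \<open>C\<close>.\<close>
    have "\<exists>g n z. z \<in> carrier B \<and> D = z <#\<^bsub>B\<^esub> V N \<and> bij_betw g (carrier C) (carrier C) \<and> Y.commutes_at n g \<and>
        (\<forall>x\<in>carrier B. f (z \<otimes>\<^bsub>B\<^esub> x) = g (f x))" if D: "D \<in> rcosets\<^bsub>B\<^esub> (V N)" for D
    proof -
      obtain z where z: "z \<in> carrier B" "D = V N #>\<^bsub>B\<^esub> z"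
        using D by (auto simp: RCOSETS_def)
      then have "D = z <#\<^bsub>B\<^esub> V N"
        using normal.coset_eq[OF X.normal_V] by blast
      then show ?thesis
        using translation_conj[OF z(1)] z(1) by metis
    qed
    then obtain g n z where gnz: "\<And>D. D \<in> rcosets\<^bsub>B\<^esub> (V N) \<Longrightarrow> z D \<in> carrier B \<and> D = z D <#\<^bsub>B\<^esub> V N \<and>
        bij_betw (g D) (carrier C) (carrier C) \<and> Y.commutes_at (n D) (g D) \<and>
        (\<forall>x\<in>carrier B. f (z D \<otimes>\<^bsub>B\<^esub> x) = g D (f x))"
      by metis
    obtain k where k: "\<And>w. w \<in> W k \<Longrightarrow> w \<in> U2"
      using clopen_U2(1) subgroup.one_closed[OF subgroup_U2] unfolding Y.openin_T
      by (metis Y.V_carrier Y.l_one)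
    \<comment> \<open>A level that serves all finitely many \<open>g D\<close> at once and, through
      \<open>k\<close>, has \<open>W M\<close> contained in \<open>U2\<close>.\<close>
    define M where "M = Max (insert k (n ` (rcosets\<^bsub>B\<^esub> (V N))))"
    have "n D \<le> M" if "D \<in> rcosets\<^bsub>B\<^esub> (V N)" for D
      using fin that by (simp add: M_def)
    then have comm: "Y.commutes_at M (g D)" if "D \<in> rcosets\<^bsub>B\<^esub> (V N)" for D
      using gnz[OF that] Y.commutes_at_mono that by blast
    have "k \<le> M" using fin by (simp add: M_def)
    then have M: "w \<in> U2" if "w \<in> W M" for w
      using k Y.V_mono that by blast
    let ?q = "\<lambda>y. Y.cell y M"
    \<comment> \<open>The size of \<open>U2\<close> in cells of level \<open>M\<close>;
      \<open>translate\<close> shows that all its right translates have the same size.\<close>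
    define j where "j = card (?q ` U2)"
    have translate: "card (?q ` (\<lambda>u. u \<otimes>\<^bsub>C\<^esub> e) ` U2) = j" if e: "e \<in> carrier C" for e
      unfolding j_def image_image
      using e U2c by (intro card_image_eq_if_same_kernel) (simp add: Y.cell_right_mult)
    \<comment> \<open>\<open>u e w = u (e w e^-1) e\<close> with \<open>e w e^-1\<close> in
      \<open>W M\<close>, so right cosets of \<open>U2\<close> are unions of cells of level
      \<open>M\<close>.\<close>
    have absorb: "u \<otimes>\<^bsub>C\<^esub> e \<otimes>\<^bsub>C\<^esub> w \<in> (\<lambda>u. u \<otimes>\<^bsub>C\<^esub> e) ` U2" if "u \<in> U2" "w \<in> W M" "e \<in> carrier C" for u w e
    proof -
      have "u \<otimes>\<^bsub>C\<^esub> e \<otimes>\<^bsub>C\<^esub> w = u \<otimes>\<^bsub>C\<^esub> (e \<otimes>\<^bsub>C\<^esub> w \<otimes>\<^bsub>C\<^esub> inv\<^bsub>C\<^esub> e) \<otimes>\<^bsub>C\<^esub> e"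
        using that U2c by (simp add: Y.m_assoc)
      moreover have "e \<otimes>\<^bsub>C\<^esub> w \<otimes>\<^bsub>C\<^esub> inv\<^bsub>C\<^esub> e \<in> U2"
        using M Y.V_conj that by blast
      ultimately show ?thesis using U2m that by blast
    qed
    have "j > 0"
    proof -
      have "?q ` U2 \<subseteq> ?q ` carrier C" using U2c by blast
      then have "finite (?q ` U2)" using Y.finite_cells finite_subset by blast
      then show ?thesis
        using subgroup.one_closed[OF subgroup_U2] by (auto simp: j_def card_gt_0_iff)
    qed
    have fV: "f ` V N = (\<lambda>u. u \<otimes>\<^bsub>C\<^esub> a) ` U2"
      using \<pi>a(1) by (auto simp: U2_def image_image)
    have f_image: "f ` D = g D ` (\<lambda>u. u \<otimes>\<^bsub>C\<^esub> a) ` U2" if D: "D \<in> rcosets\<^bsub>B\<^esub> (V N)" for D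
    proof -
      have "D = (\<lambda>v. z D \<otimes>\<^bsub>B\<^esub> v) ` V N"
        using gnz[OF D] by (auto simp: l_coset_def)
      then have "f ` D = (\<lambda>v. f (z D \<otimes>\<^bsub>B\<^esub> v)) ` V N"
        by (metis image_image)
      also have "\<dots> = g D ` f ` V N"
        using gnz[OF D] by (auto simp: image_image)
      finally show ?thesis by (simp add: fV)
    qed
    have part: "partition_on (carrier C) ((\<lambda>D. f ` D) ` (rcosets\<^bsub>B\<^esub> (V N)))"
    proof (rule partition_onI)
      have "f ` carrier B = carrier C"
        using homeomorphic_imp_surjective_map[OF homeo] by simp
      then show "\<Union>((\<lambda>D. f ` D) ` (rcosets\<^bsub>B\<^esub> (V N))) = carrier C"
        using X.rcosets_part_G[OF X.subgroup_V] by (metis image_Union)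
      show "{} \<notin> (\<lambda>D. f ` D) ` (rcosets\<^bsub>B\<^esub> (V N))"
        using subgroup.rcosets_non_empty[OF X.subgroup_V] by blast
      fix p q assume "p \<in> (\<lambda>D. f ` D) ` (rcosets\<^bsub>B\<^esub> (V N))" "q \<in> (\<lambda>D. f ` D) ` (rcosets\<^bsub>B\<^esub> (V N))" "p \<noteq> q"
      then obtain D D' where D: "D \<in> rcosets\<^bsub>B\<^esub> (V N)" "D' \<in> rcosets\<^bsub>B\<^esub> (V N)" "p = f ` D" "q = f ` D'" "D \<noteq> D'"
        by blast
      then have "D \<inter> D' = {}"
        using X.rcos_disjoint[OF X.subgroup_V[of N]] by (metis pairwiseD disjnt_def)
      moreover have "D \<subseteq> carrier B" "D' \<subseteq> carrier B"
        using D(1,2) X.rcosets_part_G[OF X.subgroup_V[of N]] by blast+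
      ultimately show "disjnt p q"
        unfolding D(3,4) disjnt_iff using f_inject by blast
    qed
    have inj_f: "inj_on (\<lambda>D. f ` D) (rcosets\<^bsub>B\<^esub> (V N))"
    proof (rule inj_onI)
      fix D D' assume D: "D \<in> rcosets\<^bsub>B\<^esub> (V N)" "D' \<in> rcosets\<^bsub>B\<^esub> (V N)" "f ` D = f ` D'"
      then have "D \<subseteq> carrier B" "D' \<subseteq> carrier B"
        using X.rcosets_part_G[OF X.subgroup_V] by auto
      then show "D = D'"
        using D(3) inj_on_image_eq_iff[OF homeomorphic_imp_injective_map[OF homeo]] by simp
    qed
    \<comment> \<open>First count: the sets \<open>f D\<close> partition the carrier of
      \<open>C\<close>, and each is the image of \<open>U2 a\<close> under \<open>g D\<close>, so it
      occupies \<open>j\<close> cells.\<close>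
    have "j * card ((\<lambda>D. f ` D) ` (rcosets\<^bsub>B\<^esub> (V N))) = card (?q ` carrier C)"
    proof (rule card_saturated_partition(2)[OF part Y.finite_cells])
      fix Z assume "Z \<in> (\<lambda>D. f ` D) ` (rcosets\<^bsub>B\<^esub> (V N))"
      then obtain D where D: "D \<in> rcosets\<^bsub>B\<^esub> (V N)" "Z = f ` D" by blast
      have gD: "bij_betw (g D) (carrier C) (carrier C)" using gnz[OF D(1)] by blast
      have "card (?q ` Z) = card (?q ` (\<lambda>u. u \<otimes>\<^bsub>C\<^esub> a) ` U2)"
        unfolding D(2) f_image[OF D(1)] image_image
        using Y.cell_commutes_at[OF gD comm[OF D(1)]] U2c a
        by (intro card_image_eq_if_same_kernel) simp
      then show "card (?q ` Z) = j" using translate[OF a] by simp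
      fix y y' assume y: "y \<in> Z" "y' \<in> carrier C" "?q y = ?q y'"
      then obtain u where u: "u \<in> U2" "y = g D (u \<otimes>\<^bsub>C\<^esub> a)"
        using f_image[OF D(1)] D(2) by blast
      have yc: "y \<in> carrier C" using u U2c a gD bij_betwE by (metis Y.m_closed)
      obtain w where w: "w \<in> W M" "y' = y \<otimes>\<^bsub>C\<^esub> w"
        by (rule Y.cell_eqE[OF y(3) yc y(2)])
      have "y' = g D (u \<otimes>\<^bsub>C\<^esub> a \<otimes>\<^bsub>C\<^esub> w)"
        using w u comm[OF D(1)] U2c a by (simp add: Y.commutes_at_def)
      then show "y' \<in> Z"
        using absorb[OF u(1) w(1) a] D f_image[OF D(1)] by blast
    qed
    then have 1: "j * card (rcosets\<^bsub>B\<^esub> (V N)) = card (?q ` carrier C)"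
      by (simp add: card_image[OF inj_f])
    have part2: "partition_on (carrier C) (rcosets\<^bsub>C\<^esub> U2)"
    proof (rule partition_onI)
      show "\<Union> (rcosets\<^bsub>C\<^esub> U2) = carrier C"
        using Y.rcosets_part_G[OF subgroup_U2] .
      show "\<And>p q. p \<in> rcosets\<^bsub>C\<^esub> U2 \<Longrightarrow> q \<in> rcosets\<^bsub>C\<^esub> U2 \<Longrightarrow> p \<noteq> q \<Longrightarrow> disjnt p q"
        using Y.rcos_disjoint[OF subgroup_U2] by (auto simp: pairwise_def)
      show "{} \<notin> rcosets\<^bsub>C\<^esub> U2"
        using subgroup.rcosets_non_empty[OF subgroup_U2] by blast
    qed
    have right: "\<exists>e\<in>carrier C. Z = (\<lambda>u. u \<otimes>\<^bsub>C\<^esub> e) ` U2" if "Z \<in> rcosets\<^bsub>C\<^esub> U2" for Z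
      using that by (auto simp: RCOSETS_def r_coset_def)
    have sat2: "y' \<in> Z" if Z: "Z \<in> rcosets\<^bsub>C\<^esub> U2" and y: "y \<in> Z" "y' \<in> carrier C" "?q y = ?q y'" for Z y y'
    proof -
      obtain e where e: "e \<in> carrier C" "Z = (\<lambda>u. u \<otimes>\<^bsub>C\<^esub> e) ` U2" using right[OF Z] by blast
      then obtain u where u: "u \<in> U2" "y = u \<otimes>\<^bsub>C\<^esub> e" using y by blast
      have yc: "y \<in> carrier C" using u U2c e by simp
      obtain w where w: "w \<in> W M" "y' = y \<otimes>\<^bsub>C\<^esub> w"
        by (rule Y.cell_eqE[OF y(3) yc y(2)])
      then show ?thesis using absorb[OF u(1) w(1) e(1)] u e by simp
    qed
    have card2: "card (?q ` Z) = j" if "Z \<in> rcosets\<^bsub>C\<^esub> U2" for Z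
      using right[OF that] translate by blast
    \<comment> \<open>Second count: the right cosets of \<open>U2\<close> also partition the carrier
      into pieces of \<open>j\<close> cells, and cancelling the positive \<open>j\<close> equates
      the indices.\<close>
    have "finite (rcosets\<^bsub>C\<^esub> U2)" "j * card (rcosets\<^bsub>C\<^esub> U2) = card (?q ` carrier C)"
      using card_saturated_partition[OF part2 Y.finite_cells sat2 card2] by auto
    then show ?thesis using 1 \<open>j > 0\<close> by (metis mult_cancel1 less_irrefl)
  qed
  ultimately show ?thesis
    using X.finite_rcosets_V X.subgroup_V clopen_V subgroup_U2 clopen_U2
    by (intro exI[of _ "V N"] exI[of _ U2]) (simp add: clopen_subgroup_def)
qed

end

context profinite_chain_pair
begin

lemma ex_isomorphic_subgroups_if_full_groups_iso:
  assumes inf: "infinite (carrier B)" "infinite (carrier C)" and iso: "X.full_group \<cong> Y.full_group"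
  shows "\<exists>U1 U2. clopen_subgroup U1 B T \<and> clopen_subgroup U2 C S \<and>
     topological_group_isomorphic
       (B\<lparr>carrier := U1\<rparr>) (subtopology T U1) (C\<lparr>carrier := U2\<rparr>) (subtopology S U2) \<and>
     finite (rcosets\<^bsub>B\<^esub> U1) \<and> finite (rcosets\<^bsub>C\<^esub> U2) \<and>
     card (rcosets\<^bsub>B\<^esub> U1) = card (rcosets\<^bsub>C\<^esub> U2)"
proof -
  obtain h where h: "h \<in> Group.iso X.full_group Y.full_group"
    using iso by (auto simp: is_iso_def)
  have "rich_action_iso X.full_group T (\<lambda>g. g) Y.full_group S (\<lambda>g. g) h"
    using X.rich_action_full_group[OF inf(1)] Y.rich_action_full_group[OF inf(2)] h
    by (simp add: rich_action_iso_def rich_action_iso_axioms_def)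
  then obtain f where f: "homeomorphic_map T S f"
    "\<And>g x. g \<in> carrier X.full_group \<Longrightarrow> x \<in> topspace T \<Longrightarrow> f (g x) = h g (f x)"
    by (rule rich_action_iso.spatial_realization) blast
  have "h g \<in> Y.full_group_set" if "g \<in> X.full_group_set" for g
    using h that by (auto simp: iso_def hom_def Pi_iff)
  then have "profinite_conjugacy B V T C W S f"
    using f profinite_chain_pair_axioms
    unfolding profinite_conjugacy_def profinite_conjugacy_axioms_def by auto
  then show ?thesis
    by (rule profinite_conjugacy.ex_isomorphic_subgroups)
qed

end

section \<open>Odometers\<close>

locale scaled_group = group G for G :: "('a, 'm) monoid_scheme" (structure) +
  fixes \<Gamma> :: "nat \<Rightarrow> 'a set"
  assumes scale: "group_scale G \<Gamma>"
begin

lemma normal_scale: "\<Gamma> n \<lhd> G"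
  using scale by (simp add: group_scale_def)

lemma scale_Suc: "\<Gamma> (Suc n) \<subseteq> \<Gamma> n"
  using scale by (simp add: group_scale_def decseq_Suc_iff)

lemma group_quotient: "group (G Mod \<Gamma> n)"
  using normal.factorgroup_is_group[OF normal_scale] .

lemma finite_quotient: "finite (carrier (G Mod \<Gamma> n))"
  using scale by (simp add: group_scale_def FactGroup_def)

lemma quotient_proj_hom: "group_hom (G Mod \<Gamma> (Suc n)) (G Mod \<Gamma> n) (quotient_proj G (\<Gamma> n))"
proof -
  have proj: "quotient_proj G (\<Gamma> n) (\<Gamma> (Suc n) #> g) = \<Gamma> n #> g" if "g \<in> carrier G" for g
    by (rule quotient_proj_rcoset[OF normal_scale normal_scale scale_Suc that])
  have "quotient_proj G (\<Gamma> n) \<in> hom (G Mod \<Gamma> (Suc n)) (G Mod \<Gamma> n)"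
  proof (rule homI)
    fix c assume "c \<in> carrier (G Mod \<Gamma> (Suc n))"
    then show "quotient_proj G (\<Gamma> n) c \<in> carrier (G Mod \<Gamma> n)"
      using proj by (auto simp: carrier_FactGroup)
    fix d assume "d \<in> carrier (G Mod \<Gamma> (Suc n))"
    with \<open>c \<in> carrier (G Mod \<Gamma> (Suc n))\<close> obtain g h where
      "g \<in> carrier G" "h \<in> carrier G" "c = \<Gamma> (Suc n) #> g" "d = \<Gamma> (Suc n) #> h"
      by (auto simp: carrier_FactGroup)
    then show "quotient_proj G (\<Gamma> n) (c \<otimes>\<^bsub>G Mod \<Gamma> (Suc n)\<^esub> d) =
        quotient_proj G (\<Gamma> n) c \<otimes>\<^bsub>G Mod \<Gamma> n\<^esub> quotient_proj G (\<Gamma> n) d"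
      by (simp add: proj normal.rcos_sum[OF normal_scale])
  qed
  then show ?thesis
    by (simp add: group_hom_def group_hom_axioms_def group_quotient)
qed

section \<open>The inverse limit as a group and as a space\<close>

abbreviation "P \<equiv> product_group UNIV (\<lambda>n. G Mod \<Gamma> n)"

lemma odometer_space_iff:
  "x \<in> odometer_space G \<Gamma> \<longleftrightarrow>
    (\<forall>n. x n \<in> carrier (G Mod \<Gamma> n)) \<and> (\<forall>n. quotient_proj G (\<Gamma> n) (x (Suc n)) = x n)"
  by (auto simp: odometer_space_def PiE_iff)

lemma group_P: "group P"
  using group_quotient by simp

lemma subgroup_odometer_space: "subgroup (odometer_space G \<Gamma>) P"
proof (rule group.subgroupI[OF group_P])
  show "odometer_space G \<Gamma> \<subseteq> carrier P"
    by (auto simp: odometer_space_def)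
  have "\<one>\<^bsub>P\<^esub> \<in> odometer_space G \<Gamma>"
    using monoid.one_closed[OF group.is_monoid[OF group_quotient]] group_hom.hom_one[OF quotient_proj_hom]
    by (simp add: odometer_space_iff)
  then show "odometer_space G \<Gamma> \<noteq> {}" by blast
  fix x assume x: "x \<in> odometer_space G \<Gamma>"
  then have "inv\<^bsub>P\<^esub> x = (\<lambda>n. inv\<^bsub>G Mod \<Gamma> n\<^esub> x n)"
    by (simp add: odometer_space_def group_quotient restrict_UNIV)
  then show "inv\<^bsub>P\<^esub> x \<in> odometer_space G \<Gamma>"
    using x group.inv_closed[OF group_quotient] group_hom.hom_inv[OF quotient_proj_hom]
    by (simp add: odometer_space_iff)
  fix y assume y: "y \<in> odometer_space G \<Gamma>"
  show "x \<otimes>\<^bsub>P\<^esub> y \<in> odometer_space G \<Gamma>"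
    using x y monoid.m_closed[OF group.is_monoid[OF group_quotient]] group_hom.hom_mult[OF quotient_proj_hom]
    by (simp add: odometer_space_iff)
qed

lemma carrier_odometer [simp]: "carrier (odometer G \<Gamma>) = odometer_space G \<Gamma>"
  by (simp add: odometer_def)

lemma group_odometer: "group (odometer G \<Gamma>)"
  unfolding odometer_def by (rule group.subgroup_imp_group[OF group_P subgroup_odometer_space])

lemma coordinate_hom: "group_hom (odometer G \<Gamma>) (G Mod \<Gamma> n) (\<lambda>x. x n)"
proof -
  have "(\<lambda>x. x n) \<in> hom (odometer G \<Gamma>) (G Mod \<Gamma> n)"
    by (rule homI) (auto simp: odometer_space_iff odometer_def)
  then show ?thesis
    by (simp add: group_hom_def group_hom_axioms_def group_quotient group_odometer)
qed

text \<open>The chain that instantiates \<open>V\<close> of \<open>profinite_chain\<close> for the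
  odometer.\<close>

definition level_kernel :: "nat \<Rightarrow> (nat \<Rightarrow> 'a set) set" where
  "level_kernel n = kernel (odometer G \<Gamma>) (G Mod \<Gamma> n) (\<lambda>x. x n)"

lemma level_kernel_iff: "x \<in> level_kernel n \<longleftrightarrow> x \<in> odometer_space G \<Gamma> \<and> x n = \<Gamma> n"
  by (simp add: level_kernel_def kernel_def)

text \<open>Since the coordinate is a homomorphism, the coset of \<open>x\<close> modulo
  \<open>level_kernel n\<close> consists of the points with the same coordinate at \<open>n\<close>.
  This links \<open>openin_T\<close> to the product topology.\<close>

lemma level_kernel_translate_iff:
  assumes x: "x \<in> odometer_space G \<Gamma>" and S: "S \<subseteq> odometer_space G \<Gamma>"
  shows "(\<forall>v\<in>level_kernel n. x \<otimes>\<^bsub>odometer G \<Gamma>\<^esub> v \<in> S) \<longleftrightarrow>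
    (\<forall>y\<in>odometer_space G \<Gamma>. y n = x n \<longrightarrow> y \<in> S)"
proof -
  interpret O: group "odometer G \<Gamma>" by (rule group_odometer)
  interpret h: group_hom "odometer G \<Gamma>" "G Mod \<Gamma> n" "\<lambda>x. x n" by (rule coordinate_hom)
  show ?thesis
  proof (intro iffI ballI impI)
    fix y assume L: "\<forall>v\<in>level_kernel n. x \<otimes>\<^bsub>odometer G \<Gamma>\<^esub> v \<in> S"
      and y: "y \<in> odometer_space G \<Gamma>" "y n = x n"
    let ?v = "inv\<^bsub>odometer G \<Gamma>\<^esub> x \<otimes>\<^bsub>odometer G \<Gamma>\<^esub> y"
    have "?v n = inv\<^bsub>G Mod \<Gamma> n\<^esub> x n \<otimes>\<^bsub>G Mod \<Gamma> n\<^esub> y n"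
      using h.hom_mult[of "inv\<^bsub>odometer G \<Gamma>\<^esub> x" y] h.hom_inv[of x] O.inv_closed[of x] x y(1)
      unfolding carrier_odometer by metis
    also have "\<dots> = \<one>\<^bsub>G Mod \<Gamma> n\<^esub>"
      using h.H.l_inv[of "x n"] h.hom_closed[of x] x unfolding carrier_odometer y(2) by blast
    finally have "?v n = \<Gamma> n"
      by simp
    then have "?v \<in> level_kernel n"
      using O.m_closed[of "inv\<^bsub>odometer G \<Gamma>\<^esub> x" y] O.inv_closed[of x] x y by (simp add: level_kernel_iff)
    then have "x \<otimes>\<^bsub>odometer G \<Gamma>\<^esub> ?v \<in> S" using L by blast
    then show "y \<in> S"
      using x y O.m_assoc[of x "inv\<^bsub>odometer G \<Gamma>\<^esub> x" y, symmetric] O.inv_closed[of x] by simp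
  next
    fix v assume R: "\<forall>y\<in>odometer_space G \<Gamma>. y n = x n \<longrightarrow> y \<in> S" and v: "v \<in> level_kernel n"
    have "(x \<otimes>\<^bsub>odometer G \<Gamma>\<^esub> v) n = x n \<otimes>\<^bsub>G Mod \<Gamma> n\<^esub> \<one>\<^bsub>G Mod \<Gamma> n\<^esub>"
      using h.hom_mult[of x v] x v by (simp add: level_kernel_iff)
    also have "\<dots> = x n"
      using h.H.r_one[of "x n"] h.hom_closed[of x] x by simp
    finally show "x \<otimes>\<^bsub>odometer G \<Gamma>\<^esub> v \<in> S"
      using R O.m_closed[of x v] x v by (simp add: level_kernel_iff)
  qed
qed

lemma coordinates_agree_below:
  assumes "x \<in> odometer_space G \<Gamma>" "y \<in> odometer_space G \<Gamma>" "x n = y n" "i \<le> n"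
  shows "x i = y i"
  using assms(4,3)
  by (induction rule: dec_induct) (use assms(1,2) odometer_space_iff in metis)+

text \<open>A basic open set of the product constrains finitely many coordinates, and compatibility
  makes all of them functions of any later one; so fixing a single coordinate suffices.\<close>

lemma openin_odometer_topology:
  "openin (odometer_topology G \<Gamma>) S \<longleftrightarrow> S \<subseteq> odometer_space G \<Gamma> \<and>
    (\<forall>x\<in>S. \<exists>n. \<forall>y\<in>odometer_space G \<Gamma>. y n = x n \<longrightarrow> y \<in> S)"
proof
  assume "openin (odometer_topology G \<Gamma>) S"
  then obtain U where U: "openin (product_topology (\<lambda>n. discrete_topology (carrier (G Mod \<Gamma> n))) UNIV) U"
    "S = U \<inter> odometer_space G \<Gamma>"
    by (auto simp: odometer_topology_def openin_subtopology)
  have "\<exists>n. \<forall>y\<in>odometer_space G \<Gamma>. y n = x n \<longrightarrow> y \<in> S" if x: "x \<in> S" for x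
  proof -
    obtain W where W: "finite {i. W i \<noteq> carrier (G Mod \<Gamma> i)}" "x \<in> Pi\<^sub>E UNIV W" "Pi\<^sub>E UNIV W \<subseteq> U"
      using U(1)[unfolded openin_product_topology_alt, rule_format, of x] x U(2) by auto
    obtain n where n: "\<And>i. W i \<noteq> carrier (G Mod \<Gamma> i) \<Longrightarrow> i \<le> n"
      using Max_ge[OF W(1)] by blast
    have "y \<in> S" if y: "y \<in> odometer_space G \<Gamma>" "y n = x n" for y
    proof -
      have "y i \<in> W i" for i
      proof (cases "W i = carrier (G Mod \<Gamma> i)")
        case True
        then show ?thesis using y odometer_space_iff by blast
      next
        case False
        then have "y i = x i"
          using n y x U(2) coordinates_agree_below by blast
        then show ?thesis using W(2) by (simp add: PiE_iff)
      qed
      then show ?thesis using W(3) U(2) y(1) by (auto simp: PiE_iff)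
    qed
    then show ?thesis by blast
  qed
  then show "S \<subseteq> odometer_space G \<Gamma> \<and>
    (\<forall>x\<in>S. \<exists>n. \<forall>y\<in>odometer_space G \<Gamma>. y n = x n \<longrightarrow> y \<in> S)"
    using U(2) by blast
next
  let ?D = "\<lambda>n. discrete_topology (carrier (G Mod \<Gamma> n))"
  assume R: "S \<subseteq> odometer_space G \<Gamma> \<and>
    (\<forall>x\<in>S. \<exists>n. \<forall>y\<in>odometer_space G \<Gamma>. y n = x n \<longrightarrow> y \<in> S)"
  show "openin (odometer_topology G \<Gamma>) S"
  proof (subst openin_subopen, intro ballI)
    fix x assume x: "x \<in> S"
    then obtain n where n: "\<And>y. y \<in> odometer_space G \<Gamma> \<Longrightarrow> y n = x n \<Longrightarrow> y \<in> S"
      using R by blast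
    have xn: "x n \<in> carrier (G Mod \<Gamma> n)" using x R odometer_space_iff by blast
    have "openin (product_topology ?D UNIV) {y \<in> topspace (product_topology ?D UNIV). y n \<in> {x n}}"
      using continuous_map_product_projection[of n UNIV ?D] xn
      by (intro openin_continuous_map_preimage[of _ "?D n"]) auto
    then have "openin (odometer_topology G \<Gamma>)
        ({y \<in> topspace (product_topology ?D UNIV). y n \<in> {x n}} \<inter> odometer_space G \<Gamma>)"
      unfolding odometer_topology_def openin_subtopology by blast
    moreover have "x \<in> topspace (product_topology ?D UNIV)"
      using x R by (auto simp: odometer_space_def)
    ultimately show "\<exists>U. openin (odometer_topology G \<Gamma>) U \<and> x \<in> U \<and> U \<subseteq> S"
      using n x R by (intro exI[of _ "{y \<in> topspace (product_topology ?D UNIV). y n \<in> {x n}} \<inter> odometer_space G \<Gamma>"]) auto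
  qed
qed

text \<open>Tychonoff for the finite quotients; the compatibility conditions are equalizers of
  continuous maps into Hausdorff spaces and so cut out a closed set.\<close>

lemma compact_odometer_topology: "compact_space (odometer_topology G \<Gamma>)"
proof -
  let ?D = "\<lambda>n. discrete_topology (carrier (G Mod \<Gamma> n))"
  let ?X = "product_topology ?D UNIV"
  have "closedin ?X {x \<in> topspace ?X. quotient_proj G (\<Gamma> n) (x (Suc n)) = x n}" for n
  proof (rule closedin_continuous_maps_eq[of "?D n"])
    have "continuous_map (?D (Suc n)) (?D n) (quotient_proj G (\<Gamma> n))"
      using group_hom.hom_closed[OF quotient_proj_hom] by auto
    then have "continuous_map ?X (?D n) (quotient_proj G (\<Gamma> n) \<circ> (\<lambda>x. x (Suc n)))"
      using continuous_map_product_projection[of "Suc n" UNIV ?D] continuous_map_compose by blast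
    then show "continuous_map ?X (?D n) (\<lambda>x. quotient_proj G (\<Gamma> n) (x (Suc n)))"
      by (simp add: comp_def)
    show "continuous_map ?X (?D n) (\<lambda>x. x n)"
      by (rule continuous_map_product_projection) simp
  qed (rule Hausdorff_space_discrete_topology)
  then have "closedin ?X (\<Inter>n. {x \<in> topspace ?X. quotient_proj G (\<Gamma> n) (x (Suc n)) = x n})"
    by (intro closedin_INT) auto
  moreover have "(\<Inter>n. {x \<in> topspace ?X. quotient_proj G (\<Gamma> n) (x (Suc n)) = x n}) = odometer_space G \<Gamma>"
    by (auto simp: odometer_space_def)
  moreover have "compact_space ?X"
    by (simp add: compact_space_product_topology compact_space_discrete_topology finite_quotient)
  ultimately have "compactin ?X (odometer_space G \<Gamma>)"
    by (simp add: closedin_compact_space)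
  then show ?thesis
    unfolding odometer_topology_def by (rule compact_space_subtopology)
qed

lemma profinite_chain_odometer: "profinite_chain (odometer G \<Gamma>) level_kernel (odometer_topology G \<Gamma>)"
proof (intro profinite_chain.intro profinite_chain_axioms.intro group_odometer)
  fix n
  interpret h: group_hom "odometer G \<Gamma>" "G Mod \<Gamma> n" "\<lambda>x. x n" by (rule coordinate_hom)
  show "level_kernel n \<lhd> odometer G \<Gamma>"
    unfolding level_kernel_def by (rule h.normal_kernel)
  \<comment> \<open>Finite index: the coordinate induces an injection of the quotient by
    \<open>level_kernel n\<close> into the finite group \<open>G Mod \<Gamma> n\<close>.\<close>
  have "(\<lambda>X. the_elem ((\<lambda>x. x n) ` X)) ` carrier (odometer G \<Gamma> Mod level_kernel n) \<subseteq> carrier (G Mod \<Gamma> n)"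
    using h.FactGroup_the_elem_mem by (auto simp: level_kernel_def)
  then have "finite ((\<lambda>X. the_elem ((\<lambda>x. x n) ` X)) ` carrier (odometer G \<Gamma> Mod level_kernel n))"
    using finite_quotient finite_subset by blast
  moreover have "inj_on (\<lambda>X. the_elem ((\<lambda>x. x n) ` X)) (carrier (odometer G \<Gamma> Mod level_kernel n))"
    using h.FactGroup_inj_on by (simp add: level_kernel_def)
  ultimately show "finite (rcosets\<^bsub>odometer G \<Gamma>\<^esub> level_kernel n)"
    by (auto simp: FactGroup_def dest: finite_imageD)
next
  show "decseq level_kernel"
  proof (rule decseq_SucI, rule subsetI)
    fix n x assume x: "x \<in> level_kernel (Suc n)"
    then have "x n = quotient_proj G (\<Gamma> n) (\<Gamma> (Suc n))"
      using odometer_space_iff by (metis level_kernel_iff)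
    also have "\<dots> = \<Gamma> n"
      using group_hom.hom_one[OF quotient_proj_hom, of n] by simp
    finally show "x \<in> level_kernel n" using x by (simp add: level_kernel_iff)
  qed
  \<comment> \<open>The unit of \<open>G Mod \<Gamma> n\<close> is the coset
    \<open>\<Gamma> n\<close>, so the unit of the odometer is the sequence \<open>\<Gamma>\<close>
    itself.\<close>
  have one: "\<one>\<^bsub>odometer G \<Gamma>\<^esub> = \<Gamma>"
    by (simp add: odometer_def restrict_UNIV)
  have "\<Gamma> \<in> odometer_space G \<Gamma>"
    using monoid.one_closed[OF group.is_monoid[OF group_odometer]] one by simp
  then show "(\<Inter>n. level_kernel n) = {\<one>\<^bsub>odometer G \<Gamma>\<^esub>}"
    by (auto simp: level_kernel_iff one)
next
  fix S
  show "openin (odometer_topology G \<Gamma>) S \<longleftrightarrow> S \<subseteq> carrier (odometer G \<Gamma>) \<and>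
    (\<forall>x\<in>S. \<exists>n. \<forall>v\<in>level_kernel n. x \<otimes>\<^bsub>odometer G \<Gamma>\<^esub> v \<in> S)"
    unfolding openin_odometer_topology carrier_odometer
    by (auto simp: level_kernel_translate_iff subset_iff)
qed (rule compact_odometer_topology)

text \<open>The group \<open>G\<close> embeds by sending \<open>g\<close> to the sequence of its
  cosets; injectivity is the trivial intersection of the scale.\<close>

lemma infinite_odometer:
  assumes "infinite (carrier G)"
  shows "infinite (carrier (odometer G \<Gamma>))"
proof -
  let ?e = "\<lambda>g n. \<Gamma> n #> g"
  have sub: "subgroup (\<Gamma> n) G" for n using normal_imp_subgroup[OF normal_scale] .
  have "?e ` carrier G \<subseteq> carrier (odometer G \<Gamma>)"
    using quotient_proj_rcoset[OF normal_scale normal_scale scale_Suc]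
    by (auto simp: odometer_space_iff carrier_FactGroup)
  moreover have "inj_on ?e (carrier G)"
  proof (rule inj_onI)
    fix g h assume gh: "g \<in> carrier G" "h \<in> carrier G" "?e g = ?e h"
    have "g \<otimes> inv h \<in> \<Gamma> n" for n
    proof -
      have "g \<in> \<Gamma> n #> h"
        using rcos_self[OF gh(1) sub[of n]] fun_cong[OF gh(3), of n] by simp
      then show ?thesis
        using subgroup.rcos_module_imp[OF sub is_group gh(2)] by blast
    qed
    then have "g \<otimes> inv h = \<one>"
      using scale by (auto simp: group_scale_def)
    then show "g = h"
      using gh by (metis inv_equality inv_inv inv_closed)
  qed
  ultimately show ?thesis
    using assms finite_subset finite_imageD by blast
qed

end

theorem theorem1p1:
  fixes G :: "('a, 'm) monoid_scheme" and H :: "('b, 'n) monoid_scheme"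
    and \<Gamma> :: "nat \<Rightarrow> 'a set" and \<Delta> :: "nat \<Rightarrow> 'b set"
  assumes "group G" "infinite (carrier G)"
    "finitely_generated_group G" "residually_finite_group G"
  assumes "group H" "infinite (carrier H)"
    "finitely_generated_group H" "residually_finite_group H"
  assumes "group_scale G \<Gamma>" "group_scale H \<Delta>"
  defines "OX \<equiv> odometer G \<Gamma>" and "TX \<equiv> odometer_topology G \<Gamma>"
    and "OY \<equiv> odometer H \<Delta>" and "TY \<equiv> odometer_topology H \<Delta>"
  shows "(topological_full_group TX (carrier OX) (left_action OX) \<cong> topological_full_group TY (carrier OY) (left_action OY)
            \<longleftrightarrow>
          topological_full_group TX (carrier OX) (right_action OX) \<cong> topological_full_group TY (carrier OY) (right_action OY))
       \<and> (topological_full_group TX (carrier OX) (right_action OX) \<cong> topological_full_group TY (carrier OY) (right_action OY)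
            \<longleftrightarrow>
          (\<exists>U1 U2. clopen_subgroup U1 OX TX \<and> clopen_subgroup U2 OY TY \<and>
             topological_group_isomorphic
               (OX\<lparr>carrier := U1\<rparr>) (subtopology TX U1) (OY\<lparr>carrier := U2\<rparr>) (subtopology TY U2) \<and>
             finite (rcosets\<^bsub>OX\<^esub> U1) \<and> finite (rcosets\<^bsub>OY\<^esub> U2) \<and>
             card (rcosets\<^bsub>OX\<^esub> U1) = card (rcosets\<^bsub>OY\<^esub> U2)))"
    (is "(?L \<longleftrightarrow> ?R) \<and> (?R \<longleftrightarrow> ?S)")
proof -
  interpret G: scaled_group G \<Gamma>
    using assms by (simp add: scaled_group_def scaled_group_axioms_def)
  interpret H: scaled_group H \<Delta>
    using assms by (simp add: scaled_group_def scaled_group_axioms_def)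
  interpret X: profinite_chain OX G.level_kernel TX
    unfolding OX_def TX_def by (rule G.profinite_chain_odometer)
  interpret Y: profinite_chain OY H.level_kernel TY
    unfolding OY_def TY_def by (rule H.profinite_chain_odometer)
  interpret XY: profinite_chain_pair OX G.level_kernel TX OY H.level_kernel TY ..
  have inf: "infinite (carrier OX)" "infinite (carrier OY)"
    unfolding OX_def OY_def using G.infinite_odometer H.infinite_odometer assms by blast+
  have "?L \<longleftrightarrow> ?R"
    using X.left_right_full_group_iso Y.left_right_full_group_iso by (meson iso_trans)
  moreover have "?L \<longleftrightarrow> ?S"
    using XY.ex_isomorphic_subgroups_if_full_groups_iso[OF inf] XY.full_groups_iso_if_subgroups_iso
    by blast
  ultimately show ?thesis by blast
qed

end
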